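(* Let $k\ge 3$ be an integer and $r\in(r_{core}(k),r_{sat}(k))$. Let $\tau$ be a local rule of some fixed even radius $R\ge 0$, and let $\mathbf{\Phi}\sim\mathbf{\Phi}_k(n,rn)$. If the $\tau$-decimation algorithm $\mathtt{DEC}_\tau$ is strictly $2\mu(k,r)$-free on $\mathbf{\Phi}$, then $$\lim_{n\to\infty}\Pr\big[\mathtt{DEC}_\tau(\mathbf{\Phi})\in\mathcal{S}(\mathbf{\Phi})\big]=0,$$ where $\mu(k,r)=\exp(-krQ^{k-1})+krQ^{k-1}\exp(-krQ^{k-1})$ and $Q$ is the largest solution of $Q=1-\exp(-krQ^{k-1})$.
   Context: A $k$-XORSAT instance on Boolean variables $x_1,\dots,x_n$ is a set of clauses, each a $GF(2)$ equation $x_{j_1}\oplus\cdots\oplus x_{j_k}=b$. An assignment is $\sigma\in\{0,1\}^n$; $\mathcal{S}(\Phi)$ is the set of assignments satisfying all clauses; distance is Hamming distance. $\mathbf{\Phi}\sim\mathbf{\Phi}_k(n,m)$ means each of $m$ clauses is drawn independently and uniformly among all $2\binom{n}{k}$ possibilities (uniform $k$-subset of variables, uniform right-hand side bit). "W.h.p." means with probability tending to $1$ as $n\to\infty$. The factor graph of an instance is bipartite with a node per variable and per clause, and an edge when the variable occurs in the clause; distance is graph distance. For a variable $x$ and even $R\ge 0$, $B_\Phi(x,R)$ is the sub-instance induced by all nodes at distance $\le R$ from $x$, rooted at $x$. A local rule of radius $R$ is a function $\tau$ from such rooted instances to $[0,1]$. The $\tau$-decimation algorithm $\mathtt{DEC}_\tau$: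 set $\Phi_0=\Phi$; for $t=0,\dots,n-1$, select an unassigned variable $x^*$ of $\Phi_t$ uniformly at random, set $\sigma(x^* )=1$ with probability $\tau(B_{\Phi_t}(x^*,R))$ and $0$ otherwise (independent randomness), then obtain $\Phi_{t+1}$ by removing $x^*$, adding $\sigma(x^* )$ to the right-hand side of every clause that contained $x^*$, and deleting clauses with no remaining variables; output $\sigma$. An iteration is a free step if the value of $\tau$ in it equals $1/2$. $\mathtt{DEC}_\tau$ is $\delta$-free on $\mathbf{\Phi}$ if w.h.p. it has at least $\delta n$ free steps, and strictly $\delta$-free if it is $\delta'$-free for some $\delta'>\delta$. $r_{core}(k)=\sup\{r\in[0,1]: Q>1-e^{-krQ^{k-1}}\ \forall Q\in(0,1)\}$. $r_{sat}(k)$ is the satisfiability threshold: the constant (known to exist, with $r_{core}(k)<r_{sat}(k)$) such that $\mathbf{\Phi}_k(n,rn)$ is satisfiable w.h.p. for $r<r_{sat}(k)$ and unsatisfiable w.h.p. for $r>r_{sat}(k)$. *)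

theory Defs
  imports
    "HOL-Probability.Probability"
    "HOL-Library.Z2"
    "HOL-Library.Extended_Nat"
    "HOL-Library.Monad_Syntax"
begin

text \<open>
  A clause \<open>(S, b)\<close> is the equation \<open>\<Sum>x\<in>S. x = b\<close> over GF(2), the field \<open>bit\<close>. Clauses
  form a multiset because independent sampling and decimation can produce repetitions; each
  occurrence is a clause node of its own in the factor graph.
\<close>

type_synonym clause = "nat set \<times> bit"

record xorsat =
  vars :: "nat set"
  clauses :: "clause multiset"

definition xorsat_instance :: "xorsat \<Rightarrow> bool" where
  "xorsat_instance \<Phi> \<longleftrightarrow>
     finite (vars \<Phi>) \<and> (\<forall>(S, b) \<in># clauses \<Phi>. S \<noteq> {} \<and> S \<subseteq> vars \<Phi>)"

definition solutions :: "xorsat \<Rightarrow> (nat \<Rightarrow> bit) set" where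
  "solutions \<Phi> = {\<sigma> \<in> vars \<Phi> \<rightarrow>\<^sub>E UNIV. \<forall>(S, b) \<in># clauses \<Phi>. (\<Sum>x\<in>S. \<sigma> x) = b}"

definition satisfiable :: "xorsat \<Rightarrow> bool" where
  "satisfiable \<Phi> \<longleftrightarrow> solutions \<Phi> \<noteq> {}"

text \<open>For \<open>n < k\<close> there are no clauses to draw from and the distribution is unspecified.\<close>

definition rand_clause :: "nat \<Rightarrow> nat \<Rightarrow> clause pmf" where
  "rand_clause k n = pmf_of_set ({S. S \<subseteq> {1..n} \<and> card S = k} \<times> UNIV)"

definition rand_xorsat :: "nat \<Rightarrow> nat \<Rightarrow> nat \<Rightarrow> xorsat pmf" where
  "rand_xorsat k n m =
     map_pmf (\<lambda>cs. \<lparr>vars = {1..n}, clauses = mset cs\<rparr>) (replicate_pmf m (rand_clause k n))"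

definition rand_xorsat_density :: "nat \<Rightarrow> real \<Rightarrow> nat \<Rightarrow> xorsat pmf" where
  "rand_xorsat_density k r n = rand_xorsat k n (nat \<lfloor>r * real n\<rfloor>)"

definition whp :: "(nat \<Rightarrow> 'a pmf) \<Rightarrow> (nat \<Rightarrow> 'a \<Rightarrow> bool) \<Rightarrow> bool" where
  "whp P E \<longleftrightarrow> (\<lambda>n. measure_pmf.prob (P n) {\<omega>. E n \<omega>}) \<longlonglongrightarrow> 1"

text \<open>\<open>ClauseNode c i\<close> stands for the \<open>i\<close>-th occurrence of the clause \<open>c\<close>.\<close>

datatype node = VarNode nat | ClauseNode clause nat

definition nodes :: "xorsat \<Rightarrow> node set" where
  "nodes \<Phi> = VarNode ` vars \<Phi> \<union> {ClauseNode c i |c i. i < count (clauses \<Phi>) c}"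

definition edges :: "xorsat \<Rightarrow> (node \<times> node) set" where
  "edges \<Phi> =
     (let E = {(VarNode x, ClauseNode c i) |x c i.
                 x \<in> vars \<Phi> \<and> i < count (clauses \<Phi>) c \<and> x \<in> fst c}
      in E \<union> E\<inverse>)"

definition graph_dist :: "('v \<times> 'v) set \<Rightarrow> 'v \<Rightarrow> 'v \<Rightarrow> enat" where
  "graph_dist E u v = Inf {enat d |d. (u, v) \<in> E ^^ d}"

definition induced :: "xorsat \<Rightarrow> node set \<Rightarrow> xorsat" where
  "induced \<Phi> N =
     (let V = {x. VarNode x \<in> N}
      in \<lparr>vars = V,
          clauses = image_mset (\<lambda>((S, b), i). (S \<inter> V, b)) (mset_set {(c, i). ClauseNode c i \<in> N})\<rparr>)"

type_synonym rooted_xorsat = "xorsat \<times> nat"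

definition nbhd :: "xorsat \<Rightarrow> nat \<Rightarrow> nat \<Rightarrow> rooted_xorsat" where
  "nbhd \<Phi> x R =
     (induced \<Phi> {v \<in> nodes \<Phi>. graph_dist (edges \<Phi>) (VarNode x) v \<le> enat R}, x)"

definition rooted_instances :: "nat \<Rightarrow> rooted_xorsat set" where
  "rooted_instances R = {nbhd \<Phi> x R |\<Phi> x. xorsat_instance \<Phi> \<and> x \<in> vars \<Phi>}"

definition local_rule :: "nat \<Rightarrow> (rooted_xorsat \<Rightarrow> real) \<Rightarrow> bool" where
  "local_rule R \<tau> \<longleftrightarrow> \<tau> \<in> rooted_instances R \<rightarrow> {0..1}"

definition decimate :: "xorsat \<Rightarrow> nat \<Rightarrow> bit \<Rightarrow> xorsat" where
  "decimate \<Phi> x a =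
     \<lparr>vars = vars \<Phi> - {x},
      clauses = filter_mset (\<lambda>(S, b). S \<noteq> {})
        (image_mset (\<lambda>(S, b). if x \<in> S then (S - {x}, b + a) else (S, b)) (clauses \<Phi>))\<rparr>"

text \<open>
  A state consists of the current instance, the partial assignment (\<open>undefined\<close> where nothing
  has been assigned yet) and the number of free steps so far.
\<close>

type_synonym dec_state = "xorsat \<times> (nat \<Rightarrow> bit) \<times> nat"

definition dec_step :: "(rooted_xorsat \<Rightarrow> real) \<Rightarrow> nat \<Rightarrow> dec_state \<Rightarrow> dec_state pmf" where
  "dec_step \<tau> R = (\<lambda>(\<Phi>, \<sigma>, f). do {
     x \<leftarrow> pmf_of_set (vars \<Phi>);
     let p = \<tau> (nbhd \<Phi> x R);
     one \<leftarrow> bernoulli_pmf p;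
     let a = (if one then 1 else 0);
     return_pmf (decimate \<Phi> x a, \<sigma>(x := a), if p = 1 / 2 then Suc f else f)
   })"

primrec dec_run :: "(rooted_xorsat \<Rightarrow> real) \<Rightarrow> nat \<Rightarrow> xorsat \<Rightarrow> nat \<Rightarrow> dec_state pmf" where
  "dec_run \<tau> R \<Phi> 0 = return_pmf (\<Phi>, (\<lambda>_. undefined), 0)"
| "dec_run \<tau> R \<Phi> (Suc t) = bind_pmf (dec_run \<tau> R \<Phi> t) (dec_step \<tau> R)"

text \<open>Output assignment together with the total number of free steps.\<close>

definition dec :: "(rooted_xorsat \<Rightarrow> real) \<Rightarrow> nat \<Rightarrow> xorsat \<Rightarrow> ((nat \<Rightarrow> bit) \<times> nat) pmf" where
  "dec \<tau> R \<Phi> = map_pmf snd (dec_run \<tau> R \<Phi> (card (vars \<Phi>)))"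

definition dec_on ::
    "(rooted_xorsat \<Rightarrow> real) \<Rightarrow> nat \<Rightarrow> xorsat pmf \<Rightarrow> (xorsat \<times> (nat \<Rightarrow> bit) \<times> nat) pmf" where
  "dec_on \<tau> R P = do {\<Phi> \<leftarrow> P; (\<sigma>, f) \<leftarrow> dec \<tau> R \<Phi>; return_pmf (\<Phi>, \<sigma>, f)}"

definition dec_free :: "(rooted_xorsat \<Rightarrow> real) \<Rightarrow> nat \<Rightarrow> (nat \<Rightarrow> xorsat pmf) \<Rightarrow> real \<Rightarrow> bool" where
  "dec_free \<tau> R P \<delta> \<longleftrightarrow> whp (\<lambda>n. dec_on \<tau> R (P n)) (\<lambda>n (\<Phi>, \<sigma>, f). real f \<ge> \<delta> * real n)"

definition dec_strictly_free ::
    "(rooted_xorsat \<Rightarrow> real) \<Rightarrow> nat \<Rightarrow> (nat \<Rightarrow> xorsat pmf) \<Rightarrow> real \<Rightarrow> bool" where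
  "dec_strictly_free \<tau> R P \<delta> \<longleftrightarrow> (\<exists>\<delta>'>\<delta>. dec_free \<tau> R P \<delta>')"

definition r_core :: "nat \<Rightarrow> real" where
  "r_core k = Sup {r \<in> {0..1}. \<forall>Q\<in>{0<..<1}. Q > 1 - exp (- real k * r * Q ^ (k - 1))}"

text \<open>At most one \<open>s\<close> has this property. The range \<open>r \<ge> 0\<close> leaves out negative densities, which
  \<open>nat\<close> would truncate to \<open>0\<close> clauses.\<close>

definition is_sat_threshold :: "nat \<Rightarrow> real \<Rightarrow> bool" where
  "is_sat_threshold k s \<longleftrightarrow>
     (\<forall>r\<ge>0. r < s \<longrightarrow> whp (rand_xorsat_density k r) (\<lambda>n \<Phi>. satisfiable \<Phi>)) \<and>
     (\<forall>r\<ge>0. r > s \<longrightarrow> whp (rand_xorsat_density k r) (\<lambda>n \<Phi>. \<not> satisfiable \<Phi>))"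

definition Q_max :: "nat \<Rightarrow> real \<Rightarrow> real" where
  "Q_max k r = (GREATEST Q. Q = 1 - exp (- real k * r * Q ^ (k - 1)))"

definition \<mu> :: "nat \<Rightarrow> real \<Rightarrow> real" where
  "\<mu> k r =
     (let c = real k * r * Q_max k r ^ (k - 1)
      in exp (- c) + c * exp (- c))"

end

theory Submission
  imports Defs
begin

text \<open>
  Fix the instance and the order in which the variables are processed. Then the run is a function
  of independent coins, and for most variables the output is determined by the coins in a ball of
  bounded radius: an influence has to travel along a chain of nearby variables that is monotone in
  the random order, and a fixed chain of length \<open>l\<close> is monotone with probability at most \<open>2 / l!\<close>.
  Hence the number of variables in violated clauses has variance \<open>o(n\<^sup>2)\<close>, and if the run succeeds
  with probability bounded away from \<open>0\<close>, then the expected number of violations is \<open>o(n)\<close>.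

  In that case, flipping the coin of a free step changes the output, typically, from one assignment
  that satisfies all nearby clauses to another. The two differ on a bounded set which contains
  the free variable and which no clause meets in exactly one variable. A variable
  in a bounded set of this kind has a finite witness in its neighbourhood, and the density of such
  variables is at most any solution \<open>q\<close> of \<open>q = exp (- k r (1 - q) ^ (k - 1))\<close>; take \<open>q = 1 - Q\<close>
  for the largest fixed point \<open>Q\<close>. So there are at most \<open>(q + o(1)) n\<close> free steps, while
  \<open>q \<le> \<mu> < 2 \<mu>\<close>.
\<close>

section \<open>Balls and witnesses in hypergraphs\<close>

text \<open>A single flip can destroy success, so success itself cannot be compared before and after
  a flip. Concentration trades it for the mean number of variables in violated clauses, which is a
  sum of local terms and is treated by linearity and the flip invariance of the coins.

  The obstacle to locality is that degrees are unbounded, so balls and chains have no worst-case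
  size. Sizes are therefore controlled through exponential moments of balls, and chains are cut at
  the first vertex with a large neighbourhood. A ball of radius h in the hypergraph of clause
  supports corresponds to distance 2 h in the factor graph.

  The equation for q comes from a branching process: a vertex lies in Poisson many edges with mean k
  r, and each of them fails to contain another witness with probability (1 - q) ^ (k - 1). With c =
  k r Q ^ (k - 1), a Poisson variable of mean c vanishes with probability 1 - Q and is at most 1
  with probability \<mu>, whence q \<le> \<mu>.\<close>

primrec hball :: "'a set set \<Rightarrow> nat \<Rightarrow> 'a set \<Rightarrow> 'a set" where
  "hball E 0 A = A"
| "hball E (Suc h) A = hball E h A \<union> \<Union>{e \<in> E. e \<inter> hball E h A \<noteq> {}}"

lemma hball_mono: "E \<subseteq> E' \<Longrightarrow> A \<subseteq> A' \<Longrightarrow> hball E h A \<subseteq> hball E' h A'"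
proof (induction h)
  case (Suc h)
  then have *: "hball E h A \<subseteq> hball E' h A'" by simp
  show ?case
  proof
    fix y assume "y \<in> hball E (Suc h) A"
    then consider "y \<in> hball E h A" | e z where "e \<in> E" "y \<in> e" "z \<in> e" "z \<in> hball E h A" by auto
    then show "y \<in> hball E' (Suc h) A'" using * Suc.prems(1) by cases auto
  qed
qed simp

lemma hball_extensive: "A \<subseteq> hball E h A"
  by (induction h) auto

lemma hball_radius_mono: "h \<le> h' \<Longrightarrow> hball E h A \<subseteq> hball E h' A"
  by (induction rule: dec_induct) auto

lemma hball_subset: "A \<subseteq> V \<Longrightarrow> \<Union>E \<subseteq> V \<Longrightarrow> hball E h A \<subseteq> V"
  by (induction h) auto

lemma hball_hball: "hball E a (hball E b A) = hball E (a + b) A"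
  by (induction a) auto

lemma hball_Suc_center: "hball E (Suc h) A = hball E h (hball E 1 A)"
  by (simp only: hball_hball) simp

lemma hball_1: "y \<in> hball E 1 {x} \<longleftrightarrow> y = x \<or> (\<exists>e\<in>E. x \<in> e \<and> y \<in> e)"
  by auto

lemma hball_sym: "y \<in> hball E h {x} \<Longrightarrow> x \<in> hball E h {y}"
proof (induction h arbitrary: y)
  case (Suc h)
  show ?case
  proof (cases "y \<in> hball E h {x}")
    case True
    then show ?thesis using Suc.IH hball_radius_mono[of h "Suc h" E "{y}"] by auto
  next
    case False
    then obtain e z where e: "e \<in> E" "y \<in> e" "z \<in> e" "z \<in> hball E h {x}" using Suc.prems by auto
    then have "x \<in> hball E h {z}" using Suc.IH by blast
    moreover have "{z} \<subseteq> hball E 1 {y}" using e by auto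
    ultimately have "x \<in> hball E h (hball E 1 {y})"
      using hball_mono[of E E "{z}" "hball E 1 {y}" h] by blast
    then show ?thesis by (simp only: hball_Suc_center)
  qed
qed simp

lemma hball_trans: "y \<in> hball E a {x} \<Longrightarrow> z \<in> hball E b {y} \<Longrightarrow> z \<in> hball E (a + b) {x}"
  using hball_mono[of E E "{y}" "hball E a {x}" b] by (auto simp: hball_hball add.commute)

text \<open>Breadth-first exploration: the edges meeting A are uncovered, and the ball grows on from
  their union through edges not yet inspected. Removing the inspected edges is what allows the rest
  to be treated as a fresh sample in \<open>hball_mgf\<close>.\<close>

lemma hball_touching_subset:
  defines "T A \<equiv> \<lambda>E. {e \<in> E. e \<inter> A \<noteq> {}}"
  shows "hball E (Suc h) A \<subseteq> A \<union> hball (E - T A E) h (\<Union>(T A E))"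
proof -
  have "hball E h (A \<union> \<Union>(T A E)) \<subseteq> A \<union> hball (E - T A E) h (\<Union>(T A E))"
  proof (induction h)
    case (Suc h)
    show ?case
    proof
      fix y assume y: "y \<in> hball E (Suc h) (A \<union> \<Union>(T A E))"
      consider "y \<in> hball E h (A \<union> \<Union>(T A E))"
        | e z where "e \<in> E" "y \<in> e" "z \<in> e" "z \<in> hball E h (A \<union> \<Union>(T A E))" using y by auto
      then show "y \<in> A \<union> hball (E - T A E) (Suc h) (\<Union>(T A E))"
      proof cases
        case 1
        then show ?thesis using Suc.IH by auto
      next
        case (2 e z)
        show ?thesis
        proof (cases "e \<in> T A E")
          case True
          then show ?thesis using 2 hball_extensive[of "\<Union>(T A E)" "E - T A E" "Suc h"] by blast
        next
          case False
          then have "e \<inter> A = {}" using 2 by (auto simp: T_def)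
          then have "z \<in> hball (E - T A E) h (\<Union>(T A E))" using 2 Suc.IH by auto
          then show ?thesis using 2 False by auto
        qed
      qed
    qed
  qed simp
  moreover have "hball E 1 A = A \<union> \<Union>(T A E)" by (auto simp: T_def)
  ultimately show ?thesis by (simp only: hball_Suc_center)
qed

text \<open>
  \<open>wit E L x\<close>: every edge at \<open>x\<close> contains a further vertex with a witness of depth \<open>L - 1\<close> in the
  hypergraph without the edges at \<open>x\<close>. On a tree this says that peeling off edges with a vertex of
  degree 1 removes all edges at \<open>x\<close> within \<open>L\<close> rounds. Depth \<open>0\<close> never suffices, not even for an
  isolated vertex.
\<close>

primrec wit :: "'a set set \<Rightarrow> nat \<Rightarrow> 'a \<Rightarrow> bool" where
  "wit E 0 x \<longleftrightarrow> False"
| "wit E (Suc L) x \<longleftrightarrow> (\<forall>e\<in>E. x \<in> e \<longrightarrow> (\<exists>y\<in>e - {x}. wit {e\<in>E. x \<notin> e} L y))"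

lemma wit_antimono: "E \<subseteq> E' \<Longrightarrow> wit E' L x \<Longrightarrow> wit E L x"
proof (induction L arbitrary: E E' x)
  case (Suc L)
  have "{e\<in>E. x \<notin> e} \<subseteq> {e\<in>E'. x \<notin> e}" using Suc.prems by auto
  note IH = Suc.IH[OF this]
  show ?case unfolding wit.simps
  proof (intro ballI impI)
    fix e assume "e \<in> E" "x \<in> e"
    then obtain y where "y \<in> e - {x}" "wit {e\<in>E'. x \<notin> e} L y" using Suc.prems by auto
    then show "\<exists>y\<in>e - {x}. wit {e\<in>E. x \<notin> e} L y" using IH by blast
  qed
qed simp

text \<open>As long as y lies outside c, the edge that spoils its witness is an old one, and c
  survives the removal of the edges at y; so c spoils a witness one level deeper, and after at most
  L such steps it is met. This confines the effect of one clause to a ball.\<close>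

lemma wit_insert_local:
  "wit E L y \<Longrightarrow> \<not> wit (insert c E) L y \<Longrightarrow> y \<in> hball E L c"
proof (induction L arbitrary: E y)
  case (Suc L)
  from Suc.prems(2) obtain e where e: "e \<in> insert c E" "y \<in> e"
    "\<And>z. z \<in> e - {y} \<Longrightarrow> \<not> wit {e\<in>insert c E. y \<notin> e} L z" by auto
  show ?case
  proof (cases "y \<in> c")
    case True
    then show ?thesis using hball_extensive[of c E "Suc L"] by blast
  next
    case False
    then have "e \<in> E" using e by auto
    then obtain z where z: "z \<in> e - {y}" "wit {e\<in>E. y \<notin> e} L z" using Suc.prems(1) e by auto
    have "{e\<in>insert c E. y \<notin> e} = insert c {e\<in>E. y \<notin> e}" using False by auto
    then have "z \<in> hball {e\<in>E. y \<notin> e} L c" using Suc.IH[OF z(2)] e(3)[OF z(1)] by simp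
    then have "z \<in> hball E L c" using hball_mono[of "{e\<in>E. y \<notin> e}" E c c L] by auto
    then show ?thesis using z e \<open>e \<in> E\<close> by auto
  qed
qed simp

text \<open>These are the stopping sets known from peeling decoders of erasure codes: no edge meets
  S in exactly one vertex. The difference of two assignments that satisfy all clauses meeting it has
  this property, by parity.\<close>

definition stopping :: "'a set set \<Rightarrow> 'a set \<Rightarrow> bool" where
  "stopping E S \<longleftrightarrow> (\<forall>e\<in>E. \<forall>x\<in>e \<inter> S. \<exists>y\<in>e \<inter> S. y \<noteq> x)"

text \<open>
  If \<open>x\<close> has no witness, then some edge at \<open>x\<close> leads to another vertex of \<open>S\<close> without a witness
  of depth \<open>L - 1\<close>. Iterating gives a self-avoiding path of \<open>L + 1\<close> vertices in \<open>S\<close>, so that no assumption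
  on cycles is needed.
\<close>

lemma stopping_card:
  "finite S \<Longrightarrow> stopping E S \<Longrightarrow> x \<in> S \<Longrightarrow> \<not> wit E L x \<Longrightarrow> L < card S"
proof (induction L arbitrary: E S x)
  case 0
  then show ?case using card_gt_0_iff by blast
next
  case (Suc L)
  from Suc.prems(4) obtain e
    where e: "e \<in> E" "x \<in> e" "\<And>y. y \<in> e - {x} \<Longrightarrow> \<not> wit {e\<in>E. x \<notin> e} L y" by auto
  then obtain y where y: "y \<in> e \<inter> S" "y \<noteq> x" using Suc.prems(2,3) unfolding stopping_def by blast
  have "stopping {e\<in>E. x \<notin> e} (S - {x})" using Suc.prems(2) unfolding stopping_def by blast
  then have "L < card (S - {x})" using Suc.IH[of "S - {x}" "{e\<in>E. x \<notin> e}" y] y e Suc.prems by auto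
  then show ?case using Suc.prems by (simp add: card_Diff_singleton)
qed

section \<open>Expectation over finitely supported distributions\<close>

abbreviation (input) "EV p \<equiv> measure_pmf.expectation p"
abbreviation (input) "iid \<equiv> replicate_pmf"
abbreviation (input) "rcard A \<equiv> real (card A)"
abbreviation (input) "PR p \<equiv> measure_pmf.prob p"

lemma EV_bind:
  assumes "finite (set_pmf p)" "\<And>x. x \<in> set_pmf p \<Longrightarrow> finite (set_pmf (q x))"
  shows "EV (bind_pmf p q) f = EV p (\<lambda>x. EV (q x) f :: real)"
  by (subst pmf_expectation_bind[OF assms(1)])
     (use assms in \<open>auto simp: integral_measure_pmf[OF assms(1)]\<close>)

lemma EV_mono:
  fixes f g :: "_ \<Rightarrow> real"
  assumes "finite (set_pmf p)" "\<And>x. x \<in> set_pmf p \<Longrightarrow> f x \<le> g x"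
  shows "EV p f \<le> EV p g"
  using assms by (intro integral_mono_AE) (auto simp: AE_measure_pmf_iff integrable_measure_pmf_finite)

lemma EV_le:
  assumes "finite (set_pmf p)" "\<And>x. x \<in> set_pmf p \<Longrightarrow> f x \<le> (c :: real)"
  shows "EV p f \<le> c"
  using EV_mono[of p f "\<lambda>_. c"] assms by simp

lemma EV_ge:
  assumes "finite (set_pmf p)" "\<And>x. x \<in> set_pmf p \<Longrightarrow> (c :: real) \<le> f x"
  shows "c \<le> EV p f"
  using EV_mono[of p "\<lambda>_. c" f] assms by simp

lemma EV_cong: "(\<And>x. x \<in> set_pmf p \<Longrightarrow> f x = (g x :: real)) \<Longrightarrow> EV p f = EV p g"
  by (intro integral_cong_AE) (auto simp: AE_measure_pmf_iff)

lemma EV_add: "finite (set_pmf p) \<Longrightarrow> EV p (\<lambda>x. f x + g x) = EV p f + (EV p g :: real)"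
  by (intro Bochner_Integration.integral_add) (auto simp: integrable_measure_pmf_finite)

lemma EV_diff: "finite (set_pmf p) \<Longrightarrow> EV p (\<lambda>x. f x - g x) = EV p f - (EV p g :: real)"
  by (intro Bochner_Integration.integral_diff) (auto simp: integrable_measure_pmf_finite)

lemma EV_sum: "finite (set_pmf p) \<Longrightarrow> EV p (\<lambda>x. \<Sum>i\<in>I. f i x) = (\<Sum>i\<in>I. EV p (f i) :: real)"
  by (intro Bochner_Integration.integral_sum) (auto simp: integrable_measure_pmf_finite)

lemma EV_indicator: "PR p A = EV p (indicator A)"
  by simp

lemma EV_of_bool: "PR p {x. P x} = EV p (\<lambda>x. of_bool (P x))"
  unfolding EV_indicator by (intro EV_cong) (simp add: indicator_def)

lemma EV_commute:
  assumes "finite (set_pmf p)" "finite (set_pmf q)"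
  shows "EV p (\<lambda>x. EV q (\<lambda>y. f x y)) = EV q (\<lambda>y. EV p (\<lambda>x. f x y :: real))"
proof -
  have fin: "EV p g = (\<Sum>x\<in>set_pmf p. pmf p x * g x)" "EV q h = (\<Sum>x\<in>set_pmf q. pmf q x * h x)"
    for g h :: "_ \<Rightarrow> real"
    by (subst integral_measure_pmf[where A = "set_pmf p"] integral_measure_pmf[where A = "set_pmf q"];
        use assms in auto)+
  show ?thesis
    unfolding fin sum_distrib_left by (subst sum.swap) (simp add: mult_ac)
qed

lemma EV_Markov:
  assumes "finite (set_pmf p)" "\<And>x. x \<in> set_pmf p \<Longrightarrow> 0 \<le> (f x :: real)" "a > 0"
  shows "PR p {x. a \<le> f x} \<le> EV p f / a"
proof -
  have "EV p (\<lambda>x. a * of_bool (a \<le> f x)) \<le> EV p f"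
    using assms by (intro EV_mono) auto
  then show ?thesis using assms by (simp add: EV_of_bool field_simps)
qed

lemma EV_square_le:
  fixes f :: "_ \<Rightarrow> real"
  assumes "finite (set_pmf p)"
  shows "(EV p f)\<^sup>2 \<le> EV p (\<lambda>x. (f x)\<^sup>2)"
proof -
  define a where "a = EV p f"
  have "0 \<le> EV p (\<lambda>x. (f x - a)\<^sup>2)" by (intro integral_nonneg_AE) auto
  also have "\<dots> = EV p (\<lambda>x. (f x)\<^sup>2 + (a\<^sup>2 - 2 * a * f x))"
    by (intro EV_cong) (simp add: power2_eq_square algebra_simps)
  also have "\<dots> = EV p (\<lambda>x. (f x)\<^sup>2) + (a\<^sup>2 - 2 * a * a)"
    by (simp add: EV_add EV_diff assms a_def)
  finally show ?thesis by (simp add: a_def power2_eq_square)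
qed

section \<open>Variance and Chebyshev's inequality\<close>

definition Var :: "'a pmf \<Rightarrow> ('a \<Rightarrow> real) \<Rightarrow> real" where
  "Var p f = EV p (\<lambda>x. (f x)\<^sup>2) - (EV p f)\<^sup>2"

lemma Var_le:
  assumes "finite (set_pmf p)"
  shows "Var p f \<le> EV p (\<lambda>x. (f x - a)\<^sup>2)"
proof -
  have "EV p (\<lambda>x. (f x - a)\<^sup>2) = EV p (\<lambda>x. (f x)\<^sup>2 + (a\<^sup>2 - 2 * a * f x))"
    by (intro EV_cong) (simp add: power2_eq_square algebra_simps)
  also have "\<dots> = EV p (\<lambda>x. (f x)\<^sup>2) + (a\<^sup>2 - 2 * a * EV p f)"
    by (simp add: EV_add EV_diff assms)
  also have "\<dots> - Var p f = (EV p f - a)\<^sup>2"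
    by (simp add: Var_def power2_eq_square algebra_simps)
  finally show ?thesis by (smt (verit) zero_le_power2)
qed

lemma Var_eq:
  assumes "finite (set_pmf p)"
  shows "Var p f = EV p (\<lambda>x. (f x - EV p f)\<^sup>2)"
proof -
  define a where "a = EV p f"
  have "EV p (\<lambda>x. (f x - a)\<^sup>2) = EV p (\<lambda>x. (f x)\<^sup>2 + (a\<^sup>2 - 2 * a * f x))"
    by (intro EV_cong) (simp add: power2_eq_square algebra_simps)
  also have "\<dots> = EV p (\<lambda>x. (f x)\<^sup>2) + (a\<^sup>2 - 2 * a * a)"
    by (simp add: EV_add EV_diff assms a_def)
  finally show ?thesis by (simp add: Var_def a_def power2_eq_square)
qed

lemma Chebyshev:
  assumes "finite (set_pmf p)" "a > 0"
  shows "PR p {x. a \<le> \<bar>f x - EV p f\<bar>} \<le> Var p f / a\<^sup>2"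
proof -
  have "{x. a \<le> \<bar>f x - EV p f\<bar>} = {x. a\<^sup>2 \<le> (f x - EV p f)\<^sup>2}"
    using assms(2) by (auto simp: abs_le_square_iff[symmetric])
  then show ?thesis
    using EV_Markov[of p "\<lambda>x. (f x - EV p f)\<^sup>2" "a\<^sup>2"] assms by (simp add: Var_eq)
qed

section \<open>Lists of independent samples\<close>

lemma finite_set_replicate_pmf [simp]:
  "finite (set_pmf p) \<Longrightarrow> finite (set_pmf (iid m p))"
  using finite_lists_length_eq[of "set_pmf p" m]
  by (auto simp: set_replicate_pmf lists_eq_set elim!: finite_subset[rotated])

lemma EV_replicate_Suc:
  assumes "finite (set_pmf D)"
  shows "EV (iid (Suc m) D) f = EV D (\<lambda>c. EV (iid m D) (\<lambda>cs. f (c # cs) :: real))"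
  using assms by (simp add: EV_bind)

lemma EV_replicate_snoc:
  assumes "finite (set_pmf D)"
  shows "EV (iid (Suc m) D) f = EV (iid m D) (\<lambda>cs. EV D (\<lambda>c. f (cs @ [c]) :: real))"
proof -
  have "iid (Suc m) D = iid m D \<bind> (\<lambda>xs. D \<bind> (\<lambda>c. return_pmf (xs @ [c])))"
    using replicate_pmf_distrib[of m 1 D] by (simp add: bind_assoc_pmf bind_return_pmf)
  then show ?thesis using assms by (simp add: EV_bind)
qed

text \<open>
  A form of the Efron--Stein inequality in which the comparison list omits an entry. The prefix \<open>ps\<close>
  is only there to make the induction work.
\<close>

lemma efron_stein:
  fixes f :: "'a list \<Rightarrow> real"
  assumes D: "finite (set_pmf D)"
    and B: "\<And>i j. Suc (i + j) = M \<Longrightarrow> EV (iid i D) (\<lambda>ps. EV D (\<lambda>c.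
              EV (iid j D) (\<lambda>cs. (f (ps @ c # cs) - f (ps @ cs))\<^sup>2))) \<le> B"
  shows "j + m = M \<Longrightarrow> EV (iid j D) (\<lambda>ps. Var (iid m D) (\<lambda>cs. f (ps @ cs))) \<le> real m * B"
proof (induction m arbitrary: j)
  case 0
  then show ?case by (simp add: Var_def)
next
  case (Suc m)
  let ?R = "iid m D"
  have step: "Var (iid (Suc m) D) (\<lambda>cs. f (ps @ cs)) \<le>
      EV D (\<lambda>c. Var ?R (\<lambda>cs. f ((ps @ [c]) @ cs)))
      + EV D (\<lambda>c. EV ?R (\<lambda>cs. (f (ps @ c # cs) - f (ps @ cs))\<^sup>2))" for ps
  proof -
    define G where "G c = EV ?R (\<lambda>cs. f (ps @ c # cs))" for c
    \<comment> \<open>Total variance, conditioned on the first entry. The variance of the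
      conditional mean is at most its second moment about any constant; the constant chosen is the
      mean over lists without this entry.\<close>
    have "Var (iid (Suc m) D) (\<lambda>cs. f (ps @ cs)) =
       EV D (\<lambda>c. Var ?R (\<lambda>cs. f (ps @ c # cs)) + (G c)\<^sup>2) - (EV D G)\<^sup>2"
      unfolding G_def using D by (simp add: Var_def EV_replicate_Suc del: replicate_pmf.simps)
    also have "\<dots> = EV D (\<lambda>c. Var ?R (\<lambda>cs. f (ps @ c # cs))) + Var D G"
      using D by (simp add: EV_add Var_def[of D])
    also have "Var D G \<le> EV D (\<lambda>c. (G c - EV ?R (\<lambda>cs. f (ps @ cs)))\<^sup>2)"
      by (rule Var_le[OF D])
    also have "\<dots> \<le> EV D (\<lambda>c. EV ?R (\<lambda>cs. (f (ps @ c # cs) - f (ps @ cs))\<^sup>2))"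
    proof (intro EV_mono D)
      fix c
      show "(G c - EV ?R (\<lambda>cs. f (ps @ cs)))\<^sup>2 \<le> EV ?R (\<lambda>cs. (f (ps @ c # cs) - f (ps @ cs))\<^sup>2)"
        using EV_square_le[of ?R "\<lambda>cs. f (ps @ c # cs) - f (ps @ cs)"] D by (simp add: EV_diff G_def)
    qed
    finally show ?thesis by simp
  qed
  have "EV (iid j D) (\<lambda>ps. Var (iid (Suc m) D) (\<lambda>cs. f (ps @ cs))) \<le>
     EV (iid (Suc j) D) (\<lambda>ps. Var ?R (\<lambda>cs. f (ps @ cs)))
     + EV (iid j D) (\<lambda>ps. EV D (\<lambda>c. EV ?R (\<lambda>cs. (f (ps @ c # cs) - f (ps @ cs))\<^sup>2)))"
    unfolding EV_replicate_snoc[OF D] using D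
    by (subst EV_add[symmetric]) (auto intro!: EV_mono step simp del: replicate_pmf.simps append_assoc)
  also have "\<dots> \<le> real m * B + B"
    using Suc.prems by (intro add_mono Suc.IH B) auto
  finally show ?case by (simp add: algebra_simps)
qed

lemma efron_stein_list:
  fixes f :: "'a list \<Rightarrow> real"
  assumes D: "finite (set_pmf D)"
    and "\<And>i j. Suc (i + j) = M \<Longrightarrow> EV (iid i D) (\<lambda>ps. EV D (\<lambda>c.
              EV (iid j D) (\<lambda>cs. (f (ps @ c # cs) - f (ps @ cs))\<^sup>2))) \<le> B"
  shows "Var (iid M D) f \<le> real M * B"
  using efron_stein[OF assms, where j = 0 and m = M] by simp

text \<open>
  Expose the entries satisfying \<open>t\<close> and bound the rest by fresh unconditioned samples: dropping the
  event that the remaining entries violate \<open>t\<close> can only increase the expectation of a nonnegative \<open>\<psi>\<close>.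
\<close>

lemma split_bound:
  fixes \<psi> :: "'a list \<Rightarrow> 'a list \<Rightarrow> real"
  assumes D: "finite (set_pmf D)" and b: "b \<ge> 0" and nonneg: "\<And>ts ns. \<psi> ts ns \<ge> 0" and "a \<ge> 0"
    and "\<And>ts j. j \<le> m \<Longrightarrow> \<forall>c\<in>set ts. c \<in> set_pmf D \<and> t c \<Longrightarrow>
           EV (iid j D) (\<psi> ts) \<le> a * b ^ length ts"
  shows "EV (iid m D) (\<lambda>cs. \<psi> (filter t cs) (filter (\<lambda>c. \<not> t c) cs))
           \<le> a * (1 + PR D {c. t c} * b) ^ m"
  using assms(3-)
proof (induction m arbitrary: \<psi> a)
  case 0
  from "0.prems"(3)[of 0 "[]"] show ?case by simp
next
  case (Suc m)
  let ?p = "PR D {c. t c}" and ?R = "iid m D"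
  let ?f = "filter t" and ?g = "filter (\<lambda>c. \<not> t c)"
  \<comment> \<open>Averages out a first entry that violates \<open>t\<close>. In that case the
    constant a stays the same, while an exposed entry costs a factor b.\<close>
  define \<psi>' where "\<psi>' ts ns = EV D (\<lambda>c. of_bool (\<not> t c) * \<psi> ts (c # ns))" for ts ns
  have 1: "EV ?R (\<lambda>cs. \<psi> (c # ?f cs) (?g cs)) \<le> (a * b) * (1 + ?p * b) ^ m"
    if "c \<in> set_pmf D" "t c" for c
  proof (rule Suc.IH[where \<psi> = "\<lambda>ts. \<psi> (c # ts)"])
    fix ts j assume "j \<le> m" "\<forall>c\<in>set ts. c \<in> set_pmf D \<and> t c"
    then show "EV (iid j D) (\<psi> (c # ts)) \<le> a * b * b ^ length ts"
      using Suc.prems(3)[of j "c # ts"] that by (simp add: mult_ac)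
  qed (use Suc.prems b in auto)
  have 2: "EV ?R (\<lambda>cs. \<psi>' (?f cs) (?g cs)) \<le> a * (1 + ?p * b) ^ m"
  proof (rule Suc.IH[where \<psi> = \<psi>'])
    show "0 \<le> \<psi>' ts ns" for ts ns
      unfolding \<psi>'_def using Suc.prems(1) by (intro integral_nonneg_AE) auto
    fix ts j assume *: "j \<le> m" "\<forall>c\<in>set ts. c \<in> set_pmf D \<and> t c"
    have "EV (iid j D) (\<psi>' ts) = EV D (\<lambda>c. EV (iid j D) (\<lambda>ns. of_bool (\<not> t c) * \<psi> ts (c # ns)))"
      unfolding \<psi>'_def using D by (intro EV_commute) auto
    also have "\<dots> \<le> EV D (\<lambda>c. EV (iid j D) (\<lambda>ns. \<psi> ts (c # ns)))"
      using D Suc.prems(1) by (intro EV_mono) auto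
    also have "\<dots> = EV (iid (Suc j) D) (\<psi> ts)" by (rule EV_replicate_Suc[OF D, symmetric])
    also have "\<dots> \<le> a * b ^ length ts" using Suc.prems(3)[of "Suc j" ts] * by auto
    finally show "EV (iid j D) (\<psi>' ts) \<le> a * b ^ length ts" .
  qed (use Suc.prems in auto)
  have "EV (iid (Suc m) D) (\<lambda>cs. \<psi> (?f cs) (?g cs)) =
     EV D (\<lambda>c. of_bool (t c) * EV ?R (\<lambda>cs. \<psi> (c # ?f cs) (?g cs))
          + EV ?R (\<lambda>cs. of_bool (\<not> t c) * \<psi> (?f cs) (c # ?g cs)))"
    unfolding EV_replicate_Suc[OF D] by (intro EV_cong) auto
  also have "\<dots> = EV D (\<lambda>c. of_bool (t c) * EV ?R (\<lambda>cs. \<psi> (c # ?f cs) (?g cs)))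
      + EV ?R (\<lambda>cs. \<psi>' (?f cs) (?g cs))"
    unfolding \<psi>'_def EV_add[OF D] using D by (subst EV_commute) auto
  also have "EV D (\<lambda>c. of_bool (t c) * EV ?R (\<lambda>cs. \<psi> (c # ?f cs) (?g cs)))
      \<le> EV D (\<lambda>c. of_bool (t c) * ((a * b) * (1 + ?p * b) ^ m))"
    using D 1 by (intro EV_mono) auto
  also have "\<dots> = ?p * ((a * b) * (1 + ?p * b) ^ m)" by (simp add: EV_of_bool)
  finally show ?case using 2 by (simp add: algebra_simps)
qed

lemma cond_pmf_mixture:
  fixes D :: "'a pmf" and t
  defines "p \<equiv> PR D {c. t c}"
  assumes p: "0 < p" "p < 1"
  shows "D = bernoulli_pmf p \<bind> (\<lambda>b. if b then cond_pmf D {c. t c} else cond_pmf D {c. \<not> t c})"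
proof (rule pmf_eqI)
  fix c
  have "PR D {c. \<not> t c} = 1 - p"
    unfolding p_def by (subst measure_pmf.prob_compl[symmetric]) (auto intro!: arg_cong[where f = "PR D"])
  moreover from this have "set_pmf D \<inter> {c. \<not> t c} \<noteq> {}" using p(2)
    by (metis measure_Int_set_pmf measure_empty inf_commute diff_gt_0_iff_gt less_irrefl)
  moreover have "set_pmf D \<inter> {c. t c} \<noteq> {}" using p(1) unfolding p_def
    by (metis measure_Int_set_pmf measure_empty inf_commute less_irrefl)
  ultimately show "pmf D c = pmf (bernoulli_pmf p \<bind> (\<lambda>b. if b then cond_pmf D {c. t c} else cond_pmf D {c. \<not> t c})) c"
    using p by (simp add: pmf_bind pmf_cond p_def[symmetric])
qed

text \<open>Filtering forgets how the two kinds of entries interleave; what remains is a binomial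
  number of independent samples of one kind and the complementary number of the other.\<close>

lemma replicate_pmf_thinning:
  assumes p: "p \<in> {0..1}" and D: "D = bernoulli_pmf p \<bind> (\<lambda>b. if b then Dt else Df)"
    and Dt: "\<And>c. c \<in> set_pmf Dt \<Longrightarrow> t c" and Df: "\<And>c. c \<in> set_pmf Df \<Longrightarrow> \<not> t c"
  shows "map_pmf (\<lambda>cs. (filter t cs, filter (\<lambda>c. \<not> t c) cs)) (iid m D) =
         binomial_pmf m p \<bind> (\<lambda>j. pair_pmf (iid j Dt) (iid (m - j) Df))"
proof (induction m)
  case 0
  then show ?case using p by (simp add: binomial_pmf_0 bind_return_pmf pair_pmf_def)
next
  case (Suc m)
  let ?F = "\<lambda>cs. (filter t cs, filter (\<lambda>c. \<not> t c) cs)"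
  let ?P = "\<lambda>i j. pair_pmf (iid i Dt) (iid j Df)"
  have 1: "Dt \<bind> (\<lambda>c. ?P i j \<bind> (\<lambda>(ts, ns). return_pmf (c # ts, ns))) = ?P (Suc i) j" for i j
    by (simp add: pair_pmf_def bind_assoc_pmf bind_return_pmf)
  have 2: "Df \<bind> (\<lambda>c. ?P i j \<bind> (\<lambda>(ts, ns). return_pmf (ts, c # ns))) = ?P i (Suc j)" for i j
    by (simp add: pair_pmf_def bind_assoc_pmf bind_return_pmf) (subst bind_commute_pmf, simp)
  have "map_pmf ?F (iid (Suc m) D) =
     bernoulli_pmf p \<bind> (\<lambda>b. (if b then Dt else Df) \<bind> (\<lambda>c. map_pmf ?F (iid m D) \<bind>
        (\<lambda>(ts, ns). return_pmf (if b then (c # ts, ns) else (ts, c # ns)))))"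
    unfolding replicate_pmf.simps
    by (subst D) (auto simp: map_pmf_def bind_assoc_pmf bind_return_pmf dest: Dt Df
          intro!: bind_pmf_cong split: if_splits)
  also have "\<dots> = bernoulli_pmf p \<bind> (\<lambda>b. binomial_pmf m p \<bind> (\<lambda>j. if b then ?P (Suc j) (m - j) else ?P j (Suc (m - j))))"
  proof (intro bind_pmf_cong refl)
    fix b
    show "(if b then Dt else Df) \<bind> (\<lambda>c. map_pmf ?F (iid m D) \<bind>
        (\<lambda>(ts, ns). return_pmf (if b then (c # ts, ns) else (ts, c # ns)))) =
       binomial_pmf m p \<bind> (\<lambda>j. if b then ?P (Suc j) (m - j) else ?P j (Suc (m - j)))"
      unfolding Suc.IH bind_assoc_pmf
      by (subst bind_commute_pmf) (cases b; simp add: 1 2)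
  qed
  also have "\<dots> = bernoulli_pmf p \<bind> (\<lambda>b. binomial_pmf m p \<bind> (\<lambda>j. ?P (of_bool b + j) (Suc m - (of_bool b + j))))"
  proof (intro bind_pmf_cong refl)
    fix b j assume "j \<in> set_pmf (binomial_pmf m p)"
    then have "j \<le> m" using p by (auto simp: set_pmf_binomial_eq split: if_splits)
    then show "(if b then ?P (Suc j) (m - j) else ?P j (Suc (m - j))) = ?P (of_bool b + j) (Suc m - (of_bool b + j))"
      by (simp add: Suc_diff_le)
  qed
  also have "\<dots> = binomial_pmf (Suc m) p \<bind> (\<lambda>j. ?P j (Suc m - j))"
    using p by (simp add: binomial_pmf_Suc bind_assoc_pmf bind_return_pmf of_bool_def)
  finally show ?case .
qed

section \<open>Random uniform hypergraphs\<close>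

definition ksets :: "'a set \<Rightarrow> nat \<Rightarrow> 'a set set" where
  "ksets V k = {S. S \<subseteq> V \<and> card S = k}"

abbreviation "rand_edge V k \<equiv> pmf_of_set (ksets V k)"

lemma finite_ksets [simp]: "finite V \<Longrightarrow> finite (ksets V k)"
  by (simp add: ksets_def)

lemma card_ksets: "finite V \<Longrightarrow> card (ksets V k) = card V choose k"
  unfolding ksets_def by (rule n_subsets)

lemma ksets_nonempty: "finite V \<Longrightarrow> k \<le> card V \<Longrightarrow> ksets V k \<noteq> {}"
  by (metis card_ksets card.empty zero_less_binomial less_irrefl)

lemma set_rand_edge [simp]: "finite V \<Longrightarrow> k \<le> card V \<Longrightarrow> set_pmf (rand_edge V k) = ksets V k"
  by (simp add: ksets_nonempty)

lemma finite_set_rand_edge [simp]: "finite V \<Longrightarrow> k \<le> card V \<Longrightarrow> finite (set_pmf (rand_edge V k))"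
  by simp

lemma set_replicate_rand_edge:
  assumes "finite V" "k \<le> card V" "cs \<in> set_pmf (iid m (rand_edge V k))" "c \<in> set cs"
  shows "c \<subseteq> V" "card c = k"
proof -
  have "c \<in> set_pmf (rand_edge V k)" using assms by (auto simp: set_replicate_pmf)
  then have "c \<in> ksets V k" using assms by simp
  then show "c \<subseteq> V" "card c = k" by (auto simp: ksets_def)
qed

section \<open>Incidence probabilities of a uniform edge\<close>

lemma card_ksets_through:
  assumes "finite V" "x \<in> V" "W \<subseteq> V - {x}" "k \<ge> 1"
  shows "card {S \<in> ksets V k. x \<in> S \<and> (S - {x}) \<inter> W = {}} = (card V - 1 - card W) choose (k - 1)"
proof -
  have "bij_betw (insert x) (ksets (V - {x} - W) (k - 1)) {S \<in> ksets V k. x \<in> S \<and> (S - {x}) \<inter> W = {}}"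
  proof (rule bij_betwI[where g = "\<lambda>S. S - {x}"])
    show "insert x \<in> ksets (V - {x} - W) (k - 1) \<rightarrow> {S \<in> ksets V k. x \<in> S \<and> (S - {x}) \<inter> W = {}}"
    proof
      fix S assume S: "S \<in> ksets (V - {x} - W) (k - 1)"
      then have "finite S" "x \<notin> S" using assms by (auto simp: ksets_def elim: finite_subset)
      then show "insert x S \<in> {S \<in> ksets V k. x \<in> S \<and> (S - {x}) \<inter> W = {}}"
        using S assms by (auto simp: ksets_def)
    qed
  qed (use assms in \<open>auto simp: ksets_def\<close>)
  then have "card {S \<in> ksets V k. x \<in> S \<and> (S - {x}) \<inter> W = {}} = card (ksets (V - {x} - W) (k - 1))"
    by (simp add: bij_betw_same_card)
  also have "\<dots> = (card V - 1 - card W) choose (k - 1)"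
    using assms by (subst card_ksets) (auto simp: card_Diff_subset finite_subset)
  finally show ?thesis .
qed

lemma card_ksets_through':
  assumes "finite V" "x \<in> V" "k \<ge> 1"
  shows "card {S \<in> ksets V k. x \<in> S} = (card V - 1) choose (k - 1)"
  using card_ksets_through[OF assms(1,2) _ assms(3), of "{}"] by simp

lemma prob_through:
  assumes "finite V" "x \<in> V" "1 \<le> k" "k \<le> card V"
  shows "PR (rand_edge V k) {c. x \<in> c} = real k / rcard V"
proof -
  have "k * (card V choose k) = card V * ((card V - 1) choose (k - 1))"
    using assms by (intro times_binomial_minus1_eq) simp
  then have "real k * real (card V choose k) = rcard V * real ((card V - 1) choose (k - 1))"
    by (metis of_nat_mult)
  moreover have "card V choose k > 0" "card V > 0" using assms by auto
  moreover have "ksets V k \<inter> {c. x \<in> c} = {S \<in> ksets V k. x \<in> S}" by auto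
  ultimately show ?thesis
    using assms by (subst measure_pmf_of_set)
      (auto simp: ksets_nonempty card_ksets card_ksets_through' field_simps)
qed

lemma prob_touch:
  assumes "finite V" "A \<subseteq> V" "1 \<le> k" "k \<le> card V"
  shows "PR (rand_edge V k) {c. c \<inter> A \<noteq> {}} \<le> real k * rcard A / rcard V"
proof -
  have "PR (rand_edge V k) {c. c \<inter> A \<noteq> {}} \<le> PR (rand_edge V k) (\<Union>x\<in>A. {c. x \<in> c})"
    by (intro measure_pmf.finite_measure_mono) auto
  also have "\<dots> \<le> (\<Sum>x\<in>A. PR (rand_edge V k) {c. x \<in> c})"
    using assms by (intro measure_pmf.finite_measure_subadditive_finite) (auto intro: finite_subset)
  also have "\<dots> = (\<Sum>x\<in>A. real k / rcard V)"
    using assms by (intro sum.cong prob_through) auto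
  finally show ?thesis by (simp add: mult.commute)
qed

text \<open>
  The recursion for the generating function of a Poisson branching process in which every individual
  lies in \<open>\<kappa>\<close> edges on average, with all \<open>k\<close> vertices of an edge counted as children.
\<close>

primrec ball_mgf :: "real \<Rightarrow> real \<Rightarrow> nat \<Rightarrow> nat \<Rightarrow> real" where
  "ball_mgf \<kappa> z k 0 = z"
| "ball_mgf \<kappa> z k (Suc h) = z * exp (\<kappa> * ball_mgf \<kappa> z k h ^ k)"

lemma ball_mgf_ge_1: "\<kappa> \<ge> 0 \<Longrightarrow> z \<ge> 1 \<Longrightarrow> ball_mgf \<kappa> z k h \<ge> 1"
proof (induction h)
  case (Suc h)
  have "1 * 1 \<le> z * exp (\<kappa> * ball_mgf \<kappa> z k h ^ k)"
    using Suc by (intro mult_mono) auto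
  then show ?case by simp
qed simp

text \<open>One exploration step by \<open>hball_touching_subset\<close> and
  \<open>split_bound\<close>: the number of edges meeting A has mean at most \<kappa> times the size
  of A, each brings at most k new vertices, and the ball around these is bounded by induction in the
  unexposed edges. A and m vary in the induction because both change when edges are exposed.\<close>

lemma hball_mgf:
  assumes V: "finite V" "1 \<le> k" "k \<le> card V" and z: "z \<ge> 1" "\<kappa> \<ge> 0"
  shows "A \<subseteq> V \<Longrightarrow> real (k * m) \<le> \<kappa> * rcard V \<Longrightarrow>
    EV (iid m (rand_edge V k)) (\<lambda>cs. z ^ card (hball (set cs) h A)) \<le> ball_mgf \<kappa> z k h ^ card A"
proof (induction h arbitrary: A m)
  case 0
  then show ?case by simp
next
  case (Suc h)
  let ?D = "rand_edge V k" and ?g = "ball_mgf \<kappa> z k h"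
  let ?t = "\<lambda>c. c \<inter> A \<noteq> {}"
  define \<psi> :: "'a set list \<Rightarrow> 'a set list \<Rightarrow> real"
    where "\<psi> ts ns = z ^ card A * z ^ card (hball (set ns) h (\<Union>(set ts)))" for ts ns
  have g1: "?g \<ge> 1" using ball_mgf_ge_1 z by blast
  have cardV: "card V > 0" using V by auto
  have fin: "finite (set_pmf (iid m ?D))" using V by simp
  have "EV (iid m ?D) (\<lambda>cs. z ^ card (hball (set cs) (Suc h) A))
     \<le> EV (iid m ?D) (\<lambda>cs. \<psi> (filter ?t cs) (filter (\<lambda>c. \<not> ?t c) cs))"
  proof (intro EV_mono fin)
    fix cs assume "cs \<in> set_pmf (iid m ?D)"
    then have sub: "\<Union>(set cs) \<subseteq> V" using V set_replicate_rand_edge by blast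
    have T: "{e \<in> set cs. e \<inter> A \<noteq> {}} = set (filter ?t cs)"
      "set cs - set (filter ?t cs) = set (filter (\<lambda>c. \<not> ?t c) cs)" by auto
    let ?B = "hball (set (filter (\<lambda>c. \<not> ?t c) cs)) h (\<Union>(set (filter ?t cs)))"
    have "?B \<subseteq> V" using sub by (intro hball_subset) auto
    then have finB: "finite ?B" using V finite_subset by blast
    have "hball (set cs) (Suc h) A \<subseteq> A \<union> ?B"
      using hball_touching_subset[of "set cs" h A] unfolding T .
    then have "card (hball (set cs) (Suc h) A) \<le> card A + card ?B"
      using finB Suc.prems V by (meson card_Un_le card_mono finite_Un finite_subset order_trans)
    then have "z ^ card (hball (set cs) (Suc h) A) \<le> z ^ (card A + card ?B)"
      using z by (intro power_increasing) auto
    then show "z ^ card (hball (set cs) (Suc h) A) \<le> \<psi> (filter ?t cs) (filter (\<lambda>c. \<not> ?t c) cs)"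
      by (simp add: \<psi>_def power_add)
  qed
  also have "\<dots> \<le> z ^ card A * (1 + PR ?D {c. ?t c} * ?g ^ k) ^ m"
  proof (rule split_bound)
    fix ts j assume j: "j \<le> m" and ts: "\<forall>c\<in>set ts. c \<in> set_pmf ?D \<and> ?t c"
    have ts': "\<And>c. c \<in> set ts \<Longrightarrow> c \<in> ksets V k" using ts V by simp
    then have sub: "\<Union>(set ts) \<subseteq> V" by (auto simp: ksets_def)
    have "card (\<Union>(set ts)) \<le> (\<Sum>c\<in>set ts. card c)"
      by (rule card_Union_le_sum_card)
    also have "\<dots> = (\<Sum>c\<in>set ts. k)" using ts' by (intro sum.cong) (auto simp: ksets_def)
    also have "\<dots> \<le> k * length ts" using card_length[of ts] by simp
    finally have c: "card (\<Union>(set ts)) \<le> k * length ts" .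
    have "real (k * j) \<le> \<kappa> * rcard V"
      using j Suc.prems(2) by (meson mult_le_mono2 of_nat_mono order_trans)
    then have "EV (iid j ?D) (\<lambda>ns. z ^ card (hball (set ns) h (\<Union>(set ts)))) \<le> ?g ^ card (\<Union>(set ts))"
      by (intro Suc.IH sub)
    also have "\<dots> \<le> ?g ^ (k * length ts)" using g1 c by (intro power_increasing) auto
    finally show "EV (iid j ?D) (\<psi> ts) \<le> z ^ card A * (?g ^ k) ^ length ts"
      using z by (simp add: \<psi>_def[abs_def] power_mult mult_left_mono)
  qed (use V z g1 in \<open>auto simp: \<psi>_def\<close>)
  also have "\<dots> \<le> z ^ card A * exp (\<kappa> * ?g ^ k) ^ card A"
  proof (intro mult_left_mono)
    let ?p = "PR ?D {c. ?t c}"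
    have "(1 + ?p * ?g ^ k) ^ m \<le> exp (?p * ?g ^ k) ^ m"
      using g1 by (intro power_mono) auto
    also have "\<dots> = exp (real m * ?p * ?g ^ k)" by (simp add: exp_of_nat_mult[symmetric] mult_ac)
    also have "real m * ?p \<le> real m * (real k * rcard A / rcard V)"
      using prob_touch[of V A k] V Suc.prems by (intro mult_left_mono) auto
    also have "\<dots> = real (k * m) / rcard V * rcard A" by simp
    also have "\<dots> \<le> \<kappa> * rcard A"
      using Suc.prems cardV by (intro mult_right_mono) (simp_all add: divide_le_eq)
    finally have "(1 + ?p * ?g ^ k) ^ m \<le> exp (\<kappa> * rcard A * ?g ^ k)"
      using g1 by (simp add: mult_right_mono)
    also have "\<dots> = exp (\<kappa> * ?g ^ k) ^ card A" by (simp add: exp_of_nat_mult[symmetric] mult_ac)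
    finally show "(1 + ?p * ?g ^ k) ^ m \<le> exp (\<kappa> * ?g ^ k) ^ card A" .
  qed (use z in auto)
  also have "\<dots> = ball_mgf \<kappa> z k (Suc h) ^ card A" by (simp add: power_mult_distrib)
  finally show ?case .
qed

section \<open>One round of the witness recursion\<close>

lemma prob_avoid_through:
  assumes "finite V" "x \<in> V" "W \<subseteq> V - {x}" "1 \<le> k" "k < card V"
  shows "PR (cond_pmf (rand_edge V k) {c. x \<in> c}) {c. (c - {x}) \<inter> W = {}}
     = real ((card V - 1 - card W) choose (k - 1)) / real ((card V - 1) choose (k - 1))"
proof -
  let ?T = "{S \<in> ksets V k. x \<in> S}"
  have cT: "card ?T = (card V - 1) choose (k - 1)" using assms by (intro card_ksets_through') auto
  then have "card ?T > 0" using assms by auto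
  then have ne: "?T \<noteq> {}" by (metis card.empty less_irrefl)
  have eq: "cond_pmf (rand_edge V k) {c. x \<in> c} = pmf_of_set ?T"
  proof (rule pmf_eqI)
    fix c
    have "ksets V k \<inter> {c. x \<in> c} = ?T" by auto
    moreover have "card (ksets V k) > 0" using assms by (simp add: card_ksets)
    ultimately show "pmf (cond_pmf (rand_edge V k) {c. x \<in> c}) c = pmf (pmf_of_set ?T) c"
      using assms ne by (subst pmf_cond) (auto simp: ksets_nonempty measure_pmf_of_set indicator_def card_gt_0_iff)
  qed
  have "?T \<inter> {c. (c - {x}) \<inter> W = {}} = {S \<in> ksets V k. x \<in> S \<and> (S - {x}) \<inter> W = {}}" by auto
  then show ?thesis
    unfolding eq using assms ne card_ksets_through[of V x W k] by (subst measure_pmf_of_set) (auto simp: cT)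
qed

text \<open>Deleting x leaves a uniform hypergraph of the same kind on one vertex fewer, so that the
  next lower depth can be treated there. For this reason the density statements below range over all
  vertex sets and all edge counts near r times their size.\<close>

lemma cond_rand_edge_avoid:
  assumes "finite V" "x \<in> V" "1 \<le> k" "k < card V"
  shows "cond_pmf (rand_edge V k) {c. x \<notin> c} = rand_edge (V - {x}) k"
proof (rule pmf_eqI)
  fix c
  have T: "ksets V k \<inter> {c. x \<notin> c} = ksets (V - {x}) k" by (auto simp: ksets_def)
  have ne: "ksets (V - {x}) k \<noteq> {}" using assms by (intro ksets_nonempty) auto
  have "card (ksets V k) > 0" using assms by (simp add: card_ksets)
  then show "pmf (cond_pmf (rand_edge V k) {c. x \<notin> c}) c = pmf (rand_edge (V - {x}) k) c"
    using assms ne T by (subst pmf_cond)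
      (auto simp: ksets_nonempty measure_pmf_of_set indicator_def card_gt_0_iff)
qed

lemma EV_binomial_power:
  assumes "p \<in> {0..1}"
  shows "EV (binomial_pmf m p) (\<lambda>j. s ^ j) = (1 - p + p * s) ^ m"
  using assms by (subst expectation_binomial_pmf')
    (auto simp: add.commute[of "1 - p"] binomial_ring[of "p * s" "1 - p"] power_mult_distrib mult_ac)

lemma EV_replicate_all:
  assumes "finite (set_pmf D)"
  shows "EV (iid j D) (\<lambda>cs. of_bool (\<forall>c\<in>set cs. P c) :: real) = PR D {c. P c} ^ j"
proof (induction j)
  case (Suc j)
  have "EV (iid (Suc j) D) (\<lambda>cs. of_bool (\<forall>c\<in>set cs. P c) :: real) =
     EV D (\<lambda>c. of_bool (P c) * EV (iid j D) (\<lambda>cs. of_bool (\<forall>c\<in>set cs. P c)))"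
    unfolding EV_replicate_Suc[OF assms] by (intro EV_cong) auto
  then show ?case by (simp add: Suc.IH EV_of_bool)
qed simp

lemma EV_pair:
  assumes "finite (set_pmf p)" "finite (set_pmf q)"
  shows "EV (pair_pmf p q) f = EV q (\<lambda>y. EV p (\<lambda>x. f (x, y) :: real))"
  using assms by (subst EV_commute) (simp_all add: pair_pmf_def EV_bind)

text \<open>
  The edges through \<open>x\<close> are independent of the others given their number, and they hit the
  witnesses of the remaining hypergraph independently. The parameter \<open>a\<close> cuts off the degree of \<open>x\<close>.
\<close>

lemma wit_Suc_prob:
  assumes V: "finite V" "x \<in> V" "1 \<le> k" "k < card V" and \<sigma>: "0 \<le> \<sigma>" "\<sigma> \<le> 1" and "0 \<le> eps"
    and bad: "\<And>j. j \<le> a \<Longrightarrow> PR (iid (m - j) (rand_edge (V - {x}) k))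
       {ns. real ((card V - 1 - card {y \<in> V - {x}. wit (set ns) L y}) choose (k - 1))
              < \<sigma> * real ((card V - 1) choose (k - 1))} \<le> eps"
  shows "PR (iid m (rand_edge V k)) {cs. wit (set cs) (Suc L) x}
     \<le> exp (- (real m * real k / rcard V) * \<sigma>) + eps + exp (real m * real k / rcard V) / 2 ^ a"
proof -
  let ?D = "rand_edge V k"
  let ?p = "real k / rcard V"
  let ?Dt = "cond_pmf ?D {c. x \<in> c}" and ?Df = "rand_edge (V - {x}) k"
  let ?W = "\<lambda>ns. {y \<in> V - {x}. wit (set ns) L y}"
  let ?\<Psi> = "\<lambda>(ts, ns). of_bool (\<forall>c\<in>set ts. (c - {x}) \<inter> ?W ns \<noteq> {}) :: real"
  let ?B = "\<lambda>ns. real ((card V - 1 - card (?W ns)) choose (k - 1)) < \<sigma> * real ((card V - 1) choose (k - 1))"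
  have p: "PR ?D {c. x \<in> c} = ?p" using V by (intro prob_through) auto
  have p01: "0 < ?p" "?p < 1" using V by auto
  have ne: "set_pmf ?D \<inter> {c. x \<in> c} \<noteq> {}" using p p01
    by (metis measure_Int_set_pmf measure_empty inf_commute less_irrefl)
  have setDt: "set_pmf ?Dt = ksets V k \<inter> {c. x \<in> c}"
    using ne V by (subst set_cond_pmf) auto
  have setDf: "set_pmf ?Df = ksets (V - {x}) k" using V by (intro set_rand_edge) auto
  have fin: "finite (set_pmf ?Dt)" "finite (set_pmf ?Df)" using V by (auto simp: setDt setDf)
  have "(card V - 1) choose (k - 1) > 0" using V by auto
  have Dt: "\<And>c. c \<in> set_pmf ?Dt \<Longrightarrow> x \<in> c" unfolding setDt by auto
  have Df: "\<And>c. c \<in> set_pmf ?Df \<Longrightarrow> \<not> x \<in> c" unfolding setDf by (auto simp: ksets_def)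
  have D: "?D = bernoulli_pmf ?p \<bind> (\<lambda>b. if b then ?Dt else ?Df)"
    using cond_pmf_mixture[of ?D "\<lambda>c. x \<in> c"] p01 unfolding cond_rand_edge_avoid[OF V] p by blast
  have "PR (iid m ?D) {cs. wit (set cs) (Suc L) x}
     = EV (iid m ?D) (\<lambda>cs. ?\<Psi> (filter (\<lambda>c. x \<in> c) cs, filter (\<lambda>c. \<not> x \<in> c) cs))"
    unfolding EV_of_bool
  proof (intro EV_cong)
    fix cs assume "cs \<in> set_pmf (iid m ?D)"
    then have sub: "\<And>c. c \<in> set cs \<Longrightarrow> c \<subseteq> V" using V set_replicate_rand_edge(1)[of V k] by auto
    have eq: "{e \<in> set cs. x \<notin> e} = set (filter (\<lambda>c. \<not> x \<in> c) cs)" by auto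
    have aux: "(c - {x}) \<inter> {y \<in> V - {x}. P y} \<noteq> {} \<longleftrightarrow> (\<exists>y\<in>c - {x}. P y)" if "c \<in> set cs" for c P
      using sub[OF that] by blast
    have all_filter: "(\<forall>e\<in>set cs. x \<in> e \<longrightarrow> X e) \<longleftrightarrow> (\<forall>c\<in>set (filter (\<lambda>c. x \<in> c) cs). Y c)"
      if "\<And>c. c \<in> set cs \<Longrightarrow> Y c \<longleftrightarrow> X c" for X Y using that by auto
    have "wit (set cs) (Suc L) x \<longleftrightarrow>
        (\<forall>c\<in>set (filter (\<lambda>c. x \<in> c) cs). (c - {x}) \<inter> ?W (filter (\<lambda>c. \<not> x \<in> c) cs) \<noteq> {})"
      unfolding wit.simps eq by (rule all_filter[OF aux])
    then show "(of_bool (wit (set cs) (Suc L) x) :: real) = ?\<Psi> (filter (\<lambda>c. x \<in> c) cs, filter (\<lambda>c. \<not> x \<in> c) cs)"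
      by simp
  qed
  also have "\<dots> = EV (map_pmf (\<lambda>cs. (filter (\<lambda>c. x \<in> c) cs, filter (\<lambda>c. \<not> x \<in> c) cs)) (iid m ?D)) ?\<Psi>"
    by simp
  also have "\<dots> = EV (binomial_pmf m ?p) (\<lambda>j. EV (pair_pmf (iid j ?Dt) (iid (m - j) ?Df)) ?\<Psi>)"
    using p01 fin by (subst replicate_pmf_thinning[OF _ D Dt Df])
      (auto intro!: EV_bind finite_set_pmf_binomial_pmf)
  \<comment> \<open>Split by the number j of edges at x. If j \<le> a, then \<open>bad\<close>
    applies to the remaining m - j edges. If j > a, the probability is bounded by 2 ^ j / 2 ^ a,
    whose mean is a value of the binomial generating function.\<close>
  also have "\<dots> \<le> EV (binomial_pmf m ?p) (\<lambda>j. ((1 - \<sigma>) ^ j + eps) + 2 ^ j / 2 ^ a)"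
  proof (intro EV_mono)
    fix j
    have prob1: "PR ?Dt {c. (c - {x}) \<inter> ?W ns \<noteq> {}} \<le> 1 - \<sigma>" if "\<not> ?B ns" for ns
    proof -
      have "PR ?Dt {c. (c - {x}) \<inter> ?W ns \<noteq> {}} = 1 - PR ?Dt {c. (c - {x}) \<inter> ?W ns = {}}"
        by (subst measure_pmf.prob_compl[symmetric]) (auto intro!: arg_cong[where f = "PR ?Dt"])
      also have "PR ?Dt {c. (c - {x}) \<inter> ?W ns = {}} =
         real ((card V - 1 - card (?W ns)) choose (k - 1)) / real ((card V - 1) choose (k - 1))"
        using V by (intro prob_avoid_through) auto
      finally have "PR ?Dt {c. (c - {x}) \<inter> ?W ns \<noteq> {}} = 1 -
         real ((card V - 1 - card (?W ns)) choose (k - 1)) / real ((card V - 1) choose (k - 1))" .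
      moreover have "\<sigma> \<le> real ((card V - 1 - card (?W ns)) choose (k - 1)) / real ((card V - 1) choose (k - 1))"
        using that \<open>(card V - 1) choose (k - 1) > 0\<close> by (simp add: le_divide_eq not_less)
      ultimately show ?thesis by linarith
    qed
    have "EV (pair_pmf (iid j ?Dt) (iid (m - j) ?Df)) ?\<Psi> =
        EV (iid (m - j) ?Df) (\<lambda>ns. PR ?Dt {c. (c - {x}) \<inter> ?W ns \<noteq> {}} ^ j)"
      using fin by (subst EV_pair) (auto simp: EV_replicate_all simp del: of_bool_eq_iff)
    also have "\<dots> \<le> EV (iid (m - j) ?Df) (\<lambda>ns. (1 - \<sigma>) ^ j + of_bool (?B ns))"
    proof (intro EV_mono)
      fix ns
      show "PR ?Dt {c. (c - {x}) \<inter> ?W ns \<noteq> {}} ^ j \<le> (1 - \<sigma>) ^ j + of_bool (?B ns)"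
      proof (cases "?B ns")
        case True
        have "PR ?Dt {c. (c - {x}) \<inter> ?W ns \<noteq> {}} ^ j \<le> 1" by (intro power_le_one) auto
        moreover have "(1 - \<sigma>) ^ j \<ge> 0" using \<sigma> by auto
        ultimately show ?thesis using True by simp
      next
        case False
        then show ?thesis using prob1[OF False] by (auto intro!: power_mono)
      qed
    qed (use fin in auto)
    also have "\<dots> = (1 - \<sigma>) ^ j + PR (iid (m - j) ?Df) {ns. ?B ns}"
      using fin by (simp add: EV_add EV_of_bool)
    also have "PR (iid (m - j) ?Df) {ns. ?B ns} \<le> eps + 2 ^ j / 2 ^ a"
    proof (cases "j \<le> a")
      case True
      moreover have "(0 :: real) \<le> 2 ^ j / 2 ^ a" by simp
      ultimately show ?thesis using bad[OF True] by linarith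
    next
      case False
      then have "(1 :: real) \<le> 2 ^ j / 2 ^ a" by (simp add: power_increasing)
      moreover have "PR (iid (m - j) ?Df) {ns. ?B ns} \<le> 1" by simp
      ultimately show ?thesis using \<open>0 \<le> eps\<close> by linarith
    qed
    finally show "EV (pair_pmf (iid j ?Dt) (iid (m - j) ?Df)) ?\<Psi> \<le> ((1 - \<sigma>) ^ j + eps) + 2 ^ j / 2 ^ a"
      by simp
  qed (use p01 in \<open>auto intro!: finite_set_pmf_binomial_pmf\<close>)
  also have "\<dots> = (1 - ?p + ?p * (1 - \<sigma>)) ^ m + eps + (1 - ?p + ?p * 2) ^ m / 2 ^ a"
  proof -
    have "EV (binomial_pmf m ?p) (\<lambda>j. 2 ^ j / 2 ^ a) = (1 - ?p + ?p * 2) ^ m / 2 ^ a"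
      using p01 by (simp add: EV_binomial_power)
    then show ?thesis
      using p01 by (subst EV_add EV_binomial_power; auto intro!: finite_set_pmf_binomial_pmf)+
  qed
  also have "(1 - ?p + ?p * (1 - \<sigma>)) ^ m \<le> exp (- ?p * \<sigma>) ^ m"
  proof (intro power_mono)
    have "1 - ?p + ?p * (1 - \<sigma>) = 1 + - ?p * \<sigma>" by (simp only: right_diff_distrib)
    then show "1 - ?p + ?p * (1 - \<sigma>) \<le> exp (- ?p * \<sigma>)"
      using exp_ge_add_one_self[of "- ?p * \<sigma>"] by linarith
    have "?p * \<sigma> \<le> 1 * 1" using p01 \<sigma> by (intro mult_mono) auto
    then show "0 \<le> 1 - ?p + ?p * (1 - \<sigma>)" by (simp only: right_diff_distrib)
  qed
  also have "\<dots> = exp (- (real m * real k / rcard V) * \<sigma>)"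
    by (simp add: exp_of_nat_mult[symmetric])
  also have "(1 - ?p + ?p * 2) ^ m \<le> exp ?p ^ m"
    using p01 exp_ge_add_one_self[of ?p] by (intro power_mono) linarith+
  also have "exp ?p ^ m = exp (real m * real k / rcard V)"
    by (simp add: exp_of_nat_mult[symmetric])
  finally show ?thesis by (simp add: divide_right_mono)
qed


text \<open>Factor by factor, (M - i) / (N - i) is at least (M - K) / N for i < K. The single K-th
  power on the left matches the power in the limiting recursion.\<close>

lemma binomial_ratio_ge:
  assumes "K \<le> M" "M \<le> N" "N > 0"
  shows "(real (M - K) / real N) ^ K * real (N choose K) \<le> real (M choose K)"
proof -
  have "(real (M - K) / real N) ^ K * real (N choose K)
      = (\<Prod>i = 0..<K. (real (M - K) / real N) * (real (N - i) / real (K - i)))"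
    using assms by (subst binomial_altdef_of_nat) (auto simp only: prod.distrib prod_constant card_atLeastLessThan diff_zero)
  also have "\<dots> \<le> (\<Prod>i = 0..<K. real (M - i) / real (K - i))"
  proof (intro prod_mono conjI)
    fix i assume i: "i \<in> {0..<K}"
    have "real (M - K) / real N * real (N - i) \<le> real (M - i) / real N * real N"
      using assms i by (intro mult_mono divide_right_mono) auto
    then show "real (M - K) / real N * (real (N - i) / real (K - i)) \<le> real (M - i) / real (K - i)"
      using assms divide_right_mono[of "real (M - K) / real N * real (N - i)" "real (M - i)" "real (K - i)"] by simp
  qed auto
  also have "\<dots> = real (M choose K)" using assms by (subst binomial_altdef_of_nat) auto
  finally show ?thesis .
qed

text \<open>An additional edge only destroys witnesses, by \<open>wit_antimono\<close>, and only in
  the ball of radius L around it, by \<open>wit_insert_local\<close>. The squared effect is at most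
  exp (2 b) for a ball of b vertices, which explains the argument \<open>exp 2\<close>.\<close>

lemma rand_edge_wit_card_Var:
  assumes V: "finite V" "1 \<le> k" "k \<le> card V" and \<kappa>: "\<kappa> \<ge> 0" "real (k * m) \<le> \<kappa> * rcard V"
  shows "Var (iid m (rand_edge V k)) (\<lambda>cs. real (card {x \<in> V. wit (set cs) L x}))
     \<le> real m * ball_mgf \<kappa> (exp 2) k L ^ k"
proof (rule efron_stein_list)
  let ?D = "rand_edge V k"
  let ?f = "\<lambda>cs. real (card {x \<in> V. wit (set cs) L x})"
  fix i j assume ij: "Suc (i + j) = m"
  let ?Ri = "iid i ?D" and ?Rj = "iid j ?D"
  have "EV ?Ri (\<lambda>ps. EV ?D (\<lambda>c. EV ?Rj (\<lambda>cs. (?f (ps @ c # cs) - ?f (ps @ cs))\<^sup>2))) \<le>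
     EV ?Ri (\<lambda>ps. EV ?D (\<lambda>c. EV ?Rj (\<lambda>cs. exp 2 ^ card (hball (set (ps @ cs)) L c))))"
  proof (intro EV_mono)
    fix ps c cs assume ps: "ps \<in> set_pmf ?Ri" and c: "c \<in> set_pmf ?D" and cs: "cs \<in> set_pmf ?Rj"
    let ?E = "set (ps @ cs)"
    let ?B = "hball ?E L c"
    have "\<Union>?E \<subseteq> V" using set_replicate_rand_edge(1)[OF V(1,3) ps] set_replicate_rand_edge(1)[OF V(1,3) cs] by auto
    moreover have "c \<in> ksets V k" using c V by simp
    then have "c \<subseteq> V" by (simp add: ksets_def)
    ultimately have BV: "?B \<subseteq> V" by (intro hball_subset)
    have ins: "set (ps @ c # cs) = insert c ?E" by auto
    have 1: "{x \<in> V. wit (insert c ?E) L x} \<subseteq> {x \<in> V. wit ?E L x}"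
      using wit_antimono[of ?E "insert c ?E" L] by auto
    have 2: "{x \<in> V. wit ?E L x} - {x \<in> V. wit (insert c ?E) L x} \<subseteq> ?B"
      using wit_insert_local[of ?E L _ c] by auto
    have "\<bar>?f (ps @ c # cs) - ?f (ps @ cs)\<bar> = real (card ({x \<in> V. wit ?E L x} - {x \<in> V. wit (insert c ?E) L x}))"
      unfolding ins using 1 V(1) by (subst card_Diff_subset) (auto simp: of_nat_diff card_mono)
    also have "\<dots> \<le> rcard ?B"
      using 2 BV V(1) by (intro of_nat_mono card_mono) (auto intro: finite_subset)
    finally have *: "\<bar>?f (ps @ c # cs) - ?f (ps @ cs)\<bar> \<le> rcard ?B" .
    have "rcard ?B \<le> exp (rcard ?B)" using exp_ge_add_one_self[of "rcard ?B"] by linarith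
    then have "\<bar>?f (ps @ c # cs) - ?f (ps @ cs)\<bar>\<^sup>2 \<le> (exp (rcard ?B))\<^sup>2"
      using * by (intro power_mono) auto
    also have "\<dots> = exp 2 ^ card ?B" by (simp add: exp_of_nat_mult[symmetric] power2_eq_square exp_add[symmetric])
    finally show "(?f (ps @ c # cs) - ?f (ps @ cs))\<^sup>2 \<le> exp 2 ^ card ?B" by simp
  qed (use V in simp_all)
  also have "\<dots> = EV ?D (\<lambda>c. EV ?Ri (\<lambda>ps. EV ?Rj (\<lambda>cs. exp 2 ^ card (hball (set (ps @ cs)) L c))))"
    using V by (subst EV_commute) simp_all
  also have "\<dots> = EV ?D (\<lambda>c. EV (iid (i + j) ?D) (\<lambda>cs. exp 2 ^ card (hball (set cs) L c)))"
    using V by (simp add: replicate_pmf_distrib EV_bind)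
  also have "\<dots> \<le> ball_mgf \<kappa> (exp 2) k L ^ k"
  proof (rule EV_le)
    fix c assume "c \<in> set_pmf ?D"
    then have c: "c \<in> ksets V k" using V by simp
    have "real (k * (i + j)) \<le> real (k * m)" using ij by (intro of_nat_mono) simp
    then have "real (k * (i + j)) \<le> \<kappa> * rcard V" using \<kappa> by linarith
    then have "EV (iid (i + j) ?D) (\<lambda>cs. exp 2 ^ card (hball (set cs) L c)) \<le> ball_mgf \<kappa> (exp 2) k L ^ card c"
      using V \<kappa>(1) c by (intro hball_mgf) (auto simp: ksets_def)
    then show "EV (iid (i + j) ?D) (\<lambda>cs. exp 2 ^ card (hball (set cs) L c)) \<le> ball_mgf \<kappa> (exp 2) k L ^ k"
      using c by (simp add: ksets_def)
  qed (use V in simp)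
  finally show "EV ?Ri (\<lambda>ps. EV ?D (\<lambda>c. EV ?Rj (\<lambda>cs. (?f (ps @ c # cs) - ?f (ps @ cs))\<^sup>2)))
      \<le> ball_mgf \<kappa> (exp 2) k L ^ k" .
qed (use V in simp)

section \<open>Density of witnesses\<close>

abbreviation (input) many_wit :: "nat set \<Rightarrow> nat \<Rightarrow> nat \<Rightarrow> nat \<Rightarrow> real \<Rightarrow> real" where
  "many_wit V k m L a \<equiv> PR (iid m (rand_edge V k)) {cs. a * rcard V \<le> real (card {x \<in> V. wit (set cs) L x})}"

text \<open>If at most a fraction q + e of the vertices have witnesses of depth L, then a vertex has
  one of depth L + 1 with probability about exp (- k r (1 - q) ^ (k - 1)), which is at most q again.
  Errors need not be tracked through the rounds, because each target accuracy may ask the previous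
  round for a finer one.\<close>

lemma wit_density_vertex:
  fixes k :: nat and r q eps :: real
  assumes k: "1 \<le> k" and r: "0 \<le> r" and q: "0 \<le> q" "q \<le> 1" "exp (- (real k * r * (1 - q) ^ (k - 1))) \<le> q"
    and IH: "\<And>eps. eps > 0 \<Longrightarrow> \<exists>\<eta>>0. \<exists>N. \<forall>V :: nat set. \<forall>m. finite V \<and> N \<le> card V \<and> \<bar>real m - r * rcard V\<bar> \<le> \<eta> * rcard V \<longrightarrow>
      many_wit V k m L (q + eps) \<le> eps"
    and eps: "eps > 0"
  shows "\<exists>\<eta>>0. \<exists>N. \<forall>V :: nat set. \<forall>m x. finite V \<and> N \<le> card V \<and> \<bar>real m - r * rcard V\<bar> \<le> \<eta> * rcard V \<and> x \<in> V \<longrightarrow>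
      PR (iid m (rand_edge V k)) {cs. wit (set cs) (Suc L) x} \<le> q + eps"
proof -
  define K where "K = k - 1"
  \<comment> \<open>The limiting bound with all losses of order e put in. One e in 1 - q - 2 e comes
    from the witness density, the other absorbs the offset K of \<open>binomial_ratio_ge\<close>; r
    - e allows for fluctuations of the edge density. The maximum with 0 covers q close to 1.\<close>
  define G where "G e = exp (- (real k * (r - e) * (max 0 (1 - q - 2 * e)) ^ K))" for e :: real
  have "isCont G 0" unfolding G_def by (intro continuous_intros)
  moreover have "G 0 \<le> q" using q k by (simp add: G_def K_def)
  ultimately have "\<forall>\<^sub>F e in at 0. G e < q + eps / 4"
    unfolding isCont_def using eps by (intro order_tendstoD(2)[of G "G 0"]) auto
  then obtain d where d: "d > 0" "\<And>e. e \<noteq> 0 \<Longrightarrow> \<bar>e\<bar> < d \<Longrightarrow> G e < q + eps / 4"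
    by (auto simp: eventually_at dist_real_def)
  define e where "e = min (d / 2) (eps / 4)"
  have e: "e > 0" "e \<le> eps / 4" "G e < q + eps / 4" using d eps by (auto simp: e_def)
  obtain \<eta>0 N0 where \<eta>0: "\<eta>0 > 0" and N0: "\<And>V :: nat set. \<And>m. finite V \<Longrightarrow> N0 \<le> card V \<Longrightarrow>
      \<bar>real m - r * rcard V\<bar> \<le> \<eta>0 * rcard V \<Longrightarrow>
      many_wit V k m L (q + e) \<le> e"
    using IH[OF e(1)] by blast
  \<comment> \<open>Degree cutoff: the mean degree is at most k (r + 1), so this makes the tail term
    of \<open>wit_Suc_prob\<close> at most eps / 4.\<close>
  obtain a :: nat where a: "exp (real k * (r + 1)) * 4 / eps < 2 ^ a"
    using real_arch_pow[of 2] by auto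
  define \<eta> where "\<eta> = min (min e 1) (\<eta>0 / 4)"
  have \<eta>: "\<eta> > 0" "\<eta> \<le> e" "\<eta> \<le> 1" "\<eta> \<le> \<eta>0 / 4" using e \<eta>0 by (auto simp: \<eta>_def)
  obtain N1 :: nat where N1: "real K / e \<le> real N1" using real_arch_simple by blast
  \<comment> \<open>Passing to V - {x} and m - j adds at most \<eta> + a + r to the deviation of the
    edge count from its nominal value; half of \<open>\<eta>0 * real n\<close> absorbs this.\<close>
  obtain N2 :: nat where N2: "(\<eta> + real a + r) * 2 / \<eta>0 \<le> real N2" using real_arch_simple by blast
  define N where "N = N0 + N1 + N2 + k + 2"
  have "PR (iid m (rand_edge V k)) {cs. wit (set cs) (Suc L) x} \<le> q + eps"
    if V: "finite V" and n: "N \<le> card V" and m: "\<bar>real m - r * rcard V\<bar> \<le> \<eta> * rcard V" and x: "x \<in> V"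
    for V :: "nat set" and m x
  proof -
    define n where "n = card V - 1"
    have cV: "card V = Suc n" using n by (simp add: n_def N_def)
    have nN: "N0 \<le> n" "N1 \<le> n" "N2 \<le> n" "k < card V" "n > 0" using n cV by (auto simp: N_def)
    have cVx: "card (V - {x}) = n" using x V by (simp add: n_def)
    define \<sigma> where "\<sigma> = (max 0 (1 - q - 2 * e)) ^ K"
    have \<sigma>: "0 \<le> \<sigma>" "\<sigma> \<le> 1" using q e by (auto simp: \<sigma>_def intro!: power_le_one)
    have "PR (iid m (rand_edge V k)) {cs. wit (set cs) (Suc L) x}
     \<le> exp (- (real m * real k / rcard V) * \<sigma>) + e + exp (real m * real k / rcard V) / 2 ^ a"
    proof (rule wit_Suc_prob[OF V x k nN(4) \<sigma>])
      fix j assume j: "j \<le> a"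
      have "PR (iid (m - j) (rand_edge (V - {x}) k))
          {ns. real ((card V - 1 - card {y \<in> V - {x}. wit (set ns) L y}) choose (k - 1)) < \<sigma> * real ((card V - 1) choose (k - 1))}
        \<le> PR (iid (m - j) (rand_edge (V - {x}) k))
          {cs. (q + e) * real (card (V - {x})) \<le> real (card {y \<in> V - {x}. wit (set cs) L y})}"
      proof (intro measure_pmf.finite_measure_mono, safe, rule ccontr)
        fix ns assume 1: "real ((card V - 1 - card {y \<in> V - {x}. wit (set ns) L y}) choose (k - 1)) < \<sigma> * real ((card V - 1) choose (k - 1))"
          and 2: "\<not> (q + e) * real (card (V - {x})) \<le> real (card {y \<in> V - {x}. wit (set ns) L y})"
        define w where "w = card {y \<in> V - {x}. wit (set ns) L y}"
        have w: "w \<le> n" unfolding w_def cVx[symmetric] using V by (intro card_mono) auto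
        have w2: "real w < (q + e) * real n" using 2 by (simp add: w_def cVx)
        show False
        proof (cases "1 - q - 2 * e \<le> 0 \<and> K > 0")
          case True
          then have "\<sigma> = 0" by (auto simp: \<sigma>_def max_def)
          then show False using 1 by simp
        next
          case False
          have "real K / e \<le> real n" using N1 nN(2) by linarith
          then have "real K \<le> e * real n" using e by (simp add: field_simps)
          then have *: "(1 - q - 2 * e) * real n \<le> real n - real w - real K" using w2 by (simp add: algebra_simps)
          have **: "K \<le> n - w"
          proof (cases "K = 0")
            case False
            with \<open>\<not> (1 - q - 2 * e \<le> 0 \<and> K > 0)\<close> have "0 < 1 - q - 2 * e" by auto
            then have "0 \<le> (1 - q - 2 * e) * real n" by simp
            with * show ?thesis by linarith
          qed simp
          have "max 0 (1 - q - 2 * e) \<le> real (n - w - K) / real n" if "K > 0"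
            using * ** w nN(5) False that by (auto simp: le_divide_eq of_nat_diff max_def)
          then have "\<sigma> \<le> (real (n - w - K) / real n) ^ K"
            by (cases "K = 0") (auto simp: \<sigma>_def intro!: power_mono)
          then have "\<sigma> * real (n choose K) \<le> (real (n - w - K) / real n) ^ K * real (n choose K)"
            by (intro mult_right_mono) auto
          also have "\<dots> \<le> real ((n - w) choose K)" using ** nN by (intro binomial_ratio_ge) auto
          finally show False using 1 unfolding w_def n_def K_def by linarith
        qed
      qed simp
      also have "\<dots> \<le> e"
      proof (rule N0)
        have "(\<eta> + real a + r) * 2 / \<eta>0 \<le> real n" using N2 nN(3) by linarith
        then have *: "(\<eta> + real a + r) * 2 \<le> \<eta>0 * real n" using \<eta>0 by (simp add: field_simps)
        have "\<eta> * real n \<le> \<eta>0 / 4 * real n" using \<eta> by (intro mult_right_mono) auto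
        then have **: "\<eta> * real n * 4 \<le> \<eta>0 * real n" by simp
        have m': "\<bar>real m - r * real n - r\<bar> \<le> \<eta> * real n + \<eta>" using m cV by (simp add: algebra_simps)
        have "0 \<le> \<eta>0 * real n" using \<eta>0 by simp
        have "\<bar>real (m - j) - real m\<bar> \<le> real a" using j by linarith
        then show "\<bar>real (m - j) - r * real (card (V - {x}))\<bar> \<le> \<eta>0 * real (card (V - {x}))"
          unfolding cVx using m' * ** r \<open>0 \<le> \<eta>0 * real n\<close> unfolding abs_le_iff distrib_right by linarith
      qed (use V nN cVx in auto)
      finally show "PR (iid (m - j) (rand_edge (V - {x}) k))
          {ns. real ((card V - 1 - card {y \<in> V - {x}. wit (set ns) L y}) choose (k - 1)) < \<sigma> * real ((card V - 1) choose (k - 1))} \<le> e" .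
    qed (use e in auto)
    also have "exp (- (real m * real k / rcard V) * \<sigma>) \<le> G e"
    proof -
      have "(r - \<eta>) * rcard V \<le> real m" using m by (simp add: algebra_simps abs_le_iff)
      then have "r - \<eta> \<le> real m / rcard V" using cV by (simp add: le_divide_eq)
      then have "r - e \<le> real m / rcard V" using \<eta> by linarith
      then have "real k * (r - e) * \<sigma> \<le> real k * (real m / rcard V) * \<sigma>"
        using \<sigma> by (intro mult_right_mono mult_left_mono) auto
      then show ?thesis by (simp add: G_def \<sigma>_def mult_ac)
    qed
    also have "exp (real m * real k / rcard V) / 2 ^ a \<le> eps / 4"
    proof -
      have "real m \<le> (r + 1) * rcard V"
        using m mult_right_mono[of \<eta> 1 "rcard V"] \<eta> by (simp add: algebra_simps abs_le_iff)
      then have "real m / rcard V \<le> r + 1" using cV by (simp add: divide_le_eq)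
      then have "real k * (real m / rcard V) \<le> real k * (r + 1)" by (intro mult_left_mono) auto
      then have "exp (real m * real k / rcard V) \<le> exp (real k * (r + 1))" by (simp add: mult_ac)
      also have "\<dots> \<le> eps / 4 * 2 ^ a" using a eps by (simp add: field_simps)
      finally show ?thesis by (simp add: divide_le_eq)
    qed
    finally show ?thesis using e by linarith
  qed
  then show ?thesis using \<eta>(1) by blast
qed

text \<open>
  The bound \<open>q\<close> is preserved by each round, so it holds for every depth; a random \<open>x\<close> gives the mean and
  Efron--Stein the concentration, which the next round uses.
\<close>

lemma wit_density:
  fixes k :: nat and r q eps :: real
  assumes k: "1 \<le> k" and r: "0 \<le> r" and q: "0 \<le> q" "q \<le> 1" "exp (- (real k * r * (1 - q) ^ (k - 1))) \<le> q"
    and eps: "eps > 0"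
  shows "\<exists>\<eta>>0. \<exists>N. \<forall>V :: nat set. \<forall>m. finite V \<and> N \<le> card V \<and> \<bar>real m - r * rcard V\<bar> \<le> \<eta> * rcard V \<longrightarrow>
      many_wit V k m L (q + eps) \<le> eps"
  using eps
proof (induction L arbitrary: eps)
  case 0
  then have "(q + eps) * rcard V > 0" if "1 \<le> card V" for V :: "nat set"
    using that q(1) by (intro mult_pos_pos) auto
  then show ?case using 0 by (intro exI[of _ 1] conjI exI[of _ "1::nat"]) (auto simp: not_le[symmetric])
next
  case (Suc L)
  obtain \<eta>0 N0 where \<eta>0: "\<eta>0 > 0" and N0: "\<And>V :: nat set. \<And>m x. finite V \<Longrightarrow> N0 \<le> card V \<Longrightarrow>
      \<bar>real m - r * rcard V\<bar> \<le> \<eta>0 * rcard V \<Longrightarrow> x \<in> V \<Longrightarrow>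
      PR (iid m (rand_edge V k)) {cs. wit (set cs) (Suc L) x} \<le> q + eps / 2"
    using wit_density_vertex[OF k r q Suc.IH, of "eps / 2"] Suc.prems by (metis half_gt_zero)
  define \<kappa> where "\<kappa> = real k * (r + 1)"
  define B where "B = ball_mgf \<kappa> (exp 2) k (Suc L) ^ k"
  define \<eta> where "\<eta> = min \<eta>0 1"
  have B0: "B \<ge> 0" unfolding B_def using ball_mgf_ge_1[of \<kappa> "exp 2" k "Suc L"] r by (intro zero_le_power) (auto simp: \<kappa>_def)
  \<comment> \<open>For n vertices the variance is at most (r + 1) n B, and the deviation to be
    excluded is n eps / 2. Chebyshev gives 4 (r + 1) B / (eps^2 n), and requiring this to be at most
    eps produces the cube.\<close>
  obtain N1 :: nat where N1: "(r + 1) * B * 4 / eps ^ 3 \<le> real N1" using real_arch_simple by blast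
  define N where "N = N0 + N1 + k + 1"
  have "many_wit V k m (Suc L) (q + eps) \<le> eps"
    if V: "finite V" and n: "N \<le> card V" and m: "\<bar>real m - r * rcard V\<bar> \<le> \<eta> * rcard V" for V :: "nat set" and m
  proof -
    let ?p = "iid m (rand_edge V k)"
    let ?f = "\<lambda>cs. real (card {x \<in> V. wit (set cs) (Suc L) x})"
    have nN: "N0 \<le> card V" "N1 \<le> card V" "k \<le> card V" "card V > 0" using n by (auto simp: N_def)
    have fin: "finite (set_pmf ?p)" using V nN by simp
    have mn: "real m \<le> (r + 1) * rcard V"
      using m mult_right_mono[of \<eta> 1 "rcard V"] by (simp add: \<eta>_def algebra_simps abs_le_iff)
    have "EV ?p ?f = EV ?p (\<lambda>cs. \<Sum>x\<in>V. of_bool (wit (set cs) (Suc L) x))"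
      using V by (intro EV_cong) (simp add: sum.inter_filter[symmetric] of_bool_def flip: sum.If_cases del: wit.simps)
    also have "\<dots> = (\<Sum>x\<in>V. PR ?p {cs. wit (set cs) (Suc L) x})"
      using fin by (simp add: EV_sum EV_of_bool del: wit.simps)
    also have "\<dots> \<le> (\<Sum>x\<in>V. q + eps / 2)"
    proof (intro sum_mono N0)
      have "\<eta> * rcard V \<le> \<eta>0 * rcard V" by (intro mult_right_mono) (auto simp: \<eta>_def)
      then show "\<bar>real m - r * rcard V\<bar> \<le> \<eta>0 * rcard V" using m by linarith
    qed (use V nN in auto)
    finally have E: "EV ?p ?f \<le> (q + eps / 2) * rcard V" by (simp add: mult.commute)
    have "PR ?p {cs. (q + eps) * rcard V \<le> ?f cs}
      \<le> PR ?p {cs. eps / 2 * rcard V \<le> \<bar>?f cs - EV ?p ?f\<bar>}"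
    proof (intro measure_pmf.finite_measure_mono, safe)
      fix cs assume "(q + eps) * rcard V \<le> ?f cs"
      then show "eps / 2 * rcard V \<le> \<bar>?f cs - EV ?p ?f\<bar>"
        using E abs_ge_self[of "?f cs - EV ?p ?f"] unfolding distrib_right by linarith
    qed simp
    also have "\<dots> \<le> Var ?p ?f / (eps / 2 * rcard V)\<^sup>2"
      using Suc.prems nN by (intro Chebyshev fin) auto
    also have "\<dots> \<le> (real m * B) / (eps / 2 * rcard V)\<^sup>2"
    proof (intro divide_right_mono)
      have "real (k * m) \<le> \<kappa> * rcard V" unfolding \<kappa>_def using mn
        by (simp add: mult_left_mono mult.assoc)
      then show "Var ?p ?f \<le> real m * B" unfolding B_def using V k nN r
        by (intro rand_edge_wit_card_Var) (auto simp: \<kappa>_def)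
    qed simp
    also have "\<dots> \<le> ((r + 1) * rcard V * B) / (eps / 2 * rcard V)\<^sup>2"
      using mn B0 by (intro divide_right_mono mult_right_mono) auto
    also have "\<dots> = (r + 1) * B * 4 / eps ^ 3 / rcard V * eps"
      using Suc.prems nN by (simp add: field_simps power2_eq_square power3_eq_cube)
    also have "\<dots> \<le> 1 * eps"
    proof (intro mult_right_mono)
      have "(r + 1) * B * 4 / eps ^ 3 \<le> rcard V" using N1 nN(2) by linarith
      then show "(r + 1) * B * 4 / eps ^ 3 / rcard V \<le> 1"
        using nN(4) by (subst divide_le_eq_1_pos) auto
    qed (use Suc.prems in auto)
    finally show ?thesis by simp
  qed
  moreover have "\<eta> > 0" using \<eta>0 by (simp add: \<eta>_def)
  ultimately show ?case by blast
qed

section \<open>Random orders and monotone chains\<close>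

definition pos :: "'a list \<Rightarrow> 'a \<Rightarrow> nat" where
  "pos xs x = length (takeWhile (\<lambda>y. y \<noteq> x) xs)"

lemma nth_pos: "x \<in> set xs \<Longrightarrow> xs ! pos xs x = x"
  unfolding pos_def by (induction xs) auto

lemma inj_on_pos: "inj_on (pos xs) (set xs)"
  by (metis inj_onI nth_pos)

lemma pos_map: "inj f \<Longrightarrow> pos (map f xs) (f x) = pos xs x"
  unfolding pos_def by (induction xs) (auto simp: inj_def)

abbreviation "rand_perm V \<equiv> pmf_of_set (permutations_of_set V)"

lemma set_rand_perm [simp]: "finite V \<Longrightarrow> set_pmf (rand_perm V) = permutations_of_set V"
  by simp

lemma rand_perm_map:
  assumes "finite V" "f permutes V"
  shows "map_pmf (map f) (rand_perm V) = rand_perm V"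
proof -
  have "map f ` permutations_of_set V = permutations_of_set V"
  proof (rule card_subset_eq)
    have inj: "inj f" using assms permutes_inj by blast
    show "map f ` permutations_of_set V \<subseteq> permutations_of_set V"
      using assms inj permutes_image[OF assms(2)]
      by (auto simp: permutations_of_set_def distinct_map inj_on_def inj_def)
    show "card (map f ` permutations_of_set V) = card (permutations_of_set V)"
      using inj by (intro card_image) (auto intro: inj_on_subset[OF inj_mapI])
  qed (use assms in simp)
  moreover have "inj_on (map f) (permutations_of_set V)"
    using assms permutes_inj by (metis inj_mapI inj_on_subset subset_UNIV)
  ultimately show ?thesis using assms by (subst map_pmf_of_set_inj) auto
qed

text \<open>Relabelling by a permutation of the entries of xs keeps a uniform order uniform, so all
  rearrangements of xs are equally likely to be increasing. These events are disjoint because a set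
  has only one increasing enumeration. A list with a repetition is never strictly
  increasing.\<close>

lemma prob_rand_perm_sorted:
  assumes V: "finite V" and xs: "set xs \<subseteq> V"
  shows "PR (rand_perm V) {\<pi>. sorted_wrt (<) (map (pos \<pi>) xs)} \<le> 1 / fact (length xs)"
proof (cases "distinct xs")
  case False
  then have "{\<pi>. sorted_wrt (<) (map (pos \<pi>) xs)} = {}"
    by (metis (mono_tags, lifting) distinct_map empty_Collect_eq strict_sorted_iff)
  then show ?thesis by simp
next
  case True
  let ?p = "rand_perm V" and ?R = "{\<rho>. \<rho> permutes set xs}"
  define Ev where "Ev \<rho> = {\<pi> \<in> permutations_of_set V. sorted_wrt (<) (map (pos \<pi>) (map \<rho> xs))}" for \<rho>
  have Ev_prob: "PR ?p (Ev \<rho>) = PR ?p {\<pi>. sorted_wrt (<) (map (pos \<pi>) xs)}"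
    if \<rho>: "\<rho> permutes set xs" for \<rho>
  proof -
    have \<rho>V: "\<rho> permutes V" using \<rho> xs by (rule permutes_subset)
    have "PR ?p (Ev \<rho>) = PR ?p {\<pi>. sorted_wrt (<) (map (pos \<pi>) (map \<rho> xs))}"
      using V by (intro measure_pmf.finite_measure_eq_AE) (auto simp: AE_measure_pmf_iff Ev_def)
    also have "\<dots> = PR (map_pmf (map \<rho>) ?p) {\<pi>. sorted_wrt (<) (map (pos \<pi>) (map \<rho> xs))}"
      using rand_perm_map[OF V \<rho>V] by simp
    also have "\<dots> = PR ?p {\<pi>. sorted_wrt (<) (map (pos \<pi>) xs)}"
      using permutes_inj[OF \<rho>] by (simp add: vimage_def comp_def pos_map)
    finally show ?thesis .
  qed
  have disj: "disjoint_family_on Ev ?R"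
    unfolding disjoint_family_on_def
  proof (intro ballI impI, rule ccontr)
    fix \<rho> \<rho>' assume \<rho>: "\<rho> \<in> ?R" "\<rho>' \<in> ?R" "\<rho> \<noteq> \<rho>'" and "Ev \<rho> \<inter> Ev \<rho>' \<noteq> {}"
    then obtain \<pi> where \<pi>: "\<pi> \<in> permutations_of_set V" "sorted_wrt (<) (map (pos \<pi>) (map \<rho> xs))"
      "sorted_wrt (<) (map (pos \<pi>) (map \<rho>' xs))" by (auto simp: Ev_def)
    have sets: "set (map \<rho> xs) = set xs" "set (map \<rho>' xs) = set xs"
      using \<rho> permutes_image by auto
    then have "map (pos \<pi>) (map \<rho> xs) = map (pos \<pi>) (map \<rho>' xs)"
      by (intro strict_sorted_equal \<pi>) (metis set_map)
    moreover have "inj_on (pos \<pi>) (set (map \<rho> xs) \<union> set (map \<rho>' xs))"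
      unfolding sets using xs \<pi>(1) by (auto simp: permutations_of_set_def intro: inj_on_subset[OF inj_on_pos])
    ultimately have "map \<rho> xs = map \<rho>' xs" by (rule map_inj_on)
    then have "\<rho> x = \<rho>' x" for x using \<rho> by (cases "x \<in> set xs") (auto simp: permutes_def)
    with \<rho>(3) show False by auto
  qed
  have finR: "finite ?R" by (rule finite_permutations) simp
  have "real (card ?R) * PR ?p {\<pi>. sorted_wrt (<) (map (pos \<pi>) xs)} = (\<Sum>\<rho>\<in>?R. PR ?p (Ev \<rho>))"
    using Ev_prob by simp
  also have "\<dots> = PR ?p (\<Union>(Ev ` ?R))"
    using finR disj by (intro measure_pmf.finite_measure_finite_Union[symmetric]) auto
  also have "\<dots> \<le> 1" by simp
  also have "card ?R = fact (length xs)"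
    using True by (subst card_permutations[where n = "length xs"]) (auto simp: distinct_card)
  finally show ?thesis by (simp add: field_simps)
qed

lemma real_card_filter: "finite A \<Longrightarrow> real (card {x \<in> A. P x}) = (\<Sum>x\<in>A. of_bool (P x))"
  by (simp add: sum_of_bool_eq Int_def)

lemma sum_Un_le:
  fixes f :: "_ \<Rightarrow> real"
  assumes "finite A" "finite B" "\<And>x. 0 \<le> f x"
  shows "sum f (A \<union> B) \<le> sum f A + sum f B"
  using sum.union_inter[OF assms(1,2), of f] sum_nonneg[of "A \<inter> B" f] assms(3) by simp

lemma sum_UN_le:
  fixes f :: "_ \<Rightarrow> real"
  assumes "finite I" "\<And>i. i \<in> I \<Longrightarrow> finite (A i)" "\<And>x. 0 \<le> f x"
  shows "sum f (\<Union>i\<in>I. A i) \<le> (\<Sum>i\<in>I. sum f (A i))"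
  using assms(1,2)
proof (induction rule: finite_induct)
  case (insert i I)
  have "sum f (\<Union>i\<in>insert i I. A i) \<le> sum f (A i) + sum f (\<Union>i\<in>I. A i)"
    using insert assms(3) by (simp add: sum_Un_le)
  then show ?case using insert by fastforce
qed simp

lemma sum_le_exp: "x \<ge> 0 \<Longrightarrow> (\<Sum>i<l. x ^ i / fact i) \<le> exp (x :: real)"
  using sum_le_suminf[OF summable_exp_generic, of "{..<l}" x]
  by (simp add: exp_def divide_inverse mult.commute)

text \<open>
  Both directions occur: chains increasing from \<open>x\<close> describe the variables that \<open>x\<close> influences,
  decreasing ones those that influence \<open>x\<close>.
\<close>

definition mono_chain :: "'a list \<Rightarrow> 'a list \<Rightarrow> bool" where
  "mono_chain \<pi> xs \<longleftrightarrow> sorted_wrt (<) (map (pos \<pi>) xs) \<or> sorted_wrt (<) (map (pos \<pi>) (rev xs))"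

lemma prob_mono_chain:
  assumes "finite V" "set xs \<subseteq> V"
  shows "PR (rand_perm V) {\<pi>. mono_chain \<pi> xs} \<le> 2 / fact (length xs)"
proof -
  have "PR (rand_perm V) {\<pi>. mono_chain \<pi> xs} \<le>
     PR (rand_perm V) {\<pi>. sorted_wrt (<) (map (pos \<pi>) xs)} +
     PR (rand_perm V) {\<pi>. sorted_wrt (<) (map (pos \<pi>) (rev xs))}"
    unfolding mono_chain_def Collect_disj_eq by (intro measure_Un_le) auto
  also have "\<dots> \<le> 1 / fact (length xs) + 1 / fact (length (rev xs))"
    using assms by (intro add_mono prob_rand_perm_sorted) auto
  finally show ?thesis by simp
qed

lemma mono_chain_take: "mono_chain \<pi> xs \<Longrightarrow> mono_chain \<pi> (take i xs)"
proof -
  have "sorted_wrt (<) (map (pos \<pi>) (rev xs)) \<Longrightarrow> sorted_wrt (<) (map (pos \<pi>) (rev (take i xs)))"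
    by (subst (asm) append_take_drop_id[of i xs, symmetric], subst (asm) rev_append)
      (simp add: sorted_wrt_append)
  then show "mono_chain \<pi> xs \<Longrightarrow> mono_chain \<pi> (take i xs)"
    unfolding mono_chain_def by (auto simp: take_map[symmetric] sorted_wrt_take)
qed

section \<open>Counting chains with truncated neighbourhoods\<close>

abbreviation linked :: "('a \<Rightarrow> 'a set) \<Rightarrow> 'a list \<Rightarrow> bool" where
  "linked N \<equiv> successively (\<lambda>a b. b \<in> N a)"

definition long_chain :: "'a set \<Rightarrow> ('a \<Rightarrow> 'a set) \<Rightarrow> nat \<Rightarrow> 'a list \<Rightarrow> 'a set" where
  "long_chain V N l \<pi> = {x \<in> V. \<exists>xs. length xs = l \<and> linked N (x # xs) \<and> mono_chain \<pi> (x # xs)}"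

context
  fixes V :: "'a set" and N :: "'a \<Rightarrow> 'a set" and D :: nat
  assumes V: "finite V" and N: "\<And>x. x \<in> V \<Longrightarrow> N x \<subseteq> V" "\<And>x. x \<in> V \<Longrightarrow> x \<in> N x"
    and sym: "\<And>x y. y \<in> N x \<Longrightarrow> x \<in> N y" and D: "D \<ge> 1"
begin

abbreviation "smallN x \<equiv> card (N x) \<le> D"

text \<open>Stopping at the first vertex with more than D neighbours keeps the number of chains
  bounded although neighbourhood sizes are not. The last vertex is exempt from
  \<open>smallN\<close>, so that chains which have just been stopped are included.\<close>

definition chains :: "nat \<Rightarrow> 'a list set" where
  "chains i = {xs. length xs = Suc i \<and> linked N xs \<and> set xs \<subseteq> V \<and> (\<forall>x\<in>set (butlast xs). smallN x)}"

definition big_chains :: "nat \<Rightarrow> 'a list set" where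
  "big_chains i = {xs \<in> chains i. \<not> smallN (last xs)}"

text \<open>Weighted by size, because a chain traced back from a big vertex may continue to any of
  its neighbours.\<close>

definition big_total :: real where
  "big_total = (\<Sum>x | x \<in> V \<and> \<not> smallN x. real (card (N x)))"

lemma finite_N: "x \<in> V \<Longrightarrow> finite (N x)"
  using N(1) V finite_subset by blast

lemma finite_chains: "finite (chains i)"
  by (rule finite_subset[OF _ finite_lists_length_eq[OF V, of "Suc i"]]) (auto simp: chains_def)

lemma card_chains: "card (chains i) \<le> card V * D ^ i"
proof (induction i)
  case 0
  have "chains 0 \<subseteq> (\<lambda>x. [x]) ` V" by (auto simp: chains_def length_Suc_conv)
  then have "card (chains 0) \<le> card ((\<lambda>x. [x]) ` V)" using V by (intro card_mono) auto
  also have "\<dots> \<le> card V" by (rule card_image_le[OF V])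
  finally show ?case by simp
next
  case (Suc i)
  let ?C = "{ys \<in> chains i. smallN (last ys)}"
  have "chains (Suc i) \<subseteq> (\<lambda>(ys, y). ys @ [y]) ` (SIGMA ys:?C. N (last ys))"
  proof
    fix xs assume xs: "xs \<in> chains (Suc i)"
    then have "xs \<noteq> []" by (auto simp: chains_def)
    then obtain ys y where eq: "xs = ys @ [y]" by (metis append_butlast_last_id)
    then have "ys \<noteq> []" using xs by (auto simp: chains_def)
    then have "ys \<in> ?C" "y \<in> N (last ys)"
      using xs unfolding eq by (auto simp: chains_def successively_append_iff dest: in_set_butlastD)
    then show "xs \<in> (\<lambda>(ys, y). ys @ [y]) ` (SIGMA ys:?C. N (last ys))" using eq by force
  qed
  moreover have lastV: "last ys \<in> V" if "ys \<in> chains i" for ys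
    using that last_in_set[of ys] by (cases "ys = []") (auto simp: chains_def)
  then have fin: "finite (SIGMA ys:?C. N (last ys))"
    using finite_chains finite_N by (intro finite_SigmaI) auto
  ultimately have "card (chains (Suc i)) \<le> card (SIGMA ys:?C. N (last ys))"
    by (meson card_image_le card_mono finite_imageI le_trans)
  also have "\<dots> = (\<Sum>ys\<in>?C. card (N (last ys)))"
    using finite_chains lastV finite_N by (intro card_SigmaI) auto
  also have "\<dots> \<le> (\<Sum>ys\<in>?C. D)" by (intro sum_mono) auto
  also have "\<dots> \<le> card (chains i) * D" by (simp add: card_mono finite_chains)
  also have "\<dots> \<le> card V * D ^ Suc i" using Suc.IH by simp
  finally show ?case .
qed

text \<open>
  These chains are counted from their last vertex backwards; all steps but the first one taken have at most
  \<open>D\<close> choices, by symmetry of \<open>N\<close>.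
\<close>

lemma card_big_chains: "real (card (big_chains i)) \<le> real D ^ i * big_total"
proof (induction i)
  case 0
  have "big_chains 0 \<subseteq> (\<lambda>x. [x]) ` {x \<in> V. \<not> smallN x}" by (auto simp: big_chains_def chains_def length_Suc_conv)
  then have "card (big_chains 0) \<le> card ((\<lambda>x. [x]) ` {x \<in> V. \<not> smallN x})" using V by (intro card_mono) auto
  also have "\<dots> \<le> card {x \<in> V. \<not> smallN x}" by (rule card_image_le) (use V in auto)
  finally have "real (card (big_chains 0)) \<le> (\<Sum>x\<in>{x \<in> V. \<not> smallN x}. 1)" by simp
  also have "\<dots> \<le> big_total" unfolding big_total_def
    using D by (intro sum_mono) auto
  finally show ?case by simp
next
  case (Suc i)
  have fin: "finite (big_chains i)" using finite_chains by (simp add: big_chains_def)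
  have hdV: "hd ys \<in> V" if "ys \<in> big_chains i" for ys
    using that hd_in_set[of ys] by (cases "ys = []") (auto simp: big_chains_def chains_def)
  have "big_chains (Suc i) \<subseteq> (\<lambda>(ys, y). y # ys) ` (SIGMA ys:big_chains i. N (hd ys))"
  proof
    fix xs assume xs: "xs \<in> big_chains (Suc i)"
    then obtain y ys where eq: "xs = y # ys" by (cases xs) (auto simp: big_chains_def chains_def)
    have "ys \<noteq> []" using xs unfolding eq by (auto simp: big_chains_def chains_def)
    then have "ys \<in> big_chains i" "y \<in> N (hd ys)"
      using xs sym unfolding eq by (auto simp: big_chains_def chains_def successively_Cons)
    then show "xs \<in> (\<lambda>(ys, y). y # ys) ` (SIGMA ys:big_chains i. N (hd ys))" using eq by force
  qed
  moreover have "finite (SIGMA ys:big_chains i. N (hd ys))"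
    using fin hdV finite_N by (intro finite_SigmaI) auto
  ultimately have "card (big_chains (Suc i)) \<le> card (SIGMA ys:big_chains i. N (hd ys))"
    by (meson card_image_le card_mono finite_imageI le_trans)
  also have "\<dots> = (\<Sum>ys\<in>big_chains i. card (N (hd ys)))"
    using fin hdV finite_N by (intro card_SigmaI) auto
  finally have *: "card (big_chains (Suc i)) \<le> (\<Sum>ys\<in>big_chains i. card (N (hd ys)))" .
  show ?case
  proof (cases "i = 0")
    case True
    have "(\<Sum>ys\<in>big_chains i. card (N (hd ys))) \<le> (\<Sum>ys\<in>(\<lambda>x. [x]) ` {x \<in> V. \<not> smallN x}. card (N (hd ys)))"
      using V by (intro sum_mono2) (auto simp: True big_chains_def chains_def length_Suc_conv)
    also have "\<dots> = (\<Sum>x\<in>{x \<in> V. \<not> smallN x}. card (N x))"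
      by (subst sum.reindex) (auto simp: inj_on_def)
    finally have "real (card (big_chains (Suc i))) \<le> big_total"
      using * by (simp add: big_total_def flip: of_nat_sum)
    also have "\<dots> \<le> real D * big_total"
      using D mult_right_mono[of 1 "real D" big_total] by (simp add: big_total_def sum_nonneg)
    finally show ?thesis using True by simp
  next
    case False
    have "(\<Sum>ys\<in>big_chains i. card (N (hd ys))) \<le> (\<Sum>ys\<in>big_chains i. D)"
    proof (intro sum_mono)
      fix ys assume ys: "ys \<in> big_chains i"
      then obtain y z zs where "ys = y # z # zs" using False
        by (cases ys; cases "tl ys") (auto simp: big_chains_def chains_def)
      then show "card (N (hd ys)) \<le> D" using ys by (auto simp: big_chains_def chains_def)
    qed
    then have "real (card (big_chains (Suc i))) \<le> real (card (big_chains i) * D)"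
      using * by (intro of_nat_mono) simp
    also have "\<dots> \<le> real D ^ i * big_total * real D" using Suc.IH by (simp add: mult_right_mono)
    finally show ?thesis by (simp add: mult_ac)
  qed
qed

text \<open>Cut the chain at its first big vertex, if there is one before the end; a prefix of a
  monotone chain is monotone and starts at the same vertex.\<close>

lemma long_chain_cover:
  assumes "\<pi> \<in> permutations_of_set V" "x \<in> long_chain V N l \<pi>"
  shows "\<exists>xs \<in> chains l \<union> (\<Union>i<l. big_chains i). mono_chain \<pi> xs \<and> hd xs = x"
proof -
  obtain ys where ys: "x \<in> V" "length ys = l" "linked N (x # ys)" "mono_chain \<pi> (x # ys)"
    using assms by (auto simp: long_chain_def)
  let ?xs = "x # ys"
  have sub: "linked N zs \<Longrightarrow> zs \<noteq> [] \<Longrightarrow> hd zs \<in> V \<Longrightarrow> set zs \<subseteq> V" for zs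
    by (induction zs rule: induct_list012) (use N(1) in auto)
  have V': "set ?xs \<subseteq> V" using sub[of ?xs] ys by auto
  show ?thesis
  proof (cases "\<forall>x\<in>set (butlast ?xs). smallN x")
    case True
    then have "?xs \<in> chains l" using ys V' by (auto simp: chains_def)
    then show ?thesis using ys by (intro bexI[of _ ?xs]) auto
  next
    case False
    then obtain z where z: "z \<in> set (butlast ?xs)" "\<not> smallN z" by blast
    then obtain j where j: "j < length (butlast ?xs)" "butlast ?xs ! j = z" by (metis in_set_conv_nth)
    then have "?xs ! j = z" using nth_butlast by metis
    then have "\<exists>i. i < l \<and> \<not> smallN (?xs ! i)"
      using z j(1) ys(2) unfolding length_butlast by auto
    define i where "i = (LEAST i. i < l \<and> \<not> smallN (?xs ! i))"
    have i: "i < l" "\<not> smallN (?xs ! i)"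
      using LeastI_ex[OF \<open>\<exists>i. i < l \<and> \<not> smallN (?xs ! i)\<close>] by (auto simp: i_def)
    have less: "smallN (?xs ! j)" if "j < i" for j
      using not_less_Least[of j "\<lambda>i. i < l \<and> \<not> smallN (?xs ! i)"] that i by (auto simp: i_def)
    let ?zs = "take (Suc i) ?xs"
    have len: "length ?zs = Suc i" using i ys by simp
    have "?zs \<noteq> []" using len by (metis list.size(3) nat.distinct(1))
    then have "last ?zs = ?zs ! i" using len by (metis last_conv_nth diff_Suc_1)
    also have "\<dots> = ?xs ! i" by (rule nth_take) simp
    finally have last: "last ?zs = ?xs ! i" .
    have bl: "butlast ?zs = take i ?xs" using butlast_take[of "Suc i" ?xs] i ys by (simp del: take_Suc_Cons butlast.simps)
    have "linked N ?zs" using ys(3) append_take_drop_id[of "Suc i" ?xs] by (metis successively_append_iff)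
    moreover have "set ?zs \<subseteq> V" using V' set_take_subset[of "Suc i" ?xs] by (rule order_trans[rotated])
    moreover have "\<forall>x\<in>set (butlast ?zs). smallN x"
      unfolding bl using less i ys by (auto simp: in_set_conv_nth)
    ultimately have "?zs \<in> big_chains i" using len last i by (simp add: big_chains_def chains_def)
    then have "?zs \<in> chains l \<union> (\<Union>i<l. big_chains i)" using i by blast
    moreover have "mono_chain \<pi> ?zs" by (rule mono_chain_take[OF ys(4)])
    moreover have "hd ?zs = x" by simp
    ultimately show ?thesis by blast
  qed
qed

text \<open>Union bound over the cover. Chains that are never stopped give the term in which the
  factorial beats D ^ l; summing over the stopping time of the others gives an exponential series.
  The second term does not decay with l and has to be made small through D.\<close>

lemma EV_card_long_chain:
  "EV (rand_perm V) (\<lambda>\<pi>. real (card (long_chain V N l \<pi>)))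
     \<le> 2 * (rcard V * real D ^ l / fact (Suc l) + exp (real D) * big_total)"
proof -
  let ?p = "rand_perm V"
  let ?S = "chains l \<union> (\<Union>i<l. big_chains i)"
  have fin: "finite (set_pmf ?p)" using V by simp
  have finS: "finite ?S" using finite_chains by (auto simp: big_chains_def)
  have prob: "PR ?p {\<pi>. mono_chain \<pi> xs} \<le> 2 / fact (Suc i)" if "xs \<in> chains i" for xs i
    using prob_mono_chain[OF V, of xs] that by (auto simp: chains_def)
  have "EV ?p (\<lambda>\<pi>. real (card (long_chain V N l \<pi>))) \<le> EV ?p (\<lambda>\<pi>. \<Sum>xs\<in>?S. of_bool (mono_chain \<pi> xs))"
  proof (intro EV_mono fin)
    fix \<pi> assume "\<pi> \<in> set_pmf ?p"
    then have \<pi>: "\<pi> \<in> permutations_of_set V" using V by simp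
    have "long_chain V N l \<pi> \<subseteq> hd ` {xs \<in> ?S. mono_chain \<pi> xs}"
      using long_chain_cover[OF \<pi>] by blast
    then have "card (long_chain V N l \<pi>) \<le> card (hd ` {xs \<in> ?S. mono_chain \<pi> xs})"
      using finS by (intro card_mono) auto
    also have "\<dots> \<le> card {xs \<in> ?S. mono_chain \<pi> xs}"
      using finS by (intro card_image_le) auto
    finally have "real (card (long_chain V N l \<pi>)) \<le> real (card {xs \<in> ?S. mono_chain \<pi> xs})" by simp
    also have "\<dots> = (\<Sum>xs\<in>?S. of_bool (mono_chain \<pi> xs))"
      by (rule real_card_filter[OF finS])
    finally show "real (card (long_chain V N l \<pi>)) \<le> (\<Sum>xs\<in>?S. of_bool (mono_chain \<pi> xs))" .
  qed
  also have "\<dots> = (\<Sum>xs\<in>?S. PR ?p {\<pi>. mono_chain \<pi> xs})"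
    by (simp add: EV_sum[OF fin] EV_of_bool)
  also have "\<dots> \<le> (\<Sum>xs\<in>chains l. PR ?p {\<pi>. mono_chain \<pi> xs})
      + (\<Sum>xs\<in>(\<Union>i<l. big_chains i). PR ?p {\<pi>. mono_chain \<pi> xs})"
    using finS by (intro sum_Un_le) auto
  also have "(\<Sum>xs\<in>(\<Union>i<l. big_chains i). PR ?p {\<pi>. mono_chain \<pi> xs})
      \<le> (\<Sum>i<l. \<Sum>xs\<in>big_chains i. PR ?p {\<pi>. mono_chain \<pi> xs})"
    using finite_chains by (intro sum_UN_le) (auto simp: big_chains_def)
  also have "\<dots> \<le> (\<Sum>i<l. \<Sum>xs\<in>big_chains i. 2 / fact (Suc i))"
    by (intro sum_mono prob) (auto simp: big_chains_def)
  also have "\<dots> = (\<Sum>i<l. real (card (big_chains i)) * (2 / fact (Suc i)))" by simp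
  also have "\<dots> \<le> (\<Sum>i<l. (real D ^ i * big_total) * (2 / fact i))"
  proof (intro sum_mono mult_mono card_big_chains)
    fix i show "(2 :: real) / fact (Suc i) \<le> 2 / fact i"
      by (intro divide_left_mono fact_mono) auto
  qed (auto simp: big_total_def intro!: mult_nonneg_nonneg sum_nonneg)
  also have "\<dots> = 2 * big_total * (\<Sum>i<l. real D ^ i / fact i)"
    by (simp add: sum_distrib_left mult_ac)
  also have "\<dots> \<le> 2 * big_total * exp (real D)"
    by (intro mult_left_mono sum_le_exp) (auto simp: big_total_def sum_nonneg)
  also have "(\<Sum>xs\<in>chains l. PR ?p {\<pi>. mono_chain \<pi> xs}) \<le> (\<Sum>xs\<in>chains l. 2 / fact (Suc l))"
    by (intro sum_mono prob)
  also have "\<dots> \<le> real (card V * D ^ l) * (2 / fact (Suc l))"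
    using card_chains[of l] by (simp only: sum_constant) (intro mult_right_mono of_nat_mono; simp)
  finally show ?thesis by (simp add: algebra_simps del: fact_Suc)
qed

lemmas EV_card_long_chain_sum = EV_card_long_chain[unfolded big_total_def]

end

section \<open>Neighbourhoods in residual instances\<close>

lemma graph_dist_le: "graph_dist E u v \<le> enat R \<longleftrightarrow> (\<exists>d\<le>R. (u, v) \<in> E ^^ d)"
proof
  let ?S = "{enat d |d. (u, v) \<in> E ^^ d}"
  assume le: "graph_dist E u v \<le> enat R"
  then have "?S \<noteq> {}" unfolding graph_dist_def by (auto simp: Inf_enat_def split: if_splits)
  then have "Inf ?S \<in> ?S" unfolding Inf_enat_def by (auto intro: LeastI)
  then obtain d where "Inf ?S = enat d" "(u, v) \<in> E ^^ d" by auto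
  then show "\<exists>d\<le>R. (u, v) \<in> E ^^ d" using le by (auto simp: graph_dist_def)
next
  assume "\<exists>d\<le>R. (u, v) \<in> E ^^ d"
  then obtain d where d: "d \<le> R" "(u, v) \<in> E ^^ d" by blast
  then have "graph_dist E u v \<le> enat d" unfolding graph_dist_def by (intro Inf_lower) auto
  also have "\<dots> \<le> enat R" using d by simp
  finally show "graph_dist E u v \<le> enat R" .
qed

text \<open>Forgetting the occurrence numbers that tell equal clause nodes apart recovers the
  multiplicities, so neighbourhoods can be computed on multisets of clauses.\<close>

lemma image_mset_occurrences:
  "image_mset (\<lambda>(c, i). f c) (mset_set {(c, i). i < count M c \<and> Q c}) = image_mset f (filter_mset Q M)"
proof -
  let ?A = "{(c, i). i < count M c \<and> Q c}"
  have A: "?A = (SIGMA c:{c \<in> set_mset M. Q c}. {..<count M c})"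
    by (auto simp: count_greater_zero_iff[symmetric] simp del: count_greater_zero_iff)
  have fin: "finite ?A" unfolding A by auto
  have "image_mset fst (mset_set ?A) = filter_mset Q M"
  proof (rule multiset_eqI)
    fix c
    have "count (image_mset fst (mset_set ?A)) c = (\<Sum>p\<in>{p \<in> ?A. fst p = c}. count (mset_set ?A) p)"
      unfolding count_image_mset' using fin by (intro sum.cong) auto
    also have "\<dots> = (\<Sum>p\<in>{p \<in> ?A. fst p = c}. 1)"
      using fin by (intro sum.cong count_mset_set(1)) auto
    also have "\<dots> = card {p \<in> ?A. fst p = c}" by simp
    also have "{p \<in> ?A. fst p = c} = (if Q c then Pair c ` {..<count M c} else {})" by auto
    also have "card \<dots> = count (filter_mset Q M) c" by (simp add: card_image inj_on_def)
    finally show "count (image_mset fst (mset_set ?A)) c = count (filter_mset Q M) c" .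
  qed
  then have "image_mset f (image_mset fst (mset_set ?A)) = image_mset f (filter_mset Q M)" by simp
  then show ?thesis by (simp add: case_prod_unfold image_mset.compositionality comp_def)
qed

context
  fixes V :: "nat set" and M :: "clause multiset" and x :: nat
  assumes x: "x \<in> V" and M: "\<And>S b. (S, b) \<in># M \<Longrightarrow> S \<subseteq> V"
begin

abbreviation (input) "G \<equiv> edges \<lparr>vars = V, clauses = M\<rparr>"
abbreviation (input) "supports \<equiv> fst ` set_mset M"

lemma edge_iff:
  "(u, v) \<in> G \<longleftrightarrow> (\<exists>y c i. y \<in> V \<and> i < count M c \<and> y \<in> fst c \<and>
     ((u = VarNode y \<and> v = ClauseNode c i) \<or> (u = ClauseNode c i \<and> v = VarNode y)))"
  unfolding edges_def Let_def by auto

text \<open>Walks from x alternate between variables and clauses: parity tells the kind of the end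
  point, and two graph steps make one hypergraph step.\<close>

lemma walk_sound:
  "(VarNode x, v) \<in> G ^^ d \<Longrightarrow>
     (case v of VarNode y \<Rightarrow> even d \<and> y \<in> hball supports (d div 2) {x}
      | ClauseNode c i \<Rightarrow> odd d \<and> i < count M c \<and> fst c \<inter> hball supports (d div 2) {x} \<noteq> {})"
proof (induction d arbitrary: v)
  case (Suc d)
  then obtain u where u: "(VarNode x, u) \<in> G ^^ d" "(u, v) \<in> G" by auto
  from u(2) consider y c i where "y \<in> V" "i < count M c" "y \<in> fst c" "u = VarNode y" "v = ClauseNode c i"
    | y c i where "y \<in> V" "i < count M c" "y \<in> fst c" "u = ClauseNode c i" "v = VarNode y"
    unfolding edge_iff by blast
  then show ?case
  proof cases
    case 1
    then have "even d" "y \<in> hball supports (d div 2) {x}" using Suc.IH[OF u(1)] by auto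
    then show ?thesis using 1 by (auto elim!: evenE)
  next
    case 2
    then have *: "odd d" "fst c \<inter> hball supports (d div 2) {x} \<noteq> {}" using Suc.IH[OF u(1)] by auto
    have "fst c \<in> supports" using 2 by (metis count_inI image_eqI not_less_zero)
    then have "y \<in> hball supports (Suc (d div 2)) {x}" using * 2 by auto
    moreover have "Suc d div 2 = Suc (d div 2)" using *(1) by (auto elim!: oddE)
    ultimately show ?thesis using * 2 by auto
  qed
qed simp

lemma walk_complete_var:
  "y \<in> hball supports h {x} \<Longrightarrow> y \<in> V \<and> (\<exists>d\<le>2 * h. (VarNode x, VarNode y) \<in> G ^^ d)"
proof (induction h arbitrary: y)
  case 0
  then show ?case using x by auto
next
  case (Suc h)
  consider "y \<in> hball supports h {x}"
    | S b z where "(S, b) \<in># M" "y \<in> S" "z \<in> S" "z \<in> hball supports h {x}" using Suc.prems by auto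
  then show ?case
  proof cases
    case 1
    then obtain d where d: "y \<in> V" "d \<le> 2 * h" "(VarNode x, VarNode y) \<in> G ^^ d" using Suc.IH by blast
    then have "d \<le> 2 * Suc h" by simp
    then show ?thesis using d by blast
  next
    case 2
    from Suc.IH[OF 2(4)] obtain d where d: "z \<in> V" "d \<le> 2 * h" "(VarNode x, VarNode z) \<in> G ^^ d" by blast
    have yV: "y \<in> V" using 2 M by blast
    have "0 < count M (S, b)" using 2 by simp
    then have "(VarNode z, ClauseNode (S, b) 0) \<in> G" "(ClauseNode (S, b) 0, VarNode y) \<in> G"
      unfolding edge_iff using 2 d yV by auto
    then have "(VarNode x, VarNode y) \<in> G ^^ Suc (Suc d)" using d(3) by auto
    then show ?thesis using d yV by (intro conjI exI[of _ "Suc (Suc d)"]) auto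
  qed
qed

lemma walk_var: "(\<exists>d\<le>2 * h. (VarNode x, VarNode y) \<in> G ^^ d) \<longleftrightarrow> y \<in> hball supports h {x}"
proof
  assume "\<exists>d\<le>2 * h. (VarNode x, VarNode y) \<in> G ^^ d"
  then obtain d where d: "d \<le> 2 * h" "y \<in> hball supports (d div 2) {x}" using walk_sound by fastforce
  then have "d div 2 \<le> h" by linarith
  then show "y \<in> hball supports h {x}" using d(2) hball_radius_mono[of "d div 2" h supports "{x}"] by auto
qed (use walk_complete_var in blast)

lemma walk_clause:
  "(\<exists>d\<le>2 * h. (VarNode x, ClauseNode c i) \<in> G ^^ d) \<longleftrightarrow>
     i < count M c \<and> h > 0 \<and> fst c \<inter> hball supports (h - 1) {x} \<noteq> {}"
proof
  assume "\<exists>d\<le>2 * h. (VarNode x, ClauseNode c i) \<in> G ^^ d"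
  then obtain d where d: "d \<le> 2 * h" "odd d" "i < count M c" "fst c \<inter> hball supports (d div 2) {x} \<noteq> {}"
    using walk_sound by fastforce
  then have "h > 0" "d div 2 \<le> h - 1" by (auto elim!: oddE)
  then show "i < count M c \<and> h > 0 \<and> fst c \<inter> hball supports (h - 1) {x} \<noteq> {}"
    using d hball_radius_mono[of "d div 2" "h - 1" supports "{x}"] by auto
next
  assume *: "i < count M c \<and> h > 0 \<and> fst c \<inter> hball supports (h - 1) {x} \<noteq> {}"
  then obtain y where y: "y \<in> fst c" "y \<in> hball supports (h - 1) {x}" by auto
  then obtain d where d: "y \<in> V" "d \<le> 2 * (h - 1)" "(VarNode x, VarNode y) \<in> G ^^ d"
    using walk_complete_var by blast
  then have "(VarNode y, ClauseNode c i) \<in> G" unfolding edge_iff using * y by blast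
  then have "(VarNode x, ClauseNode c i) \<in> G ^^ Suc d" using d by auto
  moreover have "Suc d \<le> 2 * h" using d * by linarith
  ultimately show "\<exists>d\<le>2 * h. (VarNode x, ClauseNode c i) \<in> G ^^ d" by blast
qed

text \<open>A clause at distance at most 2 h is at odd distance, hence at most 2 h - 1, and so meets
  the ball of radius h - 1; for h = 0 no clause is visible. Consequently every visible clause lies
  entirely in the ball of radius h.\<close>

lemma nbhd_eq:
  "nbhd \<lparr>vars = V, clauses = M\<rparr> x (2 * h) =
     (\<lparr>vars = hball supports h {x},
       clauses = image_mset (\<lambda>(S, b). (S \<inter> hball supports h {x}, b))
         (filter_mset (\<lambda>(S, b). h > 0 \<and> S \<inter> hball supports (h - 1) {x} \<noteq> {}) M)\<rparr>, x)"
proof -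
  let ?N = "{v \<in> nodes \<lparr>vars = V, clauses = M\<rparr>. graph_dist G (VarNode x) v \<le> enat (2 * h)}"
  have 1: "{y. VarNode y \<in> ?N} = hball supports h {x}"
    using walk_complete_var walk_var by (auto simp: nodes_def graph_dist_le)
  have 2: "{(c, i). ClauseNode c i \<in> ?N} =
      {(c, i). i < count M c \<and> (\<lambda>(S, b). h > 0 \<and> S \<inter> hball supports (h - 1) {x} \<noteq> {}) c}"
    by (auto simp: nodes_def graph_dist_le walk_clause case_prod_unfold)
  have 3: "(\<lambda>((S, b), i). (S \<inter> B, b)) = (\<lambda>(c, i). (\<lambda>(S, b). (S \<inter> B, b)) c)" for B :: "nat set"
    by auto
  show ?thesis
    unfolding nbhd_def induced_def Let_def 1 2 3 image_mset_occurrences ..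
qed

end

text \<open>Closed form of repeated \<open>decimate\<close>, where T holds the variables removed so
  far; the order of their removal leaves no trace.\<close>

definition residual :: "clause list \<Rightarrow> nat set \<Rightarrow> (nat \<Rightarrow> bit) \<Rightarrow> clause list" where
  "residual cs T \<sigma> = filter (\<lambda>(S, b). S \<noteq> {}) (map (\<lambda>(S, b). (S - T, b + (\<Sum>y\<in>S \<inter> T. \<sigma> y))) cs)"

definition local_value :: "(rooted_xorsat \<Rightarrow> real) \<Rightarrow> nat \<Rightarrow> nat set \<Rightarrow> clause list \<Rightarrow> nat set \<Rightarrow> (nat \<Rightarrow> bit) \<Rightarrow> nat \<Rightarrow> real" where
  "local_value \<tau> R V cs T \<sigma> x = \<tau> (nbhd \<lparr>vars = V - T, clauses = mset (residual cs T \<sigma>)\<rparr> x R)"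

lemma residual_empty: "\<forall>(S, b)\<in>set cs. S \<noteq> {} \<Longrightarrow> residual cs {} \<sigma> = cs"
  unfolding residual_def by (induction cs) auto

lemma decimate_residual:
  assumes "x \<notin> T" "\<forall>(S, b)\<in>set cs. finite S"
  shows "decimate \<lparr>vars = V - T, clauses = mset (residual cs T \<sigma>)\<rparr> x a =
     \<lparr>vars = V - insert x T, clauses = mset (residual cs (insert x T) (\<sigma>(x := a)))\<rparr>"
proof -
  have "filter_mset (\<lambda>(S, b). S \<noteq> {}) (image_mset (\<lambda>(S, b). if x \<in> S then (S - {x}, b + a) else (S, b)) (mset (residual cs T \<sigma>)))
      = mset (residual cs (insert x T) (\<sigma>(x := a)))"
    using assms(2)
  proof (induction cs)
    case (Cons c cs)
    obtain S b where c: "c = (S, b)" by (cases c)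
    have fin: "finite S" using Cons.prems c by simp
    have eq: "(\<Sum>y\<in>S \<inter> T. (\<sigma>(x := a)) y) = (\<Sum>y\<in>S \<inter> T. \<sigma> y)"
      using assms(1) by (intro sum.cong) auto
    have "(\<Sum>y\<in>S \<inter> insert x T. (\<sigma>(x := a)) y) = (\<Sum>y\<in>S \<inter> T. \<sigma> y) + (if x \<in> S then a else 0)"
    proof (cases "x \<in> S")
      case True
      then have "S \<inter> insert x T = insert x (S \<inter> T)" by auto
      moreover have "(\<Sum>y\<in>insert x (S \<inter> T). (\<sigma>(x := a)) y) = (\<sigma>(x := a)) x + (\<Sum>y\<in>S \<inter> T. (\<sigma>(x := a)) y)"
        using fin assms(1) by (intro sum.insert) auto
      ultimately show ?thesis using True unfolding eq by (simp only: fun_upd_same add.commute if_True)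
    next
      case False
      then have "S \<inter> insert x T = S \<inter> T" by auto
      then show ?thesis using False eq by simp
    qed
    moreover have "S - T - {x} = S - insert x T" by auto
    moreover have "x \<in> S - T \<longleftrightarrow> x \<in> S" using assms(1) by auto
    moreover have "x \<notin> S \<Longrightarrow> S - insert x T = S - T" by auto
    ultimately show ?case
      using Cons by (cases "x \<in> S"; cases "S - T = {}"; cases "S - insert x T = {}")
        (auto simp: residual_def c add.assoc simp del: fun_upd_apply)
  qed (simp add: residual_def)
  then show ?thesis by (auto simp: decimate_def)
qed

lemma hball_refine:
  assumes "\<And>e. e \<in> E \<Longrightarrow> \<exists>e'\<in>E'. e \<subseteq> e'"
  shows "hball E h A \<subseteq> hball E' h A"
proof (induction h)
  case (Suc h)
  show ?case
  proof
    fix y assume "y \<in> hball E (Suc h) A"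
    then consider "y \<in> hball E h A" | e z where "e \<in> E" "y \<in> e" "z \<in> e" "z \<in> hball E h A" by auto
    then show "y \<in> hball E' (Suc h) A"
    proof cases
      case (2 e z)
      then obtain e' where "e' \<in> E'" "e \<subseteq> e'" using assms by blast
      then show ?thesis using 2 Suc.IH by auto
    qed (use Suc.IH in auto)
  qed
qed simp

text \<open>The assignment enters only through the right-hand sides of visible clauses. Such a
  clause meets the residual ball of radius h - 1, and removing variables never shortens distances;
  so the whole original clause, including its assigned variables, lies in the original ball of
  radius h. Dependence is thus described by a hypergraph that does not change during the
  run.\<close>

lemma local_value_cong:
  assumes x: "x \<in> V - T" and cs: "\<forall>(S, b)\<in>set cs. S \<subseteq> V"
    and agree: "\<And>y. y \<in> T \<Longrightarrow> y \<in> hball (fst ` set cs) h {x} \<Longrightarrow> \<sigma> y = \<sigma>' y"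
  shows "local_value \<tau> (2 * h) V cs T \<sigma> x = local_value \<tau> (2 * h) V cs T \<sigma>' x"
proof -
  let ?E = "fst ` set cs"
  define E where "E = (\<lambda>S. S - T) ` ?E - {{}}"
  define B where "B = hball E h {x}"
  define Q where "Q S \<longleftrightarrow> h > 0 \<and> S \<inter> hball E (h - 1) {x} \<noteq> {}" for S
  have supp: "fst ` set_mset (mset (residual cs T \<rho>)) = E" for \<rho>
    unfolding residual_def E_def by (force simp: image_iff)
  have sub: "S \<subseteq> V - T" if "(S, b) \<in># mset (residual cs T \<rho>)" for S b \<rho>
    using that cs unfolding residual_def by auto
  have res: "image_mset (\<lambda>(S, b). (S \<inter> B, b)) (filter_mset (\<lambda>(S, b). Q S) (mset (residual cs T \<rho>)))
      = image_mset (\<lambda>(S, b). ((S - T) \<inter> B, b + (\<Sum>y\<in>S \<inter> T. \<rho> y))) (filter_mset (\<lambda>(S, b). Q (S - T)) (mset cs))" for \<rho>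
  proof (induction cs)
    case (Cons c cs)
    then show ?case by (cases c) (auto simp: residual_def Q_def)
  qed (simp add: residual_def)
  have "image_mset (\<lambda>(S, b). ((S - T) \<inter> B, b + (\<Sum>y\<in>S \<inter> T. \<sigma> y))) (filter_mset (\<lambda>(S, b). Q (S - T)) (mset cs))
      = image_mset (\<lambda>(S, b). ((S - T) \<inter> B, b + (\<Sum>y\<in>S \<inter> T. \<sigma>' y))) (filter_mset (\<lambda>(S, b). Q (S - T)) (mset cs))"
  proof (intro image_mset_cong, clarify)
    fix S b assume "(S, b) \<in># filter_mset (\<lambda>(S, b). Q (S - T)) (mset cs)"
    then have S: "(S, b) \<in> set cs" and "Q (S - T)" by auto
    then obtain z where z: "z \<in> S" "z \<in> hball E (h - 1) {x}" and h: "h > 0" by (auto simp: Q_def)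
    have "hball E (h - 1) {x} \<subseteq> hball ?E (h - 1) {x}"
      by (intro hball_refine) (auto simp: E_def)
    with z S have "S \<subseteq> hball ?E (Suc (h - 1)) {x}" by force
    then have "S \<subseteq> hball ?E h {x}" using h by simp
    then have "(\<Sum>y\<in>S \<inter> T. \<sigma> y) = (\<Sum>y\<in>S \<inter> T. \<sigma>' y)" using agree by (intro sum.cong) auto
    then show "(S - T) \<inter> B = (S - T) \<inter> B \<and> b + (\<Sum>y\<in>S \<inter> T. \<sigma> y) = b + (\<Sum>y\<in>S \<inter> T. \<sigma>' y)" by simp
  qed
  then show ?thesis
    unfolding local_value_def
    by (subst (1 2) nbhd_eq[OF x sub]) (assumption+, simp only: supp B_def[symmetric] Q_def[symmetric] res)
qed

section \<open>Decimation driven by a fixed order and independent coins\<close>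

abbreviation bit_of :: "bool \<Rightarrow> bit" where "bit_of b \<equiv> (if b then 1 else 0)"

type_synonym value_fun = "nat set \<Rightarrow> (nat \<Rightarrow> bit) \<Rightarrow> nat \<Rightarrow> real"

primrec run_random :: "value_fun \<Rightarrow> nat list \<Rightarrow> nat set \<Rightarrow> (nat \<Rightarrow> bit) \<Rightarrow> nat \<Rightarrow> ((nat \<Rightarrow> bit) \<times> nat) pmf" where
  "run_random val [] T \<sigma> f = return_pmf (\<sigma>, f)"
| "run_random val (x # xs) T \<sigma> f = bernoulli_pmf (val T \<sigma> x) \<bind> (\<lambda>b.
     run_random val xs (insert x T) (\<sigma>(x := bit_of b)) (if val T \<sigma> x = 1 / 2 then Suc f else f))"

primrec run_coins :: "value_fun \<Rightarrow> (nat \<times> real \<Rightarrow> bool) \<Rightarrow> nat list \<Rightarrow> nat set \<Rightarrow> (nat \<Rightarrow> bit) \<Rightarrow> nat \<Rightarrow> (nat \<Rightarrow> bit) \<times> nat" where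
  "run_coins val u [] T \<sigma> f = (\<sigma>, f)"
| "run_coins val u (x # xs) T \<sigma> f =
     run_coins val u xs (insert x T) (\<sigma>(x := bit_of (u (x, val T \<sigma> x)))) (if val T \<sigma> x = 1 / 2 then Suc f else f)"

text \<open>
  There is one coin for each variable and each value that the local rule may take there, so that
  the coins do not depend on the run.
\<close>

definition coins :: "nat set \<Rightarrow> real set \<Rightarrow> (nat \<times> real \<Rightarrow> bool) pmf" where
  "coins A P = Pi_pmf (A \<times> P) False (\<lambda>(x, p). bernoulli_pmf p)"

lemma run_coins_cong:
  "(\<And>y p. y \<in> set xs \<Longrightarrow> u (y, p) = u' (y, p)) \<Longrightarrow> run_coins val u xs T \<sigma> f = run_coins val u' xs T \<sigma> f"
  by (induction xs arbitrary: T \<sigma> f) auto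

text \<open>The order lists each variable once, so every coin is read at most once, and the coins of
  the variable just processed are independent of those read later. Coins that are never read
  integrate out.\<close>

lemma run_random_eq_coins:
  assumes "finite A" "finite P" "distinct xs" "set xs \<subseteq> A"
    and "\<And>T \<sigma> x. T \<subseteq> V \<Longrightarrow> \<sigma> \<in> V \<rightarrow>\<^sub>E UNIV \<Longrightarrow> x \<in> V \<Longrightarrow> val T \<sigma> x \<in> P"
    and "A \<subseteq> V" "T \<subseteq> V" "\<sigma> \<in> V \<rightarrow>\<^sub>E UNIV"
  shows "run_random val xs T \<sigma> f = map_pmf (\<lambda>u. run_coins val u xs T \<sigma> f) (coins A P)"
  using assms
proof (induction xs arbitrary: A T \<sigma> f)
  case (Cons x xs)
  let ?p = "val T \<sigma> x" and ?f = "if val T \<sigma> x = 1 / 2 then Suc f else f"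
  let ?A = "{x} \<times> P" and ?B = "(A - {x}) \<times> P"
  let ?q = "\<lambda>(x, p). bernoulli_pmf p"
  let ?go = "\<lambda>u b. run_coins val u xs (insert x T) (\<sigma>(x := bit_of b)) ?f"
  have xV: "x \<in> A" "x \<in> V" using Cons.prems by auto
  then have p: "?p \<in> P" using Cons.prems by auto
  have "?A \<union> ?B = A \<times> P" using xV by auto
  then have "coins A P = Pi_pmf (?A \<union> ?B) False ?q" by (simp add: coins_def)
  also have "\<dots> = map_pmf (\<lambda>(f, g) z. if z \<in> ?A then f z else g z) (pair_pmf (Pi_pmf ?A False ?q) (coins (A - {x}) P))"
    unfolding coins_def using Cons.prems by (intro Pi_pmf_union) auto
  finally have "map_pmf (\<lambda>u. run_coins val u (x # xs) T \<sigma> f) (coins A P) =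
     map_pmf (\<lambda>(f, g). run_coins val (\<lambda>z. if z \<in> ?A then f z else g z) (x # xs) T \<sigma> f')
       (pair_pmf (Pi_pmf ?A False ?q) (coins (A - {x}) P))" if "f' = f" for f'
    using that by (simp add: pmf.map_comp comp_def case_prod_unfold)
  from this[OF refl] have "map_pmf (\<lambda>u. run_coins val u (x # xs) T \<sigma> f) (coins A P) =
     map_pmf (\<lambda>(v, g). run_coins val (\<lambda>z. if z \<in> ?A then v z else g z) (x # xs) T \<sigma> f)
       (pair_pmf (Pi_pmf ?A False ?q) (coins (A - {x}) P))" .
  also have "(\<lambda>(v, g). run_coins val (\<lambda>z. if z \<in> ?A then v z else g z) (x # xs) T \<sigma> f) = (\<lambda>(v, g). ?go g (v (x, ?p)))"
  proof (intro ext, clarify)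
    fix v g :: "nat \<times> real \<Rightarrow> bool"
    have "run_coins val (\<lambda>z. if z \<in> ?A then v z else g z) (x # xs) T \<sigma> f =
        run_coins val (\<lambda>z. if z \<in> ?A then v z else g z) xs (insert x T) (\<sigma>(x := bit_of (v (x, ?p)))) ?f"
      using p by simp
    also have "\<dots> = ?go g (v (x, ?p))" using Cons.prems by (intro run_coins_cong) auto
    finally show "run_coins val (\<lambda>z. if z \<in> ?A then v z else g z) (x # xs) T \<sigma> f = ?go g (v (x, ?p))" .
  qed
  also have "map_pmf (\<lambda>(v, g). ?go g (v (x, ?p))) (pair_pmf (Pi_pmf ?A False ?q) (coins (A - {x}) P)) =
      map_pmf (\<lambda>v. v (x, ?p)) (Pi_pmf ?A False ?q) \<bind> (\<lambda>b. map_pmf (\<lambda>g. ?go g b) (coins (A - {x}) P))"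
    by (simp add: pair_pmf_def map_pmf_def bind_assoc_pmf bind_return_pmf)
  also have "map_pmf (\<lambda>v. v (x, ?p)) (Pi_pmf ?A False ?q) = bernoulli_pmf ?p"
    using Cons.prems p by (subst Pi_pmf_component) auto
  also have "bernoulli_pmf ?p \<bind> (\<lambda>b. map_pmf (\<lambda>g. ?go g b) (coins (A - {x}) P)) = run_random val (x # xs) T \<sigma> f"
    unfolding run_random.simps
  proof (intro bind_pmf_cong refl)
    fix b
    have "\<sigma>(x := bit_of b) \<in> V \<rightarrow>\<^sub>E UNIV" using Cons.prems(8) xV(2) by (auto simp: PiE_def extensional_def)
    then show "map_pmf (\<lambda>g. ?go g b) (coins (A - {x}) P) = run_random val xs (insert x T) (\<sigma>(x := bit_of b)) ?f"
      using Cons.prems xV by (intro Cons.IH[symmetric]) auto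
  qed
  finally show ?case by (rule sym)
qed simp

text \<open>\<open>dec_run\<close> appends its steps at the end, while \<open>run_random\<close>
  consumes the order from the front. Iterating from an arbitrary state allows the first step to be
  split off.\<close>

definition dec_iter :: "(rooted_xorsat \<Rightarrow> real) \<Rightarrow> nat \<Rightarrow> nat \<Rightarrow> dec_state \<Rightarrow> dec_state pmf" where
  "dec_iter \<tau> R t s = ((\<lambda>p. p \<bind> dec_step \<tau> R) ^^ t) (return_pmf s)"

lemma dec_run_eq_iter: "dec_run \<tau> R \<Phi> t = dec_iter \<tau> R t (\<Phi>, (\<lambda>_. undefined), 0)"
  unfolding dec_iter_def by (induction t) auto

lemma dec_iter_Suc: "dec_iter \<tau> R (Suc t) s = dec_step \<tau> R s \<bind> dec_iter \<tau> R t"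
proof (induction t)
  case 0
  show ?case by (simp add: dec_iter_def bind_return_pmf bind_return_pmf')
next
  case (Suc t)
  have step: "dec_iter \<tau> R (Suc t) s' = dec_iter \<tau> R t s' \<bind> dec_step \<tau> R" for t s'
    by (simp add: dec_iter_def)
  show ?case unfolding step[of "Suc t"] Suc.IH bind_assoc_pmf by (simp add: step)
qed

text \<open>Uniform choices among the unassigned variables amount to a uniform order drawn in
  advance, because these choices do not depend on the values assigned; the coin of a step therefore
  commutes with the rest of the order.\<close>

lemma dec_iter_eq_run_random:
  assumes "finite V" "T \<subseteq> V" "\<forall>(S, b)\<in>set cs. finite S"
  shows "map_pmf snd (dec_iter \<tau> R (card (V - T)) (\<lparr>vars = V - T, clauses = mset (residual cs T \<sigma>)\<rparr>, \<sigma>, f)) =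
     rand_perm (V - T) \<bind> (\<lambda>\<pi>. run_random (local_value \<tau> R V cs) \<pi> T \<sigma> f)"
  using assms(2)
proof (induction "card (V - T)" arbitrary: T \<sigma> f)
  case 0
  have e: "V - T = {}" using 0 assms(1) by (metis card_0_eq finite_Diff)
  show ?case unfolding e by (simp add: dec_iter_def pmf_of_set_singleton bind_return_pmf)
next
  case (Suc t)
  let ?\<Phi> = "\<lparr>vars = V - T, clauses = mset (residual cs T \<sigma>)\<rparr>"
  let ?val = "local_value \<tau> R V cs"
  let ?f = "\<lambda>x. if ?val T \<sigma> x = 1 / 2 then Suc f else f"
  have ne: "V - T \<noteq> {}" "finite (V - T)" using Suc.hyps(2) assms(1) by (metis card.empty nat.distinct(1), simp)
  have step: "dec_step \<tau> R (?\<Phi>, \<sigma>, f) = pmf_of_set (V - T) \<bind> (\<lambda>x. bernoulli_pmf (?val T \<sigma> x) \<bind> (\<lambda>b.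
      return_pmf (decimate ?\<Phi> x (bit_of b), \<sigma>(x := bit_of b), ?f x)))"
    by (simp add: dec_step_def Let_def local_value_def)
  have "map_pmf snd (dec_iter \<tau> R (card (V - T)) (?\<Phi>, \<sigma>, f)) =
     pmf_of_set (V - T) \<bind> (\<lambda>x. bernoulli_pmf (?val T \<sigma> x) \<bind> (\<lambda>b.
       map_pmf snd (dec_iter \<tau> R t (decimate ?\<Phi> x (bit_of b), \<sigma>(x := bit_of b), ?f x))))"
    unfolding Suc.hyps(2)[symmetric] dec_iter_Suc step
    by (simp add: map_bind_pmf bind_assoc_pmf bind_return_pmf)
  also have "\<dots> = pmf_of_set (V - T) \<bind> (\<lambda>x. bernoulli_pmf (?val T \<sigma> x) \<bind> (\<lambda>b.
       rand_perm (V - T - {x}) \<bind> (\<lambda>\<pi>. run_random ?val \<pi> (insert x T) (\<sigma>(x := bit_of b)) (?f x))))"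
  proof (intro bind_pmf_cong refl)
    fix x b assume "x \<in> set_pmf (pmf_of_set (V - T))"
    then have x: "x \<in> V - T" using ne by simp
    then have "card (V - insert x T) = t" using Suc.hyps(2) assms(1)
      by (metis Diff_insert card_Diff_singleton diff_Suc_1)
    moreover have "V - insert x T = V - T - {x}" by auto
    ultimately show "map_pmf snd (dec_iter \<tau> R t (decimate ?\<Phi> x (bit_of b), \<sigma>(x := bit_of b), ?f x)) =
       rand_perm (V - T - {x}) \<bind> (\<lambda>\<pi>. run_random ?val \<pi> (insert x T) (\<sigma>(x := bit_of b)) (?f x))"
      using Suc.hyps(1)[of "insert x T" "\<sigma>(x := bit_of b)" "?f x"] x Suc.prems
        decimate_residual[of x T cs V \<sigma> "bit_of b"] assms(3) by auto
  qed
  also have "\<dots> = pmf_of_set (V - T) \<bind> (\<lambda>x. rand_perm (V - T - {x}) \<bind> (\<lambda>\<pi>. run_random ?val (x # \<pi>) T \<sigma> f))"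
    unfolding run_random.simps by (intro bind_pmf_cong refl) (subst bind_commute_pmf, rule refl)
  also have "\<dots> = rand_perm (V - T) \<bind> (\<lambda>\<pi>. run_random ?val \<pi> T \<sigma> f)"
    unfolding random_permutation_of_set[OF ne(2,1)]
    by (simp add: bind_assoc_pmf bind_return_pmf bind_map_pmf map_pmf_def del: run_random.simps)
  finally show ?case .
qed

definition bef :: "'a list \<Rightarrow> 'a \<Rightarrow> 'a set" where
  "bef \<pi> x = {y \<in> set \<pi>. pos \<pi> y < pos \<pi> x}"

lemma bef_Cons_same: "bef (x # xs) x = {}"
  by (auto simp: bef_def pos_def)

lemma bef_Cons: "y \<noteq> x \<Longrightarrow> x \<notin> set xs \<Longrightarrow> bef (x # xs) y = insert x (bef xs y)"
  by (auto simp: bef_def pos_def)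

lemma run_coins_outside: "y \<notin> set xs \<Longrightarrow> fst (run_coins val u xs T \<sigma> f) y = \<sigma> y"
  by (induction xs arbitrary: T \<sigma> f) auto

text \<open>No variable is assigned twice, so the final assignment agrees with each intermediate one
  on the variables already processed. The run becomes a system of equations for the final assignment
  alone, which can be studied by induction along the order.\<close>

lemma run_coins_spec:
  fixes u xs
  assumes val: "\<And>T \<sigma> \<sigma>' x. (\<And>y. y \<in> T \<Longrightarrow> \<sigma> y = \<sigma>' y) \<Longrightarrow> x \<in> V - T \<Longrightarrow> val T \<sigma> x = val T \<sigma>' x"
    and "distinct xs" "set xs \<subseteq> V" "set xs \<inter> T = {}"
  shows "(\<forall>x\<in>set xs. fst (run_coins val u xs T \<sigma> f) x =
        bit_of (u (x, val (T \<union> bef xs x) (fst (run_coins val u xs T \<sigma> f)) x))) \<and>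
     snd (run_coins val u xs T \<sigma> f) =
        f + card {x \<in> set xs. val (T \<union> bef xs x) (fst (run_coins val u xs T \<sigma> f)) x = 1 / 2}"
  using assms(2-4)
proof (induction xs arbitrary: T \<sigma> f)
  case (Cons x xs)
  let ?\<sigma> = "\<sigma>(x := bit_of (u (x, val T \<sigma> x)))" and ?f = "if val T \<sigma> x = 1 / 2 then Suc f else f"
  define \<rho> where "\<rho> = fst (run_coins val u xs (insert x T) ?\<sigma> ?f)"
  have eq: "fst (run_coins val u (x # xs) T \<sigma> f) = \<rho>" by (simp add: \<rho>_def)
  have \<rho>T: "\<rho> y = \<sigma> y" if "y \<in> T" for y
    unfolding \<rho>_def using that Cons.prems by (subst run_coins_outside) auto
  have vx: "val T \<rho> x = val T \<sigma> x" using Cons.prems \<rho>T by (intro val) auto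
  have \<rho>x: "\<rho> x = bit_of (u (x, val T \<sigma> x))"
    unfolding \<rho>_def using Cons.prems by (subst run_coins_outside) auto
  have IH: "\<forall>y\<in>set xs. \<rho> y = bit_of (u (y, val (insert x T \<union> bef xs y) \<rho> y))"
     "snd (run_coins val u xs (insert x T) ?\<sigma> ?f) = ?f + card {y \<in> set xs. val (insert x T \<union> bef xs y) \<rho> y = 1 / 2}"
    using Cons.IH[of "insert x T" ?\<sigma> ?f, folded \<rho>_def] Cons.prems
    by (simp_all only: distinct.simps list.set) blast+
  have b: "T \<union> bef (x # xs) y = insert x T \<union> bef xs y" if "y \<in> set xs" for y
    using that Cons.prems by (subst bef_Cons) auto
  have "{y \<in> set (x # xs). val (T \<union> bef (x # xs) y) \<rho> y = 1 / 2} =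
      {y. y = x \<and> val T \<sigma> x = 1 / 2} \<union> {y \<in> set xs. val (insert x T \<union> bef xs y) \<rho> y = 1 / 2}"
    using b vx by (auto simp: bef_Cons_same)
  also have "card \<dots> = card {y. y = x \<and> val T \<sigma> x = 1 / 2} + card {y \<in> set xs. val (insert x T \<union> bef xs y) \<rho> y = 1 / 2}"
    using Cons.prems by (intro card_Un_disjoint) auto
  finally have "?f + card {y \<in> set xs. val (insert x T \<union> bef xs y) \<rho> y = 1 / 2} =
      f + card {y \<in> set (x # xs). val (T \<union> bef (x # xs) y) \<rho> y = 1 / 2}"
    by simp
  then have 1: "snd (run_coins val u (x # xs) T \<sigma> f) = f + card {y \<in> set (x # xs). val (T \<union> bef (x # xs) y) \<rho> y = 1 / 2}"
    unfolding run_coins.simps IH(2) .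
  have 2: "\<rho> y = bit_of (u (y, val (T \<union> bef (x # xs) y) \<rho> y))" if "y \<in> set (x # xs)" for y
  proof (cases "y = x")
    case True
    then show ?thesis using \<rho>x vx by (simp add: bef_Cons_same)
  next
    case False
    then have y: "y \<in> set xs" using that by simp
    show ?thesis unfolding b[OF y] using IH(1) y by blast
  qed
  show ?case unfolding eq using 1 2 by blast
qed simp

section \<open>Influence of the coins\<close>

lemma coins_independent:
  assumes "finite A" "finite P"
    and f: "\<And>u u'. (\<And>y p. y \<in> B \<Longrightarrow> u (y, p) = u' (y, p)) \<Longrightarrow> f u = (f u' :: real)"
    and g: "\<And>u u'. (\<And>y p. y \<notin> B \<Longrightarrow> u (y, p) = u' (y, p)) \<Longrightarrow> g u = (g u' :: real)"
    and bounded: "\<And>u. \<bar>f u\<bar> \<le> 1" "\<And>u. \<bar>g u\<bar> \<le> 1"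
  shows "EV (coins A P) (\<lambda>u. f u * g u) = EV (coins A P) f * EV (coins A P) g"
proof -
  let ?q = "\<lambda>(x, p). bernoulli_pmf p"
  let ?X = "(A \<inter> B) \<times> P" and ?Y = "(A - B) \<times> P"
  let ?p = "Pi_pmf ?X False ?q" and ?r = "Pi_pmf ?Y False ?q"
  define j where "j v w = (\<lambda>z. if z \<in> ?X then v z else w z)" for v w :: "nat \<times> real \<Rightarrow> bool"
  have fin: "finite (set_pmf ?p)" "finite (set_pmf ?r)"
    using assms(1,2) by (auto intro!: finite_subset[OF set_Pi_pmf_subset'] finite_PiE_dflt)
  have "?X \<union> ?Y = A \<times> P" by auto
  then have "coins A P = Pi_pmf (?X \<union> ?Y) False ?q" by (simp add: coins_def)
  also have "\<dots> = map_pmf (\<lambda>(v, w). j v w) (pair_pmf ?p ?r)"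
    unfolding j_def using assms(1,2) by (intro Pi_pmf_union) auto
  finally have c: "coins A P = map_pmf (\<lambda>(v, w). j v w) (pair_pmf ?p ?r)" .
  \<comment> \<open>Outside its index set each part takes the default \<open>False\<close>. This
    makes \<open>j v w\<close> agree with \<open>v\<close> on all coins of B, also on those outside
    \<open>A \<times> P\<close>, where \<open>j\<close> reads \<open>w\<close>.\<close>
  have out: "v (y, p) = False" if "v \<in> set_pmf ?p" "y \<notin> A \<inter> B" for v y p
    using that set_Pi_pmf_subset[of ?X False ?q] assms(1,2) by auto
  have out': "w (y, p) = False" if "w \<in> set_pmf ?r" "y \<notin> A - B" for w y p
    using that set_Pi_pmf_subset[of ?Y False ?q] assms(1,2) by auto
  have outP: "v (y, p) = False" if "v \<in> set_pmf ?p" "p \<notin> P" for v y p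
    using that set_Pi_pmf_subset[of ?X False ?q] assms(1,2) by auto
  have fj: "f (j v w) = f v" if "v \<in> set_pmf ?p" "w \<in> set_pmf ?r" for v w
  proof (rule f)
    fix y p assume "y \<in> B"
    then show "j v w (y, p) = v (y, p)" unfolding j_def using out[OF that(1), of y p] outP[OF that(1), of p y] out'[OF that(2), of y p] by auto
  qed
  have gj: "g (j v w) = g w" if "v \<in> set_pmf ?p" "w \<in> set_pmf ?r" for v w
    by (rule g) (auto simp: j_def)
  have pair: "EV (pair_pmf ?p ?r) k = EV ?r (\<lambda>w. EV ?p (\<lambda>v. k (v, w)))" for k :: "_ \<Rightarrow> real"
    by (rule EV_pair[OF fin])
  have 1: "EV (coins A P) (\<lambda>u. f u * g u) = EV ?r (\<lambda>w. EV ?p (\<lambda>v. f v * g w))"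
    unfolding c integral_map_pmf pair using fj gj by (intro EV_cong) (auto intro!: EV_cong)
  have 2: "EV (coins A P) f = EV ?p f"
    unfolding c integral_map_pmf pair using fj
    by (subst EV_cong[where g = "\<lambda>_. EV ?p f"]) (auto intro!: EV_cong)
  have 3: "EV (coins A P) g = EV ?r g"
    unfolding c integral_map_pmf pair using gj
    by (intro EV_cong) (subst EV_cong[where g = "\<lambda>_. g _"], auto)
  show ?thesis unfolding 1 2 3 by simp
qed

lemma finite_set_coins [simp]: "finite A \<Longrightarrow> finite P \<Longrightarrow> finite (set_pmf (coins A P))"
  unfolding coins_def by (auto intro!: finite_subset[OF set_Pi_pmf_subset'] finite_PiE_dflt)

text \<open>Only a fair coin keeps its law when negated; this is where the value 1 / 2 of free steps
  enters.\<close>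

lemma coins_flip:
  assumes "finite A" "finite P" "x \<in> A" "1 / 2 \<in> P"
  shows "map_pmf (\<lambda>u. u((x, 1 / 2) := \<not> u (x, 1 / 2))) (coins A P) = coins A P"
proof -
  let ?q = "\<lambda>(x, p). bernoulli_pmf p :: bool pmf"
  let ?z = "(x, 1 / 2 :: real)"
  let ?B = "A \<times> P - {?z}"
  have "A \<times> P = insert ?z ?B" using assms by auto
  then have c: "coins A P = map_pmf (\<lambda>(b, u). u(?z := b)) (pair_pmf (bernoulli_pmf (1 / 2)) (Pi_pmf ?B False ?q))"
    unfolding coins_def using assms by (subst \<open>A \<times> P = insert ?z ?B\<close>, subst Pi_pmf_insert) auto
  have Not: "map_pmf Not (bernoulli_pmf (1 / 2)) = bernoulli_pmf (1 / 2)"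
  proof (rule pmf_eqI)
    fix b
    have "pmf (map_pmf Not (bernoulli_pmf (1 / 2))) (\<not> \<not> b) = pmf (bernoulli_pmf (1 / 2)) (\<not> b)"
      by (rule pmf_map_inj') (auto simp: inj_def)
    then show "pmf (map_pmf Not (bernoulli_pmf (1 / 2))) b = pmf (bernoulli_pmf (1 / 2)) b"
      by (cases b) auto
  qed
  have "map_pmf (\<lambda>u. u(?z := \<not> u ?z)) (coins A P) =
      map_pmf (\<lambda>(b, u). u(?z := b)) (pair_pmf (map_pmf Not (bernoulli_pmf (1 / 2))) (Pi_pmf ?B False ?q))"
    unfolding c by (simp add: pmf.map_comp comp_def case_prod_unfold pair_map_pmf1 map_pmf_def
        pair_pmf_def bind_assoc_pmf bind_return_pmf)
  then show ?thesis unfolding Not c .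
qed

lemma finite_UNIV_bit: "finite (UNIV :: bit set)"
proof -
  have "(UNIV :: bit set) = {0, 1}" using bit_not_zero_iff by blast
  then show ?thesis by (metis finite.emptyI finite_insert)
qed

definition infl :: "nat set set \<Rightarrow> nat \<Rightarrow> nat list \<Rightarrow> (nat \<times> nat) set" where
  "infl E h \<pi> = {(y, x). x \<in> set \<pi> \<and> y \<in> set \<pi> \<and> pos \<pi> y < pos \<pi> x \<and> y \<in> hball E h {x}}"

lemma infl_pos: "(y, x) \<in> (infl E h \<pi>)\<^sup>* \<Longrightarrow> y = x \<or> pos \<pi> y < pos \<pi> x"
  by (induction rule: rtrancl_induct) (auto simp: infl_def)

lemma infl_backward_chain:
  "(y, x) \<in> infl E h \<pi> ^^ n \<Longrightarrow> \<exists>xs. length xs = n \<and> linked (\<lambda>a. hball E h {a}) (x # xs) \<and>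
     sorted_wrt (>) (map (pos \<pi>) (x # xs))"
proof (induction n arbitrary: x)
  case (Suc n)
  then obtain z where z: "(y, z) \<in> infl E h \<pi> ^^ n" "(z, x) \<in> infl E h \<pi>" by auto
  then obtain xs where xs: "length xs = n" "linked (\<lambda>a. hball E h {a}) (z # xs)"
    "sorted_wrt (>) (map (pos \<pi>) (z # xs))" using Suc.IH by blast
  then show ?case using z(2)
    by (intro exI[of _ "z # xs"]) (auto simp: infl_def)
qed simp

lemma infl_forward_chain:
  "(x, y) \<in> infl E h \<pi> ^^ n \<Longrightarrow> \<exists>xs. length xs = n \<and> linked (\<lambda>a. hball E h {a}) (x # xs) \<and>
     sorted_wrt (<) (map (pos \<pi>) (x # xs))"
proof (induction n arbitrary: x)
  case (Suc n)
  then obtain z where z: "(z, y) \<in> infl E h \<pi> ^^ n" "(x, z) \<in> infl E h \<pi>" by (meson relpow_Suc_D2)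
  then obtain xs where xs: "length xs = n" "linked (\<lambda>a. hball E h {a}) (z # xs)"
    "sorted_wrt (<) (map (pos \<pi>) (z # xs))" using Suc.IH by blast
  then show ?case using z(2)
    by (intro exI[of _ "z # xs"]) (auto simp: infl_def intro: hball_sym)
qed simp

lemma relpow_infl_hball: "(y, x) \<in> infl E h \<pi> ^^ n \<Longrightarrow> y \<in> hball E (n * h) {x}"
proof (induction n arbitrary: x)
  case (Suc n)
  then obtain z where "(y, z) \<in> infl E h \<pi> ^^ n" "(z, x) \<in> infl E h \<pi>" by auto
  then show ?case using Suc.IH hball_trans[of z E h x y "n * h"] by (auto simp: infl_def)
qed simp

text \<open>A path of influence from or to x with at least l steps would contain a long chain
  starting at x. Hence there are fewer than l steps, and each of them stays within radius h.\<close>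

lemma infl_local:
  assumes "x \<in> V" "x \<notin> long_chain V (\<lambda>a. hball E h {a}) l \<pi>"
  shows "(y, x) \<in> (infl E h \<pi>)\<^sup>* \<Longrightarrow> y \<in> hball E (l * h) {x}"
    and "(x, y) \<in> (infl E h \<pi>)\<^sup>* \<Longrightarrow> y \<in> hball E (l * h) {x}"
proof -
  have no_chain: False if "l \<le> length xs" "linked (\<lambda>a. hball E h {a}) (x # xs)" "mono_chain \<pi> (x # xs)" for xs
  proof -
    have "linked (\<lambda>a. hball E h {a}) (take (Suc l) (x # xs))"
      using that(2) append_take_drop_id[of "Suc l" "x # xs"] by (metis successively_append_iff)
    moreover have "mono_chain \<pi> (take (Suc l) (x # xs))" by (rule mono_chain_take[OF that(3)])
    ultimately have "x \<in> long_chain V (\<lambda>a. hball E h {a}) l \<pi>"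
      using assms(1) that(1) unfolding long_chain_def by (auto intro!: exI[of _ "take l xs"])
    then show False using assms(2) by simp
  qed
  { assume "(y, x) \<in> (infl E h \<pi>)\<^sup>*"
    then obtain n where n: "(y, x) \<in> infl E h \<pi> ^^ n" using rtrancl_power by blast
    then obtain xs where xs: "length xs = n" "linked (\<lambda>a. hball E h {a}) (x # xs)" "sorted_wrt (>) (map (pos \<pi>) (x # xs))"
      using infl_backward_chain by blast
    from xs(3) have "mono_chain \<pi> (x # xs)"
      unfolding mono_chain_def rev_map[symmetric] sorted_wrt_rev by blast
    then have "\<not> l \<le> n" using no_chain[OF _ xs(2)] xs(1) by blast
    then have "n * h \<le> l * h" by simp
    then show "y \<in> hball E (l * h) {x}"
      using relpow_infl_hball[OF n] hball_radius_mono[of "n * h" "l * h" E "{x}"] by blast }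
  { assume "(x, y) \<in> (infl E h \<pi>)\<^sup>*"
    then obtain n where n: "(x, y) \<in> infl E h \<pi> ^^ n" using rtrancl_power by blast
    then obtain xs where xs: "length xs = n" "linked (\<lambda>a. hball E h {a}) (x # xs)" "sorted_wrt (<) (map (pos \<pi>) (x # xs))"
      using infl_forward_chain by blast
    from xs(3) have "mono_chain \<pi> (x # xs)" unfolding mono_chain_def by blast
    then have "\<not> l \<le> n" using no_chain[OF _ xs(2)] xs(1) by blast
    then have "n * h \<le> l * h" by simp
    then show "y \<in> hball E (l * h) {x}"
      using hball_sym[OF relpow_infl_hball[OF n]] hball_radius_mono[of "n * h" "l * h" E "{x}"] by blast }
qed

text \<open>
  In this locale \<open>pv u x\<close> is the value of the rule when \<open>x\<close> is reached, \<open>J x\<close> collects the variables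
  whose coins may influence the value assigned to \<open>x\<close>, \<open>JJ y\<close> those that may influence whether a
  clause at \<open>y\<close> is violated, and \<open>Z\<close> counts the variables in violated clauses.
\<close>

locale decimation_run =
  fixes V :: "nat set" and cs :: "clause list" and \<pi> :: "nat list" and \<tau> :: "rooted_xorsat \<Rightarrow> real" and h :: nat
  assumes V: "finite V" and perm: "\<pi> \<in> permutations_of_set V"
    and cs: "\<And>S b. (S, b) \<in> set cs \<Longrightarrow> S \<subseteq> V"
begin

abbreviation "E \<equiv> fst ` set cs"
abbreviation "val \<equiv> local_value \<tau> (2 * h) V cs"

text \<open>For fixed clauses the rule takes finitely many values, so finitely many coins suffice.
  The value 1 / 2 is added by hand so that every variable has a fair coin to flip.\<close>

definition P :: "real set" where
  "P = insert (1 / 2) ((\<lambda>(T, \<sigma>, x). val T \<sigma> x) ` (Pow V \<times> (V \<rightarrow>\<^sub>E UNIV) \<times> V))"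

definition run where "run u = run_coins val u \<pi> {} (\<lambda>_. undefined) 0"
definition outp where "outp u = fst (run u)"
definition pv where "pv u x = val (bef \<pi> x) (outp u) x"
definition C where "C = coins V P"
definition J where "J x = {y. (y, x) \<in> (infl E h \<pi>)\<^sup>*}"

lemma P: "finite P" "1 / 2 \<in> P" "T \<subseteq> V \<Longrightarrow> \<sigma> \<in> V \<rightarrow>\<^sub>E UNIV \<Longrightarrow> x \<in> V \<Longrightarrow> val T \<sigma> x \<in> P"
  unfolding P_def using V finite_UNIV_bit by (auto intro!: finite_PiE image_eqI[where x = "(T, \<sigma>, x)"])

lemma set\<pi>: "set \<pi> = V" "distinct \<pi>"
  using perm by (auto simp: permutations_of_set_def)

lemma finC [simp]: "finite (set_pmf C)"
  unfolding C_def using V P by simp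

lemma run_random_C: "run_random val \<pi> {} (\<lambda>_. undefined) 0 = map_pmf run C"
  unfolding run_def[abs_def] C_def using V P set\<pi> by (intro run_random_eq_coins[where V = V]) auto

lemma hball_V: "x \<in> V \<Longrightarrow> hball E i {x} \<subseteq> V"
  by (intro hball_subset) (auto dest!: cs)

lemma finite_hball: "x \<in> V \<Longrightarrow> finite (hball E i {x})"
  using hball_V V finite_subset by blast

lemma run_spec:
  "(\<forall>x\<in>V. outp u x = bit_of (u (x, pv u x))) \<and> snd (run u) = card {x \<in> V. pv u x = 1 / 2}"
proof -
  have "val T \<sigma> x = val T \<sigma>' x" if "\<And>y. y \<in> T \<Longrightarrow> \<sigma> y = \<sigma>' y" "x \<in> V - T" for T \<sigma> \<sigma>' x
    using that cs by (intro local_value_cong) auto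
  note cong = this
  have "(\<forall>x\<in>set \<pi>. fst (run u) x = bit_of (u (x, val ({} \<union> bef \<pi> x) (fst (run u)) x))) \<and>
      snd (run u) = 0 + card {x \<in> set \<pi>. val ({} \<union> bef \<pi> x) (fst (run u)) x = 1 / 2}"
    unfolding run_def
    by (rule run_coins_spec[where V = V, OF cong set\<pi>(2) eq_refl[OF set\<pi>(1)] Int_empty_right])
  then show ?thesis unfolding set\<pi> outp_def pv_def Un_empty_left add_0 .
qed

lemmas outp_eq = run_spec[THEN conjunct1, rule_format]
lemmas free_count = run_spec[THEN conjunct2]

lemma J_refl: "x \<in> J x" by (simp add: J_def)

text \<open>Induction along the order. The rule at x reads earlier variables only, so its value does
  not depend on the coins of x itself; in particular a flip at x leaves a free step at x
  free.\<close>

lemma pv_outp_local: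
  "x \<in> V \<Longrightarrow> ((\<forall>y\<in>J x - {x}. \<forall>p. u (y, p) = u' (y, p)) \<longrightarrow> pv u x = pv u' x) \<and>
     ((\<forall>y\<in>J x. \<forall>p. u (y, p) = u' (y, p)) \<longrightarrow> outp u x = outp u' x)"
proof (induction "pos \<pi> x" arbitrary: x rule: less_induct)
  case less
  have 1: "pv u x = pv u' x" if u: "\<forall>y\<in>J x - {x}. \<forall>p. u (y, p) = u' (y, p)"
    unfolding pv_def
  proof (rule local_value_cong)
    show "x \<in> V - bef \<pi> x" using less by (auto simp: bef_def)
    show "\<forall>(S, b)\<in>set cs. S \<subseteq> V" using cs by auto
    fix y assume y: "y \<in> bef \<pi> x" "y \<in> hball E h {x}"
    then have "(y, x) \<in> infl E h \<pi>" using less.prems set\<pi> by (auto simp: bef_def infl_def)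
    then have "J y \<subseteq> J x - {x}"
      using infl_pos[of x y E h \<pi>] by (auto simp: J_def infl_def dest: rtrancl_into_rtrancl)
    then show "outp u y = outp u' y" using less.hyps[of y] y u set\<pi> by (auto simp: bef_def)
  qed
  have 2: "outp u x = outp u' x" if "\<forall>y\<in>J x. \<forall>p. u (y, p) = u' (y, p)"
    using that 1 outp_eq[OF less.prems] J_refl by auto
  show ?case using 1 2 by blast
qed

lemmas pv_local = pv_outp_local[THEN conjunct1, rule_format]
lemmas outp_local = pv_outp_local[THEN conjunct2, rule_format]

definition unsat where "unsat u y \<longleftrightarrow> (\<exists>(S, b)\<in>set cs. y \<in> S \<and> (\<Sum>z\<in>S. outp u z) \<noteq> b)"
definition JJ where "JJ y = (\<Union>z\<in>hball E 1 {y}. J z)"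

lemma unsat_local: "y \<in> V \<Longrightarrow> (\<And>z p. z \<in> JJ y \<Longrightarrow> u (z, p) = u' (z, p)) \<Longrightarrow> unsat u y = unsat u' y"
proof -
  assume y: "y \<in> V" and u: "\<And>z p. z \<in> JJ y \<Longrightarrow> u (z, p) = u' (z, p)"
  have "outp u z = outp u' z" if "(S, b) \<in> set cs" "y \<in> S" "z \<in> S" for S b z
  proof -
    have "z \<in> hball E 1 {y}" using that by (force simp: hball_1)
    moreover from this have "z \<in> V" using hball_V[OF y, of 1] by blast
    ultimately show ?thesis using u by (intro outp_local) (auto simp: JJ_def)
  qed
  then have "(\<Sum>z\<in>S. outp u z) = (\<Sum>z\<in>S. outp u' z)" if "(S, b) \<in> set cs" "y \<in> S" for S b
    using that by (intro sum.cong) auto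
  then show "unsat u y = unsat u' y" unfolding unsat_def by (intro bex_cong refl) auto
qed

definition Z where "Z u = real (card {y \<in> V. unsat u y})"

lemma Z_eq: "Z u = (\<Sum>y\<in>V. of_bool (unsat u y))"
  unfolding Z_def by (rule real_card_filter[OF V])

text \<open>Variables with disjoint influence sets are violated independently, so their covariance
  vanishes; any other pair contributes at most 1.\<close>

lemma Var_Z: "Var C Z \<le> real (card {(y, y'). y \<in> V \<and> y' \<in> V \<and> JJ y \<inter> JJ y' \<noteq> {}})"
proof -
  let ?b = "\<lambda>y u. of_bool (unsat u y) :: real"
  have "EV C (\<lambda>u. (Z u)\<^sup>2) = (\<Sum>y\<in>V. \<Sum>y'\<in>V. EV C (\<lambda>u. ?b y u * ?b y' u))"
    unfolding Z_eq power2_eq_square sum_product by (simp only: EV_sum[OF finC])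
  moreover have "(EV C Z)\<^sup>2 = (\<Sum>y\<in>V. \<Sum>y'\<in>V. EV C (?b y) * EV C (?b y'))"
    unfolding Z_eq[abs_def] power2_eq_square EV_sum[OF finC] sum_product ..
  ultimately have "Var C Z = (\<Sum>y\<in>V. \<Sum>y'\<in>V. EV C (\<lambda>u. ?b y u * ?b y' u) - EV C (?b y) * EV C (?b y'))"
    by (simp only: Var_def sum_subtractf)
  also have "\<dots> \<le> (\<Sum>y\<in>V. \<Sum>y'\<in>V. of_bool (JJ y \<inter> JJ y' \<noteq> {}))"
  proof (intro sum_mono)
    fix y y' assume y: "y \<in> V" "y' \<in> V"
    show "EV C (\<lambda>u. ?b y u * ?b y' u) - EV C (?b y) * EV C (?b y') \<le> of_bool (JJ y \<inter> JJ y' \<noteq> {})"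
    proof (cases "JJ y \<inter> JJ y' = {}")
      case True
      have "EV C (\<lambda>u. ?b y u * ?b y' u) = EV C (?b y) * EV C (?b y')"
        unfolding C_def
      proof (rule coins_independent[where B = "JJ y"])
        fix u u' :: "nat \<times> real \<Rightarrow> bool"
        { assume "\<And>z p. z \<in> JJ y \<Longrightarrow> u (z, p) = u' (z, p)"
          then have "unsat u y = unsat u' y" by (rule unsat_local[OF y(1)])
          then show "?b y u = ?b y u'" by simp }
        { assume "\<And>z p. z \<notin> JJ y \<Longrightarrow> u (z, p) = u' (z, p)"
          then have "unsat u y' = unsat u' y'" using True by (intro unsat_local[OF y(2)]) auto
          then show "?b y' u = ?b y' u'" by simp }
      qed (use V P in auto)
      then show ?thesis by simp
    next
      case False
      have "EV C (\<lambda>u. ?b y u * ?b y' u) \<le> 1" by (intro EV_le) auto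
      moreover have "0 \<le> EV C (?b y) * EV C (?b y')" by (intro mult_nonneg_nonneg EV_ge) auto
      moreover have "of_bool (JJ y \<inter> JJ y' \<noteq> {}) = (1 :: real)" using False by simp
      ultimately show ?thesis by linarith
    qed
  qed
  also have "\<dots> = (\<Sum>z\<in>V \<times> V. of_bool (JJ (fst z) \<inter> JJ (snd z) \<noteq> {}))"
    by (simp add: sum.cartesian_product case_prod_unfold)
  also have "\<dots> = real (card {z \<in> V \<times> V. JJ (fst z) \<inter> JJ (snd z) \<noteq> {}})"
    using V by (intro real_card_filter[symmetric]) auto
  also have "{z \<in> V \<times> V. JJ (fst z) \<inter> JJ (snd z) \<noteq> {}} = {(y, y'). y \<in> V \<and> y' \<in> V \<and> JJ y \<inter> JJ y' \<noteq> {}}" by auto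
  finally show ?thesis .
qed

definition LC where "LC l = long_chain V (\<lambda>a. hball E h {a}) l \<pi>"

lemma LC_V: "LC l \<subseteq> V" by (auto simp: LC_def long_chain_def)

lemma J_local: "x \<in> V \<Longrightarrow> x \<notin> LC l \<Longrightarrow> J x \<subseteq> hball E (l * h) {x}"
  unfolding J_def LC_def using infl_local(1) by blast

lemma J_local': "x \<in> V \<Longrightarrow> x \<notin> LC l \<Longrightarrow> x \<in> J y \<Longrightarrow> y \<in> hball E (l * h) {x}"
  unfolding J_def LC_def using infl_local(2) by blast

text \<open>
  Unless a long chain starts next to \<open>y\<close> or \<open>y'\<close>, intersecting influence sets force \<open>y'\<close> into a bounded
  ball around \<open>y\<close>.
\<close>

lemma intersecting_pairs:
  "real (card {(y, y'). y \<in> V \<and> y' \<in> V \<and> JJ y \<inter> JJ y' \<noteq> {}}) \<le>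
     2 * rcard V * (\<Sum>z\<in>LC l. real (card (hball E 1 {z}))) + (\<Sum>y\<in>V. real (card (hball E (2 * (l * h + 1)) {y})))"
proof -
  let ?r = "l * h + 1"
  define X where "X = {y \<in> V. hball E 1 {y} \<inter> LC l \<noteq> {}}"
  have JJ: "JJ y \<subseteq> hball E ?r {y}" if "y \<in> V" "y \<notin> X" for y
    unfolding JJ_def
  proof (rule UN_least)
    fix z assume z: "z \<in> hball E 1 {y}"
    then have "z \<in> V" "z \<notin> LC l" using that hball_V[of y 1] by (auto simp: X_def)
    then have "J z \<subseteq> hball E (l * h) {z}" by (rule J_local)
    also have "\<dots> \<subseteq> hball E ?r {y}" using hball_trans[OF z, of _ "l * h"] by (auto simp: add.commute)
    finally show "J z \<subseteq> hball E ?r {y}" .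
  qed
  have "{(y, y'). y \<in> V \<and> y' \<in> V \<and> JJ y \<inter> JJ y' \<noteq> {}} \<subseteq> X \<times> V \<union> V \<times> X \<union> (SIGMA y:V. hball E (2 * ?r) {y})"
  proof
    fix p assume "p \<in> {(y, y'). y \<in> V \<and> y' \<in> V \<and> JJ y \<inter> JJ y' \<noteq> {}}"
    then obtain y y' x where p: "p = (y, y')" "y \<in> V" "y' \<in> V" and x: "x \<in> JJ y" "x \<in> JJ y'" by auto
    show "p \<in> X \<times> V \<union> V \<times> X \<union> (SIGMA y:V. hball E (2 * ?r) {y})"
    proof (cases "y \<in> X \<or> y' \<in> X")
      case False
      then have *: "x \<in> hball E ?r {y}" "x \<in> hball E ?r {y'}" using JJ p x by blast+
      have "y' \<in> hball E (?r + ?r) {y}" by (rule hball_trans[OF *(1) hball_sym[OF *(2)]])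
      then have "y' \<in> hball E (2 * ?r) {y}" unfolding mult_2 .
      then have "(y, y') \<in> (SIGMA y:V. hball E (2 * ?r) {y})" using p(2) by (rule SigmaI[rotated])
      then show ?thesis unfolding p(1) Un_iff by blast
    next
      case True
      then have "(y, y') \<in> X \<times> V \<union> V \<times> X" using p by auto
      then show ?thesis unfolding p(1) Un_iff by blast
    qed
  qed
  moreover have "finite (SIGMA y:V. hball E (2 * ?r) {y})" using V finite_hball by (intro finite_SigmaI)
  moreover have "finite X" using V by (simp add: X_def)
  ultimately have "card {(y, y'). y \<in> V \<and> y' \<in> V \<and> JJ y \<inter> JJ y' \<noteq> {}}
      \<le> card (X \<times> V \<union> V \<times> X \<union> (SIGMA y:V. hball E (2 * ?r) {y}))"
    using V by (intro card_mono finite_UnI finite_cartesian_product)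
  also have "\<dots> \<le> card (X \<times> V) + card (V \<times> X) + card (SIGMA y:V. hball E (2 * ?r) {y})"
    using card_Un_le[of "X \<times> V \<union> V \<times> X" "SIGMA y:V. hball E (2 * ?r) {y}"] card_Un_le[of "X \<times> V" "V \<times> X"] by linarith
  also have "card (SIGMA y:V. hball E (2 * ?r) {y}) = (\<Sum>y\<in>V. card (hball E (2 * ?r) {y}))"
    using V finite_hball by (intro card_SigmaI) blast+
  finally have *: "card {(y, y'). y \<in> V \<and> y' \<in> V \<and> JJ y \<inter> JJ y' \<noteq> {}} \<le>
      2 * card V * card X + (\<Sum>y\<in>V. card (hball E (2 * ?r) {y}))"
    unfolding card_cartesian_product by (simp add: mult.commute[of _ "card V"] del: hball.simps)
  have "X \<subseteq> (\<Union>z\<in>LC l. hball E 1 {z})"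
  proof
    fix y assume "y \<in> X"
    then obtain z where "z \<in> hball E 1 {y}" "z \<in> LC l" unfolding X_def by blast
    then show "y \<in> (\<Union>z\<in>LC l. hball E 1 {z})" by (intro UN_I[of z] hball_sym[of z])
  qed
  moreover have finLC: "finite (LC l)" using LC_V V finite_subset by blast
  moreover have finB: "finite (hball E 1 {z})" if "z \<in> LC l" for z
    using that LC_V by (intro finite_hball) blast
  ultimately have "card X \<le> card (\<Union>z\<in>LC l. hball E 1 {z})" by (intro card_mono finite_UN_I)
  also have "\<dots> \<le> (\<Sum>z\<in>LC l. card (hball E 1 {z}))" by (rule card_UN_le[OF finLC])
  finally have "card X \<le> (\<Sum>z\<in>LC l. card (hball E 1 {z}))" .
  then have "2 * card V * card X \<le> 2 * card V * (\<Sum>z\<in>LC l. card (hball E 1 {z}))" by (rule mult_le_mono2)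
  with * have "card {(y, y'). y \<in> V \<and> y' \<in> V \<and> JJ y \<inter> JJ y' \<noteq> {}} \<le>
      2 * card V * (\<Sum>z\<in>LC l. card (hball E 1 {z})) + (\<Sum>y\<in>V. card (hball E (2 * ?r) {y}))" by linarith
  then have "real (card {(y, y'). y \<in> V \<and> y' \<in> V \<and> JJ y \<inter> JJ y' \<noteq> {}}) \<le>
      real (2 * card V * (\<Sum>z\<in>LC l. card (hball E 1 {z})) + (\<Sum>y\<in>V. card (hball E (2 * ?r) {y})))"
    by (rule of_nat_mono)
  then show ?thesis by (simp del: hball.simps)
qed

end

section \<open>Free steps and failure\<close>

context decimation_run
begin

abbreviation flip where "flip x u \<equiv> u((x, 1 / 2 :: real) := \<not> u (x, 1 / 2))"

lemma pv_flip: "x \<in> V \<Longrightarrow> pv (flip x u) x = pv u x"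
  by (rule pv_local) auto

lemma outp_flip: "x \<in> V \<Longrightarrow> pv u x = 1 / 2 \<Longrightarrow> outp (flip x u) x \<noteq> outp u x"
proof -
  assume x: "x \<in> V" and p: "pv u x = 1 / 2"
  have "outp u x = bit_of (u (x, 1 / 2))" using outp_eq[OF x, of u] unfolding p .
  moreover have "outp (flip x u) x = bit_of (\<not> u (x, 1 / 2))"
    using outp_eq[OF x, of "flip x u"] unfolding pv_flip[OF x] p by simp
  ultimately show ?thesis by simp
qed

lemma outp_flip_differs: "z \<in> V \<Longrightarrow> outp (flip x u) z \<noteq> outp u z \<Longrightarrow> x \<in> J z"
proof (rule ccontr)
  assume z: "z \<in> V" "outp (flip x u) z \<noteq> outp u z" and x: "x \<notin> J z"
  have "outp (flip x u) z = outp u z" using x by (intro outp_local[OF z(1)]) auto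
  then show False using z(2) by simp
qed

text \<open>A clause with exactly one changed variable changes its parity and cannot be satisfied
  both before and after the flip. Only clauses at changed variables have to be satisfied, which
  keeps the argument local.\<close>

lemma stopping_flip:
  assumes "\<And>y. y \<in> V \<Longrightarrow> outp (flip x u) y \<noteq> outp u y \<Longrightarrow> \<not> unsat u y \<and> \<not> unsat (flip x u) y"
  shows "stopping E {z \<in> V. outp (flip x u) z \<noteq> outp u z}" (is "stopping E ?S")
  unfolding stopping_def
proof (intro ballI, rule ccontr)
  fix e y assume e: "e \<in> E" and y: "y \<in> e \<inter> ?S" and no: "\<not> (\<exists>z\<in>e \<inter> ?S. z \<noteq> y)"
  from e obtain b where b: "(e, b) \<in> set cs" by auto
  have eV: "e \<subseteq> V" using cs b by blast
  then have fin: "finite e" using V finite_subset by blast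
  have "(\<Sum>z\<in>e. outp u z) = b" "(\<Sum>z\<in>e. outp (flip x u) z) = b"
    using assms[of y] y b unfolding unsat_def by auto
  moreover have "(\<Sum>z\<in>e - {y}. outp u z) = (\<Sum>z\<in>e - {y}. outp (flip x u) z)"
    using no eV by (intro sum.cong) auto
  ultimately have "outp u y = outp (flip x u) y"
    using sum.remove[OF fin IntD1[OF y], of "outp u"] sum.remove[OF fin IntD1[OF y], of "outp (flip x u)"]
    by (metis add_right_cancel)
  then show False using y by auto
qed

text \<open>Otherwise the variables changed by the flip form a stopping set that contains x and lies
  in the ball, which contradicts \<open>stopping_card\<close>. The same K serves as bound for the
  ball and as depth of the witness.\<close>

lemma free_vertex:
  assumes x: "x \<in> V" "x \<notin> LC l" "card (hball E (l * h) {x}) \<le> K" "\<not> wit E K x" and free: "pv u x = 1 / 2"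
  shows "\<exists>y \<in> hball E (l * h) {x}. unsat u y \<or> unsat (flip x u) y"
proof (rule ccontr)
  assume no: "\<not> ?thesis"
  let ?S = "{z \<in> V. outp (flip x u) z \<noteq> outp u z}"
  have S: "?S \<subseteq> hball E (l * h) {x}"
    using outp_flip_differs J_local'[OF x(1,2)] by blast
  then have "stopping E ?S" using no by (intro stopping_flip) blast
  moreover have finS: "finite ?S" using V by simp
  moreover have "x \<in> ?S" using x free outp_flip by simp
  ultimately have "K < card ?S" using stopping_card[of ?S E x K] x(4) by blast
  moreover have "card ?S \<le> card (hball E (l * h) {x})"
    using S finite_hball[OF x(1)] by (intro card_mono)
  ultimately show False using x(3) by linarith
qed

lemma EV_flip: "x \<in> V \<Longrightarrow> EV C (\<lambda>u. f (flip x u)) = EV C (f :: _ \<Rightarrow> real)"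
proof -
  assume x: "x \<in> V"
  have "EV C f = EV (map_pmf (flip x) C) f"
    unfolding C_def coins_flip[OF V P(1) x P(2)] ..
  then show ?thesis by simp
qed

text \<open>
  Charge a free step at \<open>x\<close> to a violation in the ball around \<open>x\<close>, before or after the flip. Flips preserve
  the distribution of the coins, and each violation is charged by at most \<open>K\<close> variables.
\<close>

lemma free_bound:
  "EV C (\<lambda>u. real (snd (run u))) \<le> real (card {x \<in> V. wit E K x}) + real (card (LC l))
     + real (card {x \<in> V. K < card (hball E (2 * (l * h)) {x})}) + 2 * real K * EV C Z"
proof -
  let ?r = "l * h"
  let ?p = "\<lambda>y. EV C (\<lambda>u. of_bool (unsat u y)) :: real"
  let ?F = "\<lambda>x. EV C (\<lambda>u. of_bool (pv u x = 1 / 2)) :: real"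
  \<comment> \<open>The radius is doubled because all good variables that charge one violation lie
    in the ball of twice the radius around any one of them.\<close>
  define Bad where "Bad = {x \<in> V. wit E K x} \<union> LC l \<union> {x \<in> V. K < card (hball E (2 * ?r) {x})}"
  define Good where "Good = V - Bad"
  have BV: "Bad \<subseteq> V" using LC_V by (auto simp: Bad_def)
  then have finB: "finite Bad" "finite Good" using V by (auto intro: finite_subset simp: Good_def)
  note finball = finite_hball
  have p0: "0 \<le> ?p y" for y by (intro EV_ge) auto
  have "EV C (\<lambda>u. real (snd (run u))) = (\<Sum>x\<in>V. ?F x)"
    unfolding free_count real_card_filter[OF V] by (simp only: EV_sum[OF finC])
  also have "\<dots> = (\<Sum>x\<in>Bad. ?F x) + (\<Sum>x\<in>Good. ?F x)"
    unfolding Good_def using BV V by (subst sum.subset_diff[of Bad]) auto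
  also have "(\<Sum>x\<in>Bad. ?F x) \<le> (\<Sum>x\<in>Bad. 1)"
    by (intro sum_mono EV_le) auto
  also have "(\<Sum>x\<in>Bad. 1) \<le> real (card {x \<in> V. wit E K x}) + real (card (LC l)) + real (card {x \<in> V. K < card (hball E (2 * ?r) {x})})"
  proof -
    have "card Bad \<le> card {x \<in> V. wit E K x} + card (LC l) + card {x \<in> V. K < card (hball E (2 * ?r) {x})}"
      unfolding Bad_def by (meson add_le_mono card_Un_le le_refl le_trans)
    then show ?thesis by simp
  qed
  also have "(\<Sum>x\<in>Good. ?F x) \<le> (\<Sum>x\<in>Good. \<Sum>y\<in>hball E ?r {x}. 2 * ?p y)"
  proof (intro sum_mono)
    fix x assume "x \<in> Good"
    then have x: "x \<in> V" "x \<notin> LC l" "card (hball E (2 * ?r) {x}) \<le> K" "\<not> wit E K x"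
      by (auto simp: Good_def Bad_def)
    have "hball E ?r {x} \<subseteq> hball E (2 * ?r) {x}" by (rule hball_radius_mono) simp
    then have "card (hball E ?r {x}) \<le> K"
      using card_mono[OF finball[OF x(1)]] x(3) le_trans by blast
    note fv = free_vertex[OF x(1,2) this x(4)]
    have "?F x \<le>
       EV C (\<lambda>u. \<Sum>y\<in>hball E ?r {x}. of_bool (unsat u y) + of_bool (unsat (flip x u) y))"
    proof (intro EV_mono finC)
      fix u
      show "of_bool (pv u x = 1 / 2) \<le> (\<Sum>y\<in>hball E ?r {x}. of_bool (unsat u y) + of_bool (unsat (flip x u) y) :: real)"
      proof (cases "pv u x = 1 / 2")
        case True
        then obtain y where y: "y \<in> hball E ?r {x}" "unsat u y \<or> unsat (flip x u) y" using fv by blast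
        have "(1 :: real) \<le> of_bool (unsat u y) + of_bool (unsat (flip x u) y)" using y by auto
        also have "\<dots> \<le> (\<Sum>y\<in>hball E ?r {x}. of_bool (unsat u y) + of_bool (unsat (flip x u) y))"
          using y(1) finball[OF x(1)] by (intro member_le_sum) auto
        finally show ?thesis using True by simp
      qed (simp add: sum_nonneg)
    qed
    also have "\<dots> = (\<Sum>y\<in>hball E ?r {x}. 2 * ?p y)"
    proof -
      have "EV C (\<lambda>u. of_bool (unsat (flip x u) y)) = ?p y" for y
        using EV_flip[OF x(1), of "\<lambda>u. of_bool (unsat u y)"] .
      then show ?thesis by (simp only: EV_sum[OF finC] EV_add[OF finC] mult_2)
    qed
    finally show "?F x \<le> (\<Sum>y\<in>hball E ?r {x}. 2 * ?p y)" .
  qed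
  also have "\<dots> = (\<Sum>x\<in>Good. \<Sum>y\<in>V. of_bool (y \<in> hball E ?r {x}) * (2 * ?p y))"
  proof (rule sum.cong[OF refl])
    fix x assume "x \<in> Good"
    then have "x \<in> V" by (auto simp: Good_def)
    then have "V \<inter> {y. y \<in> hball E ?r {x}} = hball E ?r {x}" using hball_V by blast
    then show "(\<Sum>y\<in>hball E ?r {x}. 2 * ?p y) = (\<Sum>y\<in>V. of_bool (y \<in> hball E ?r {x}) * (2 * ?p y))"
      using V by (simp add: of_bool_def if_distrib[of "\<lambda>t. t * _"] sum.If_cases cong: if_cong)
  qed
  also have "\<dots> = (\<Sum>y\<in>V. real (card {x \<in> Good. y \<in> hball E ?r {x}}) * (2 * ?p y))"
    by (subst sum.swap) (simp only: sum_distrib_right[symmetric] real_card_filter[OF finB(2)])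
  also have "\<dots> \<le> (\<Sum>y\<in>V. real K * (2 * ?p y))"
  proof (intro sum_mono mult_right_mono of_nat_mono)
    fix y assume "y \<in> V"
    show "card {x \<in> Good. y \<in> hball E ?r {x}} \<le> K"
    proof (cases "{x \<in> Good. y \<in> hball E ?r {x}} = {}")
      case False
      then obtain x where x: "x \<in> Good" "y \<in> hball E ?r {x}" by blast
      then have xV: "x \<in> V" "card (hball E (2 * ?r) {x}) \<le> K" by (auto simp: Good_def Bad_def)
      have "{x \<in> Good. y \<in> hball E ?r {x}} \<subseteq> hball E (?r + ?r) {x}"
        using hball_trans[OF x(2) hball_sym] by blast
      then have "{x \<in> Good. y \<in> hball E ?r {x}} \<subseteq> hball E (2 * ?r) {x}" unfolding mult_2 .
      then show ?thesis using card_mono[OF finball[OF xV(1)]] xV(2) le_trans by blast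
    next
      case True
      then show ?thesis by (simp only: card.empty le0)
    qed
  qed (use p0 in auto)
  also have "\<dots> = 2 * real K * (\<Sum>y\<in>V. ?p y)" by (simp add: sum_distrib_left mult_ac)
  also have "(\<Sum>y\<in>V. ?p y) = EV C Z"
    unfolding Z_eq[abs_def] by (simp only: EV_sum[OF finC])
  finally show ?thesis by simp
qed

text \<open>Success forces \<open>Z\<close> to be 0, a deviation by the whole mean.\<close>

lemma success_bound:
  assumes "EV C Z > 0"
  shows "PR C {u. outp u \<in> solutions \<lparr>vars = V, clauses = mset cs\<rparr>} \<le> Var C Z / (EV C Z)\<^sup>2"
proof -
  have "{u. outp u \<in> solutions \<lparr>vars = V, clauses = mset cs\<rparr>} \<subseteq> {u. EV C Z \<le> \<bar>Z u - EV C Z\<bar>}"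
  proof
    fix u assume "u \<in> {u. outp u \<in> solutions \<lparr>vars = V, clauses = mset cs\<rparr>}"
    then have "\<not> unsat u y" for y unfolding unsat_def solutions_def by auto
    then have "Z u = 0" by (simp add: Z_def)
    then show "u \<in> {u. EV C Z \<le> \<bar>Z u - EV C Z\<bar>}" using assms by simp
  qed
  then have "PR C {u. outp u \<in> solutions \<lparr>vars = V, clauses = mset cs\<rparr>}
     \<le> PR C {u. EV C Z \<le> \<bar>Z u - EV C Z\<bar>}"
    by (intro measure_pmf.finite_measure_mono) auto
  also have "\<dots> \<le> Var C Z / (EV C Z)\<^sup>2" by (rule Chebyshev[OF finC assms])
  finally show ?thesis .
qed


text \<open>
  If all terms but the first are less than \<open>1\<close>, then there are many free steps and few exceptional
  variables; so the mean of \<open>Z\<close> is linear and Chebyshev's inequality applies. Otherwise the bound is trivial.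
\<close>

lemma success_pointwise:
  assumes n: "card V > 0" and K: "K \<ge> 1" and eps: "eps > 0" "eps' > 0" "d > 0" "\<delta> \<ge> 0" "d \<le> \<delta> * (1 - eps) - q - 3 * eps"
  shows "PR C {u. outp u \<in> solutions \<lparr>vars = V, clauses = mset cs\<rparr>} \<le>
    eps' / (d / (2 * real K))\<^sup>2 + of_bool ((q + eps) * rcard V \<le> real (card {x \<in> V. wit E K x}))
    + real (card (LC l)) / (eps * rcard V)
    + real (card {x \<in> V. K < card (hball E (2 * (l * h)) {x})}) / (eps * rcard V)
    + (2 * rcard V * (\<Sum>z\<in>LC l'. real (card (hball E 1 {z}))) + (\<Sum>y\<in>V. real (card (hball E (2 * (l' * h + 1)) {y})))) / (eps' * (rcard V)\<^sup>2)
    + PR C {u. real (snd (run u)) < \<delta> * rcard V} / eps"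
    (is "?s \<le> ?t0 + ?t1 + ?t2 + ?t3 + ?t4 + ?t5")
proof -
  let ?n = "rcard V"
  let ?Pairs = "2 * ?n * (\<Sum>z\<in>LC l'. real (card (hball E 1 {z}))) + (\<Sum>y\<in>V. real (card (hball E (2 * (l' * h + 1)) {y})))"
  have nonneg: "0 \<le> ?t0" "0 \<le> ?t1" "0 \<le> ?t2" "0 \<le> ?t3" "0 \<le> ?t4" "0 \<le> ?t5"
    using eps n by (auto intro!: divide_nonneg_nonneg add_nonneg_nonneg sum_nonneg mult_nonneg_nonneg)
  show ?thesis
  proof (cases "?t1 < 1 \<and> ?t2 < 1 \<and> ?t3 < 1 \<and> ?t4 < 1 \<and> ?t5 < 1")
    case False
    have "?s \<le> 1" by simp
    with False nonneg show ?thesis by linarith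
  next
    case True
    then have t: "?t1 < 1" "?t2 < 1" "?t3 < 1" "?t4 < 1" "?t5 < 1" by blast+
    have en: "eps * ?n > 0" "eps' * ?n\<^sup>2 > 0" using eps n by auto
    have 1: "real (card {x \<in> V. wit E K x}) < (q + eps) * ?n" using t(1) by (simp add: of_bool_def split: if_splits)
    have 2: "real (card (LC l)) < eps * ?n" using t(2) en(1) by (simp only: divide_less_eq_1_pos)
    have 3: "real (card {x \<in> V. K < card (hball E (2 * (l * h)) {x})}) < eps * ?n"
      using t(3) en(1) by (simp only: divide_less_eq_1_pos)
    have 4: "?Pairs < eps' * ?n\<^sup>2" using t(4) en(2) by (simp only: divide_less_eq_1_pos)
    have 5: "PR C {u. real (snd (run u)) < \<delta> * ?n} < eps"
      using t(5) eps(1) by (simp only: divide_less_eq_1_pos)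
    \<comment> \<open>A shortage of free steps has probability below eps, so it costs at most a
      factor 1 - eps in their mean.\<close>
    have "\<delta> * ?n * (1 - eps) \<le> \<delta> * ?n * (1 - PR C {u. real (snd (run u)) < \<delta> * ?n})"
      using 5 eps by (intro mult_left_mono) auto
    also have "\<dots> = EV C (\<lambda>u. \<delta> * ?n - \<delta> * ?n * of_bool (real (snd (run u)) < \<delta> * ?n))"
      unfolding EV_of_bool by (simp add: EV_diff algebra_simps)
    also have "\<dots> \<le> EV C (\<lambda>u. real (snd (run u)))"
      by (intro EV_mono) (auto simp: of_bool_def)
    also have "\<dots> \<le> (q + eps) * ?n + eps * ?n + eps * ?n + 2 * real K * EV C Z"
      using free_bound[of K l] 1 2 3 by linarith
    finally have "(\<delta> * (1 - eps) - q - 3 * eps) * ?n \<le> 2 * real K * EV C Z" by (simp add: algebra_simps)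
    moreover have "d * ?n \<le> (\<delta> * (1 - eps) - q - 3 * eps) * ?n" using eps(5) by (intro mult_right_mono) auto
    ultimately have "d * ?n \<le> 2 * real K * EV C Z" by linarith
    then have EZ: "d / (2 * real K) * ?n \<le> EV C Z" using K by (simp add: field_simps)
    have dn: "d / (2 * real K) * ?n > 0" using eps K n by auto
    then have "?s \<le> Var C Z / (EV C Z)\<^sup>2" using EZ by (intro success_bound) linarith
    also have "\<dots> \<le> (eps' * ?n\<^sup>2) / (d / (2 * real K) * ?n)\<^sup>2"
    proof (intro frac_le power_mono EZ)
      show "Var C Z \<le> eps' * ?n\<^sup>2" using Var_Z intersecting_pairs[of l'] 4 by linarith
      show "0 < (d / (2 * real K) * ?n)\<^sup>2" using dn by (rule zero_less_power)
      show "0 \<le> d / (2 * real K) * ?n" using dn by simp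
      show "0 \<le> eps' * ?n\<^sup>2" using en by simp
    qed
    also have "\<dots> = ?t0" using n by (simp add: power_mult_distrib power_divide)
    finally show ?thesis using nonneg by linarith
  qed
qed

end

section \<open>Averaging over instances and orders\<close>

abbreviation mean_chains :: "nat set \<Rightarrow> nat \<Rightarrow> nat \<Rightarrow> nat \<Rightarrow> nat \<Rightarrow> real" where
  "mean_chains V k m h l \<equiv> EV (iid m (rand_edge V k)) (\<lambda>es. EV (rand_perm V) (\<lambda>\<pi>.
     real (card (long_chain V (\<lambda>a. hball (set es) h {a}) l \<pi>))))"

lemma map_replicate_pmf: "map_pmf (map f) (iid m p) = iid m (map_pmf f p)"
proof (induction m)
  case (Suc m)
  have "map_pmf (map f) (iid (Suc m) p) =
      p \<bind> (\<lambda>x. map_pmf (map f) (iid m p) \<bind> (\<lambda>ys. return_pmf (f x # ys)))"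
    by (simp add: map_pmf_def bind_assoc_pmf bind_return_pmf)
  then show ?case by (simp add: Suc.IH bind_map_pmf)
qed simp

lemma rand_clause_eq: "rand_clause k n = pmf_of_set (ksets {1..n} k \<times> UNIV)"
  by (simp add: rand_clause_def ksets_def)

lemma set_rand_clause:
  "k \<le> n \<Longrightarrow> set_pmf (rand_clause k n) = ksets {1..n} k \<times> UNIV"
  unfolding rand_clause_eq using finite_UNIV_bit ksets_nonempty[of "{1..n}" k] by (intro set_pmf_of_set) auto

lemma map_fst_rand_clause:
  assumes "k \<le> n"
  shows "map_pmf fst (rand_clause k n) = rand_edge {1..n} k"
proof (rule pmf_eqI)
  fix S
  let ?A = "ksets {1..n} k"
  have A: "finite ?A" "?A \<noteq> {}" using assms by (auto simp: ksets_nonempty)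
  have B: "finite (UNIV :: bit set)" "card (UNIV :: bit set) > 0"
    using finite_UNIV_bit by (auto simp: card_gt_0_iff)
  have eq: "(A \<times> (UNIV :: 'b set)) \<inter> fst -` {S} = (A \<inter> {S}) \<times> UNIV" for A :: "nat set set" by fastforce
  have "card (?A \<inter> {S}) = indicator ?A S" by (simp add: indicator_def)
  have "pmf (map_pmf fst (rand_clause k n)) S = real (card ((?A \<times> (UNIV :: bit set)) \<inter> fst -` {S})) / real (card (?A \<times> (UNIV :: bit set)))"
    unfolding rand_clause_eq pmf_map using A B(1) by (intro measure_pmf_of_set) auto
  also have "\<dots> = indicator ?A S / real (card ?A)"
    using B(2) unfolding eq by (simp add: card_cartesian_product \<open>card (?A \<inter> {S}) = indicator ?A S\<close> indicator_def)
  also have "\<dots> = pmf (rand_edge {1..n} k) S" by (rule pmf_of_set[OF A(2,1), symmetric])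
  finally show "pmf (map_pmf fst (rand_clause k n)) S = pmf (rand_edge {1..n} k) S" .
qed

text \<open>Balls, witnesses and chains do not see the right-hand sides, so they can be averaged
  over the random hypergraph of supports.\<close>

lemma EV_edges:
  assumes "k \<le> n"
  shows "EV (iid m (rand_clause k n)) (\<lambda>cs. F (fst ` set cs)) =
         EV (iid m (rand_edge {1..n} k)) (\<lambda>es. F (set es) :: real)"
  unfolding map_fst_rand_clause[OF assms, symmetric] map_replicate_pmf[symmetric] by simp

section \<open>Exponential bounds for ball sizes\<close>

lemma le_exp_nat: "real N \<le> exp (real N)"
  using exp_ge_add_one_self[of "real N"] by linarith

lemma exp_power_nat: "exp c ^ N = exp (c * real N)"
  by (simp add: exp_of_nat_mult[symmetric] mult.commute)

text \<open>The factor \<open>exp (real D)\<close> is the price of stopped chains in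
  \<open>EV_card_long_chain\<close>. Sizes above D pay for it and still leave decay in D, at the
  cost of a third exponential moment.\<close>

lemma size_tail_exp: "real N * of_bool (D < N) * exp (real D) \<le> exp (- real D) * exp 3 ^ N"
proof (cases "D < N")
  case True
  have "real N * exp (real D) \<le> exp (real N) * exp (real D)" by (intro mult_right_mono le_exp_nat) simp
  also have "\<dots> = exp (real N + real D)" by (simp add: exp_add)
  also have "\<dots> \<le> exp (- real D + 3 * real N)" using True by simp
  finally show ?thesis using True unfolding exp_power_nat exp_add by simp
qed simp

lemma size_split: "real N \<le> real D + exp (- real D) * exp 2 ^ N"
proof (cases "N \<le> D")
  case False
  have "real N \<le> exp (real N)" by (rule le_exp_nat)
  also have "\<dots> \<le> exp (- real D + 2 * real N)" using False by simp
  finally show ?thesis unfolding exp_power_nat exp_add by simp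
qed (simp add: add_increasing2)

lemma size_indicator: "of_bool (K < N) \<le> exp (- real K) * exp 1 ^ N"
proof (cases "K < N")
  case True
  have "1 \<le> exp (- real K + 1 * real N)" using True by simp
  then show ?thesis using True unfolding exp_power_nat exp_add by simp
qed simp

context
  fixes V :: "nat set" and k m :: nat and \<kappa> :: real
  assumes V: "finite V" "1 \<le> k" "k \<le> card V" and \<kappa>: "0 \<le> \<kappa>" "real (k * m) \<le> \<kappa> * rcard V"
begin

abbreviation "edges_pmf \<equiv> iid m (rand_edge V k)"

lemma fin_edges_pmf: "finite (set_pmf edges_pmf)" using V by simp

lemma EV_sum_ball_mgf:
  assumes "z \<ge> 1"
  shows "EV edges_pmf (\<lambda>es. \<Sum>x\<in>V. z ^ card (hball (set es) i {x})) \<le> rcard V * ball_mgf \<kappa> z k i"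
proof -
  have "EV edges_pmf (\<lambda>es. \<Sum>x\<in>V. z ^ card (hball (set es) i {x})) = (\<Sum>x\<in>V. EV edges_pmf (\<lambda>es. z ^ card (hball (set es) i {x})))"
    by (rule EV_sum[OF fin_edges_pmf])
  also have "\<dots> \<le> (\<Sum>x\<in>V. ball_mgf \<kappa> z k i)"
  proof (rule sum_mono)
    fix x assume "x \<in> V"
    then show "EV edges_pmf (\<lambda>es. z ^ card (hball (set es) i {x})) \<le> ball_mgf \<kappa> z k i"
      using hball_mgf[OF V assms \<kappa>(1), of "{x}" m i] \<kappa>(2) by simp
  qed
  finally show ?thesis by simp
qed

lemma EV_sum_ball_card:
  "EV edges_pmf (\<lambda>es. \<Sum>x\<in>V. real (card (hball (set es) i {x}))) \<le> rcard V * ball_mgf \<kappa> (exp 1) k i"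
proof -
  have "EV edges_pmf (\<lambda>es. \<Sum>x\<in>V. real (card (hball (set es) i {x}))) \<le> EV edges_pmf (\<lambda>es. \<Sum>x\<in>V. exp 1 ^ card (hball (set es) i {x}))"
    by (intro EV_mono[OF fin_edges_pmf] sum_mono) (simp only: exp_power_nat mult_1 le_exp_nat)
  also have "\<dots> \<le> rcard V * ball_mgf \<kappa> (exp 1) k i" by (rule EV_sum_ball_mgf) simp
  finally show ?thesis .
qed

lemma EV_big_balls:
  "EV edges_pmf (\<lambda>es. real (card {x \<in> V. K < card (hball (set es) i {x})})) \<le> rcard V * (exp (- real K) * ball_mgf \<kappa> (exp 1) k i)"
proof -
  have "EV edges_pmf (\<lambda>es. real (card {x \<in> V. K < card (hball (set es) i {x})})) \<le>
      EV edges_pmf (\<lambda>es. exp (- real K) * (\<Sum>x\<in>V. exp 1 ^ card (hball (set es) i {x})))"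
    unfolding real_card_filter[OF V(1)] sum_distrib_left
    by (intro EV_mono[OF fin_edges_pmf] sum_mono size_indicator)
  also have "\<dots> = exp (- real K) * EV edges_pmf (\<lambda>es. \<Sum>x\<in>V. exp 1 ^ card (hball (set es) i {x}))" by simp
  also have "\<dots> \<le> exp (- real K) * (rcard V * ball_mgf \<kappa> (exp 1) k i)"
    by (intro mult_left_mono EV_sum_ball_mgf) auto
  finally show ?thesis by (simp add: mult_ac)
qed

lemma edges_subset: "es \<in> set_pmf edges_pmf \<Longrightarrow> \<Union>(set es) \<subseteq> V"
  using set_replicate_rand_edge(1)[OF V(1,3)] by blast

lemma EV_long_chain:
  assumes D: "D \<ge> 1"
  shows "mean_chains V k m h l \<le> 2 * rcard V * (real D ^ l / fact (Suc l) + exp (- real D) * ball_mgf \<kappa> (exp 3) k h)"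
proof -
  have "mean_chains V k m h l \<le>
     EV edges_pmf (\<lambda>es. 2 * (rcard V * real D ^ l / fact (Suc l)) + 2 * exp (- real D) * (\<Sum>x\<in>V. exp 3 ^ card (hball (set es) h {x})))"
  proof (intro EV_mono fin_edges_pmf)
    fix es assume es: "es \<in> set_pmf edges_pmf"
    let ?N = "\<lambda>a. hball (set es) h {a}"
    have "EV (rand_perm V) (\<lambda>\<pi>. real (card (long_chain V ?N l \<pi>))) \<le>
        2 * (rcard V * real D ^ l / fact (Suc l) + exp (real D) * (\<Sum>x | x \<in> V \<and> \<not> card (?N x) \<le> D. real (card (?N x))))"
    proof (rule EV_card_long_chain_sum[OF V(1) _ _ _ D])
      show "hball (set es) h {x} \<subseteq> V" if "x \<in> V" for x
        using that edges_subset[OF es] by (intro hball_subset) auto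
      show "x \<in> hball (set es) h {x}" for x using hball_extensive[of "{x}" "set es" h] by simp
    qed (rule hball_sym)
    also have "exp (real D) * (\<Sum>x | x \<in> V \<and> \<not> card (?N x) \<le> D. real (card (?N x))) = (\<Sum>x\<in>V. real (card (?N x)) * of_bool (D < card (?N x)) * exp (real D))"
      unfolding sum.inter_filter[OF V(1)] sum_distrib_left by (intro sum.cong) auto
    also have "\<dots> \<le> (\<Sum>x\<in>V. exp (- real D) * exp 3 ^ card (?N x))"
      by (intro sum_mono size_tail_exp)
    finally show "EV (rand_perm V) (\<lambda>\<pi>. real (card (long_chain V ?N l \<pi>))) \<le>
       2 * (rcard V * real D ^ l / fact (Suc l)) + 2 * exp (- real D) * (\<Sum>x\<in>V. exp 3 ^ card (?N x))"
      by (simp add: sum_distrib_left algebra_simps del: fact_Suc)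
  qed
  also have "\<dots> = 2 * (rcard V * real D ^ l / fact (Suc l)) + 2 * exp (- real D) * EV edges_pmf (\<lambda>es. \<Sum>x\<in>V. exp 3 ^ card (hball (set es) h {x}))"
    by (simp add: EV_add[OF fin_edges_pmf] del: fact_Suc)
  also have "\<dots> \<le> 2 * (rcard V * real D ^ l / fact (Suc l)) + 2 * exp (- real D) * (rcard V * ball_mgf \<kappa> (exp 3) k h)"
    by (intro add_left_mono mult_left_mono EV_sum_ball_mgf) auto
  finally show ?thesis by (simp add: algebra_simps del: fact_Suc)
qed

end

lemma exp_minus_nat_small: "t > 0 \<Longrightarrow> \<exists>D\<ge>1. exp (- real D) * c \<le> t"
proof -
  assume t: "t > 0"
  obtain D :: nat where D: "max 1 (c / t) \<le> real D" using real_arch_simple by blast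
  have "c \<le> t * real D" using D t by (simp add: field_simps)
  also have "\<dots> \<le> t * exp (real D)" using t le_exp_nat by (intro mult_left_mono) auto
  finally have "exp (- real D) * c \<le> t" by (simp add: exp_minus field_simps)
  then show ?thesis using D by (intro exI[of _ D]) auto
qed

text \<open>D is fixed first and makes the contribution of big neighbourhoods small; then l is
  chosen such that the factorial beats D ^ l. Neither depends on V or m.\<close>

lemma long_chain_small:
  assumes "t > 0"
  shows "\<exists>l. \<forall>V m. finite V \<and> 1 \<le> k \<and> k \<le> card V \<and> 0 \<le> \<kappa> \<and> real (k * m) \<le> \<kappa> * rcard V \<longrightarrow>
    mean_chains V k m h l \<le> t * rcard V"
proof -
  obtain D :: nat where D: "D \<ge> 1" "exp (- real D) * ball_mgf \<kappa> (exp 3) k h \<le> t / 4"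
    using exp_minus_nat_small[of "t / 4"] assms by auto
  have "(\<lambda>l. inverse (fact l) * real D ^ l) \<longlonglongrightarrow> 0" by (rule summable_LIMSEQ_zero[OF summable_exp])
  then have "\<forall>\<^sub>F l in sequentially. inverse (fact l) * real D ^ l < t / 4"
    using assms by (intro order_tendstoD(2)[of _ 0]) auto
  then obtain l where l: "inverse (fact l) * real D ^ l < t / 4" by (auto simp: eventually_sequentially)
  have "real D ^ l / fact (Suc l) \<le> real D ^ l / fact l"
    by (intro divide_left_mono fact_mono) auto
  also have "\<dots> < t / 4" using l unfolding divide_inverse mult.commute[of "real D ^ l"] .
  finally have "real D ^ l / fact (Suc l) \<le> t / 4" by (rule less_imp_le)
  then have "2 * rcard V * (real D ^ l / fact (Suc l) + exp (- real D) * ball_mgf \<kappa> (exp 3) k h) \<le> 2 * rcard V * (t / 4 + t / 4)" for V :: "nat set"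
    using D by (intro mult_left_mono add_mono) auto
  then have bound: "2 * rcard V * (real D ^ l / fact (Suc l) + exp (- real D) * ball_mgf \<kappa> (exp 3) k h) \<le> t * rcard V" for V :: "nat set"
    by (simp add: mult.commute del: fact_Suc)
  show ?thesis
  proof (intro exI[of _ l] allI impI, elim conjE)
    fix V :: "nat set" and m
    assume "finite V" "1 \<le> k" "k \<le> card V" "0 \<le> \<kappa>" "real (k * m) \<le> \<kappa> * rcard V"
    from EV_long_chain[OF this D(1)] bound
    show "mean_chains V k m h l \<le> t * rcard V" by (rule order_trans)
  qed
qed


lemma EV_const: "EV p (\<lambda>_. c :: real) = c"
  by simp

section \<open>Transfer to the decimation algorithm\<close>

lemma dec_eq_run:
  assumes V: "finite V" and cs: "\<And>S b. (S, b) \<in> set cs \<Longrightarrow> S \<subseteq> V \<and> S \<noteq> {}"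
  shows "dec \<tau> (2 * h) \<lparr>vars = V, clauses = mset cs\<rparr> =
    rand_perm V \<bind> (\<lambda>\<pi>. map_pmf (decimation_run.run V cs \<pi> \<tau> h) (decimation_run.C V cs \<tau> h))"
proof -
  have res: "residual cs {} \<sigma> = cs" for \<sigma> using cs by (intro residual_empty) auto
  have fin: "\<forall>(S, b)\<in>set cs. finite S" using cs V finite_subset by fastforce
  have "dec \<tau> (2 * h) \<lparr>vars = V, clauses = mset cs\<rparr> =
      rand_perm V \<bind> (\<lambda>\<pi>. run_random (local_value \<tau> (2 * h) V cs) \<pi> {} (\<lambda>_. undefined) 0)"
    using dec_iter_eq_run_random[OF V empty_subsetI fin, of \<tau> "2 * h" "\<lambda>_. undefined" 0]
    unfolding dec_def dec_run_eq_iter by (simp add: res)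
  also have "\<dots> = rand_perm V \<bind> (\<lambda>\<pi>. map_pmf (decimation_run.run V cs \<pi> \<tau> h) (decimation_run.C V cs \<tau> h))"
  proof (intro bind_pmf_cong refl)
    fix \<pi> assume "\<pi> \<in> set_pmf (rand_perm V)"
    then interpret decimation_run V cs \<pi> \<tau> h using V cs by unfold_locales auto
    show "run_random (local_value \<tau> (2 * h) V cs) \<pi> {} (\<lambda>_. undefined) 0 = map_pmf run C" by (rule run_random_C)
  qed
  finally show ?thesis .
qed

text \<open>Clauses, order and coins are averaged one after the other, which makes the estimates for
  a fixed instance and order available inside the averages.\<close>

lemma prob_dec_on:
  assumes k: "1 \<le> k" "k \<le> n"
  shows "PR (dec_on \<tau> (2 * h) (rand_xorsat k n m)) {(\<Phi>, \<sigma>, f). A \<Phi> \<sigma> f} =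
    EV (iid m (rand_clause k n)) (\<lambda>cs. EV (rand_perm {1..n}) (\<lambda>\<pi>.
      PR (decimation_run.C {1..n} cs \<tau> h)
        {u. A \<lparr>vars = {1..n}, clauses = mset cs\<rparr> (decimation_run.outp {1..n} cs \<pi> \<tau> h u) (snd (decimation_run.run {1..n} cs \<pi> \<tau> h u))}))"
proof -
  let ?V = "{1..n}" and ?p = "iid m (rand_clause k n)"
  let ?\<Phi> = "\<lambda>cs. \<lparr>vars = ?V, clauses = mset cs\<rparr>"
  let ?run = "\<lambda>cs \<pi>. decimation_run.run ?V cs \<pi> \<tau> h" and ?C = "\<lambda>cs. decimation_run.C ?V cs \<tau> h"
  let ?I = "indicator {(\<Phi>, \<sigma>, f). A \<Phi> \<sigma> f} :: _ \<Rightarrow> real"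
  have fin: "finite (set_pmf (rand_clause k n))"
    using k finite_UNIV_bit by (simp add: set_rand_clause)
  have valid: "S \<subseteq> ?V \<and> S \<noteq> {}" if "cs \<in> set_pmf ?p" "(S, b) \<in> set cs" for cs S b
  proof -
    have "(S, b) \<in> set_pmf (rand_clause k n)" using that by (auto simp: set_replicate_pmf)
    then show ?thesis using k unfolding set_rand_clause[OF k(2)] ksets_def by auto
  qed
  have "dec_on \<tau> (2 * h) (rand_xorsat k n m) = ?p \<bind> (\<lambda>cs. dec \<tau> (2 * h) (?\<Phi> cs) \<bind> (\<lambda>(\<sigma>, f). return_pmf (?\<Phi> cs, \<sigma>, f)))"
    unfolding dec_on_def rand_xorsat_def by (simp add: bind_map_pmf)
  also have "\<dots> = ?p \<bind> (\<lambda>cs. rand_perm ?V \<bind> (\<lambda>\<pi>. map_pmf (\<lambda>u. (?\<Phi> cs, ?run cs \<pi> u)) (?C cs)))"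
  proof (intro bind_pmf_cong refl)
    fix cs assume cs: "cs \<in> set_pmf ?p"
    show "dec \<tau> (2 * h) (?\<Phi> cs) \<bind> (\<lambda>(\<sigma>, f). return_pmf (?\<Phi> cs, \<sigma>, f)) =
        rand_perm ?V \<bind> (\<lambda>\<pi>. map_pmf (\<lambda>u. (?\<Phi> cs, ?run cs \<pi> u)) (?C cs))"
      using valid[OF cs] by (subst dec_eq_run) (auto simp: bind_assoc_pmf map_pmf_def bind_return_pmf case_prod_unfold)
  qed
  finally have eq: "dec_on \<tau> (2 * h) (rand_xorsat k n m) =
      ?p \<bind> (\<lambda>cs. rand_perm ?V \<bind> (\<lambda>\<pi>. map_pmf (\<lambda>u. (?\<Phi> cs, ?run cs \<pi> u)) (?C cs)))" .
  have finC: "finite (set_pmf (?C cs))" if "cs \<in> set_pmf ?p" "\<pi> \<in> permutations_of_set ?V" for cs \<pi>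
  proof -
    interpret decimation_run ?V cs \<pi> \<tau> h using that valid by unfold_locales auto
    show ?thesis by (rule finC)
  qed
  have "PR (dec_on \<tau> (2 * h) (rand_xorsat k n m)) {(\<Phi>, \<sigma>, f). A \<Phi> \<sigma> f} =
      EV ?p (\<lambda>cs. EV (rand_perm ?V \<bind> (\<lambda>\<pi>. map_pmf (\<lambda>u. (?\<Phi> cs, ?run cs \<pi> u)) (?C cs))) ?I)"
    unfolding eq EV_indicator using fin finC by (intro EV_bind) (auto simp del: atLeastAtMost_iff)
  also have "\<dots> = EV ?p (\<lambda>cs. EV (rand_perm ?V) (\<lambda>\<pi>. PR (?C cs)
        {u. A (?\<Phi> cs) (decimation_run.outp ?V cs \<pi> \<tau> h u) (snd (?run cs \<pi> u))}))"
  proof (intro EV_cong)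
    fix cs assume cs: "cs \<in> set_pmf ?p"
    have "EV (rand_perm ?V \<bind> (\<lambda>\<pi>. map_pmf (\<lambda>u. (?\<Phi> cs, ?run cs \<pi> u)) (?C cs))) ?I =
       EV (rand_perm ?V) (\<lambda>\<pi>. EV (map_pmf (\<lambda>u. (?\<Phi> cs, ?run cs \<pi> u)) (?C cs)) ?I)"
      using finC[OF cs] by (intro EV_bind) auto
    also have "\<dots> = EV (rand_perm ?V) (\<lambda>\<pi>. PR (?C cs)
        {u. A (?\<Phi> cs) (decimation_run.outp ?V cs \<pi> \<tau> h u) (snd (?run cs \<pi> u))})"
    proof (intro EV_cong)
      fix \<pi> assume "\<pi> \<in> set_pmf (rand_perm ?V)"
      then interpret decimation_run ?V cs \<pi> \<tau> h using cs valid by unfold_locales auto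
      show "EV (map_pmf (\<lambda>u. (?\<Phi> cs, run u)) C) ?I =
          PR C {u. A (?\<Phi> cs) (outp u) (snd (run u))}"
        unfolding EV_indicator[symmetric] outp_def by (simp add: vimage_def case_prod_unfold)
    qed
    finally show "EV (rand_perm ?V \<bind> (\<lambda>\<pi>. map_pmf (\<lambda>u. (?\<Phi> cs, ?run cs \<pi> u)) (?C cs))) ?I =
        EV (rand_perm ?V) (\<lambda>\<pi>. PR (?C cs)
        {u. A (?\<Phi> cs) (decimation_run.outp ?V cs \<pi> \<tau> h u) (snd (?run cs \<pi> u))})" .
  qed
  finally show ?thesis .
qed

text \<open>The bound of \<open>success_pointwise\<close> is a sum, so it is averaged term by term;
  the divisions by eps and eps' play the role of Markov's inequality. D truncates the sizes of balls
  of radius 1.\<close>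

lemma success_prob_le:
  fixes k n m h K l l' :: nat and \<tau> \<kappa>
  defines "V \<equiv> {1..n}" and "P \<equiv> dec_on \<tau> (2 * h) (rand_xorsat k n m)" and "R \<equiv> iid m (rand_edge {1..n} k)"
  assumes k: "1 \<le> k" "k \<le> n" and \<kappa>: "0 \<le> \<kappa>" "real (k * m) \<le> \<kappa> * real n" and "K \<ge> 1"
    and eps: "eps > 0" "eps' > 0" "d > 0" "\<delta> \<ge> 0" "d \<le> \<delta> * (1 - eps) - q - 3 * eps"
    and LC: "mean_chains V k m h l \<le> t * real n"
    and LC': "mean_chains V k m h l' \<le> t' * real n"
  shows "PR P {(\<Phi>, \<sigma>, f). \<sigma> \<in> solutions \<Phi>} \<le>
    eps' / (d / (2 * real K))\<^sup>2
    + PR R {es. (q + eps) * real n \<le> real (card {x \<in> V. wit (set es) K x})}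
    + t / eps + exp (- real K) * ball_mgf \<kappa> (exp 1) k (2 * (l * h)) / eps
    + (2 * (real D * t' + exp (- real D) * ball_mgf \<kappa> (exp 2) k 1) + ball_mgf \<kappa> (exp 1) k (2 * (l' * h + 1)) / real n) / eps'
    + PR P {(\<Phi>, \<sigma>, f). real f < \<delta> * real n} / eps"
proof -
  let ?p = "iid m (rand_clause k n)" and ?q = "rand_perm V"
  have n: "real n > 0" "card V = n" "finite V" using k by (auto simp: V_def)
  have finp: "finite (set_pmf ?p)" "finite (set_pmf ?q)" "finite (set_pmf R)"
    using k finite_UNIV_bit by (auto simp: set_rand_clause R_def V_def)
  define LCs where "LCs l es \<pi> = long_chain V (\<lambda>a. hball es h {a}) l \<pi>" for l es \<pi>
  define w where "w es = (of_bool ((q + eps) * real n \<le> real (card {x \<in> V. wit es K x})) :: real)" for es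
  define B where "B es = real (card {x \<in> V. K < card (hball es (2 * (l * h)) {x})})" for es
  define M where "M es = (\<Sum>x\<in>V. (exp 2 :: real) ^ card (hball es 1 {x}))" for es
  define S where "S es = (\<Sum>y\<in>V. real (card (hball es (2 * (l' * h + 1)) {y})))" for es
  define F where "F cs \<pi> = PR (decimation_run.C V cs \<tau> h) {u. real (snd (decimation_run.run V cs \<pi> \<tau> h u)) < \<delta> * real n}" for cs \<pi>
  define X where "X es \<pi> = eps' / (d / (2 * real K))\<^sup>2 + w es + real (card (LCs l es \<pi>)) * (1 / (eps * real n)) + B es * (1 / (eps * real n))
      + (2 * real n * (real D * real (card (LCs l' es \<pi>)) + exp (- real D) * M es) + S es) * (1 / (eps' * (real n)\<^sup>2))" for es \<pi>
  have "PR P {(\<Phi>, \<sigma>, f). \<sigma> \<in> solutions \<Phi>} \<le> EV ?p (\<lambda>cs. EV ?q (\<lambda>\<pi>. X (fst ` set cs) \<pi> + F cs \<pi> * (1 / eps)))"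
    unfolding P_def prob_dec_on[OF k, where A = "\<lambda>\<Phi> \<sigma> f. \<sigma> \<in> solutions \<Phi>"] V_def[symmetric]
  proof (intro EV_mono finp)
    fix cs \<pi> assume cs: "cs \<in> set_pmf ?p" and \<pi>: "\<pi> \<in> set_pmf ?q"
    interpret decimation_run V cs \<pi> \<tau> h
    proof
      show "finite V" by (rule n)
      show "\<pi> \<in> permutations_of_set V" using \<pi> n by simp
      fix S b assume "(S, b) \<in> set cs"
      then have "(S, b) \<in> set_pmf (rand_clause k n)" using cs by (auto simp: set_replicate_pmf)
      then show "S \<subseteq> V" unfolding set_rand_clause[OF k(2)] ksets_def V_def by auto
    qed
    \<comment> \<open>Membership in \<open>LC l'\<close> and the size of the ball are correlated and
      cannot be averaged separately. Sizes up to D are replaced by D, and larger ones are paid for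
      by an exponential moment summed over all of V.\<close>
    have "(\<Sum>z\<in>LC l'. real (card (hball E 1 {z}))) \<le> (\<Sum>z\<in>LC l'. real D + exp (- real D) * exp 2 ^ card (hball E 1 {z}))"
      by (intro sum_mono size_split)
    also have "\<dots> = real D * real (card (LC l')) + exp (- real D) * (\<Sum>z\<in>LC l'. exp 2 ^ card (hball E 1 {z}))"
      by (simp only: sum.distrib sum_distrib_left sum_constant mult.commute)
    also have "(\<Sum>z\<in>LC l'. exp 2 ^ card (hball E 1 {z})) \<le> M E"
      unfolding M_def using LC_V n by (intro sum_mono2) auto
    finally have sp: "(\<Sum>z\<in>LC l'. real (card (hball E 1 {z}))) \<le> real D * real (card (LCs l' E \<pi>)) + exp (- real D) * M E"
      by (simp add: LCs_def LC_def)
    have "PR C {u. outp u \<in> solutions \<lparr>vars = V, clauses = mset cs\<rparr>} \<le>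
      eps' / (d / (2 * real K))\<^sup>2 + w E + real (card (LCs l E \<pi>)) / (eps * real n) + B E / (eps * real n)
      + (2 * real n * (\<Sum>z\<in>LC l'. real (card (hball E 1 {z}))) + S E) / (eps' * (real n)\<^sup>2) + F cs \<pi> / eps"
      using success_pointwise[of K eps eps' d \<delta> q l l'] n eps \<open>K \<ge> 1\<close>
      unfolding w_def LCs_def B_def S_def F_def LC_def by simp
    also have "\<dots> \<le> X E \<pi> + F cs \<pi> * (1 / eps)"
      unfolding X_def times_divide_eq_right mult_1_right using sp eps n
      by (intro add_mono divide_right_mono mult_left_mono order_refl) auto
    finally show "PR C {u. outp u \<in> solutions \<lparr>vars = V, clauses = mset cs\<rparr>} \<le> X E \<pi> + F cs \<pi> * (1 / eps)" .
  qed
  also have "\<dots> = EV ?p (\<lambda>cs. EV ?q (X (fst ` set cs))) + EV ?p (\<lambda>cs. EV ?q (F cs)) * (1 / eps)"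
    by (simp add: EV_add finp)
  also have "EV ?p (\<lambda>cs. EV ?q (F cs)) = PR P {(\<Phi>, \<sigma>, f). real f < \<delta> * real n}"
    unfolding P_def prob_dec_on[OF k, where A = "\<lambda>\<Phi> \<sigma> f. real f < \<delta> * real n"] V_def[symmetric] F_def ..
  also have "EV ?p (\<lambda>cs. EV ?q (X (fst ` set cs))) = EV R (\<lambda>es. EV ?q (X (set es)))"
    unfolding R_def by (rule EV_edges[OF k(2)])
  also have "\<dots> = eps' / (d / (2 * real K))\<^sup>2 + EV R (\<lambda>es. w (set es)) + EV R (\<lambda>es. EV ?q (\<lambda>\<pi>. real (card (LCs l (set es) \<pi>)))) * (1 / (eps * real n))
      + EV R (\<lambda>es. B (set es)) * (1 / (eps * real n))
      + (2 * real n * (real D * EV R (\<lambda>es. EV ?q (\<lambda>\<pi>. real (card (LCs l' (set es) \<pi>)))) + exp (- real D) * EV R (\<lambda>es. M (set es))) + EV R (\<lambda>es. S (set es))) * (1 / (eps' * (real n)\<^sup>2))"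
    unfolding X_def by (simp only: EV_add finp integral_mult_right_zero integral_mult_left_zero EV_const)
  also have "\<dots> \<le> eps' / (d / (2 * real K))\<^sup>2 + PR R {es. (q + eps) * real n \<le> real (card {x \<in> V. wit (set es) K x})}
     + (t * real n) * (1 / (eps * real n))
     + (real n * (exp (- real K) * ball_mgf \<kappa> (exp 1) k (2 * (l * h)))) * (1 / (eps * real n))
     + (2 * real n * (real D * (t' * real n) + exp (- real D) * (real n * ball_mgf \<kappa> (exp 2) k 1))
        + real n * ball_mgf \<kappa> (exp 1) k (2 * (l' * h + 1))) * (1 / (eps' * (real n)\<^sup>2))"
  proof (intro add_mono mult_right_mono mult_left_mono order_refl)
    show "EV R (\<lambda>es. w (set es)) \<le> PR R {es. (q + eps) * real n \<le> real (card {x \<in> V. wit (set es) K x})}"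
      unfolding w_def EV_of_bool by simp
    show "EV R (\<lambda>es. EV ?q (\<lambda>\<pi>. real (card (LCs l (set es) \<pi>)))) \<le> t * real n"
      using LC by (simp add: LCs_def R_def V_def)
    show "EV R (\<lambda>es. EV ?q (\<lambda>\<pi>. real (card (LCs l' (set es) \<pi>)))) \<le> t' * real n"
      using LC' by (simp add: LCs_def R_def V_def)
    show "EV R (\<lambda>es. B (set es)) \<le> real n * (exp (- real K) * ball_mgf \<kappa> (exp 1) k (2 * (l * h)))"
      using EV_big_balls[of V k \<kappa> m K "2 * (l * h)"] k \<kappa> n unfolding B_def R_def V_def by simp
    show "EV R (\<lambda>es. M (set es)) \<le> real n * ball_mgf \<kappa> (exp 2) k 1"
      using EV_sum_ball_mgf[of V k \<kappa> m "exp 2" 1] k \<kappa> n unfolding M_def R_def V_def by simp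
    show "EV R (\<lambda>es. S (set es)) \<le> real n * ball_mgf \<kappa> (exp 1) k (2 * (l' * h + 1))"
      using EV_sum_ball_card[of V k \<kappa> m "2 * (l' * h + 1)"] k \<kappa> n unfolding S_def R_def V_def by simp
  qed (use eps n in auto)
  also have "\<dots> = eps' / (d / (2 * real K))\<^sup>2 + PR R {es. (q + eps) * real n \<le> real (card {x \<in> V. wit (set es) K x})}
     + t / eps + exp (- real K) * ball_mgf \<kappa> (exp 1) k (2 * (l * h)) / eps
     + (2 * (real D * t' + exp (- real D) * ball_mgf \<kappa> (exp 2) k 1) + ball_mgf \<kappa> (exp 1) k (2 * (l' * h + 1)) / real n) / eps'"
  proof -
    have 1: "(a * real n) * (1 / (eps * real n)) = a / eps" "(real n * a) * (1 / (eps * real n)) = a / eps" for a using n by auto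
    have 2: "(2 * real n * (b * (a * real n) + c * (real n * e)) + real n * g) * (1 / (eps' * (real n)\<^sup>2)) =
        (2 * (b * a + c * e) + g / real n) / eps'" for a b c e g
      using n eps(2) by (simp add: field_simps power2_eq_square)
    show ?thesis unfolding 1 2 ..
  qed
  finally show ?thesis by simp
qed

section \<open>The main theorem\<close>

lemma r_core_nonneg: "0 \<le> r_core k"
  unfolding r_core_def by (intro cSup_upper bdd_aboveI[of _ 1]) auto

text \<open>\<open>GREATEST\<close> is meaningful only once a maximum is known to exist. All fixed
  points are at most 1; the nonnegative ones form a compact set, which contains 0 because k - 1 is
  positive, and the negative ones lie below its maximum.\<close>

lemma Q_max_fixpoint:
  assumes k: "k \<ge> 2" and r: "r \<ge> 0"
  shows "Q_max k r = 1 - exp (- real k * r * Q_max k r ^ (k - 1))" "0 \<le> Q_max k r" "Q_max k r \<le> 1"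
proof -
  let ?g = "\<lambda>Q :: real. 1 - exp (- real k * r * Q ^ (k - 1))"
  let ?F = "{Q \<in> {0..1}. Q = ?g Q}"
  have le1: "Q \<le> 1" if "Q = ?g Q" for Q using that exp_gt_zero[of "- real k * r * Q ^ (k - 1)"] by linarith
  have "closed {Q. Q = ?g Q}" by (intro closed_Collect_eq continuous_intros)
  then have "compact ({0..1} \<inter> {Q. Q = ?g Q})" by (intro compact_Int_closed compact_Icc)
  then have "compact ?F" by (simp add: Int_def)
  moreover have "0 \<in> ?F" using k by auto
  ultimately have "\<exists>M\<in>?F. \<forall>Q\<in>?F. Q \<le> M" by (intro compact_attains_sup) blast+
  then obtain M where M: "M \<in> ?F" "\<And>Q. Q \<in> ?F \<Longrightarrow> Q \<le> M" by blast
  have "Q_max k r = M"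
    unfolding Q_max_def
  proof (rule Greatest_equality)
    show "M = ?g M" using M(1) by blast
    fix Q assume Q: "Q = ?g Q"
    show "Q \<le> M"
    proof (cases "Q \<ge> 0")
      case True
      then show ?thesis using M(2)[of Q] Q le1[OF Q] by auto
    next
      case False
      then show ?thesis using M(1) by auto
    qed
  qed
  then show "Q_max k r = ?g (Q_max k r)" "0 \<le> Q_max k r" "Q_max k r \<le> 1" using M(1) by auto
qed

lemma mu_ge:
  assumes "k \<ge> 2" "r \<ge> 0"
  shows "1 - Q_max k r \<le> \<mu> k r"
proof -
  let ?c = "real k * r * Q_max k r ^ (k - 1)"
  have "1 - Q_max k r = exp (- ?c)" using Q_max_fixpoint(1)[OF assms] by simp
  moreover have "0 \<le> ?c" using Q_max_fixpoint(2)[OF assms] assms by simp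
  ultimately show ?thesis by (simp add: \<mu>_def Let_def)
qed

text \<open>Each of the six terms of \<open>success_prob_le\<close> is brought below \<xi>. The
  constants are chosen in the order l, K, eps', D, t', l': K has to beat the balls of radius 2 l h,
  and the variance has to be small on a scale set by K, which takes a second chain length
  l'.\<close>

lemma success_prob_eventually_le:
  fixes k h :: nat and r q \<delta> \<xi> :: real and \<tau> :: "rooted_xorsat \<Rightarrow> real"
  assumes k: "1 \<le> k" and r: "0 \<le> r" and q: "0 \<le> q" "q \<le> 1" "exp (- (real k * r * (1 - q) ^ (k - 1))) \<le> q"
    and \<delta>: "q < \<delta>" and \<xi>: "\<xi> > 0"
    and free: "dec_free \<tau> (2 * h) (rand_xorsat_density k r) \<delta>"
  shows "\<forall>\<^sub>F n in sequentially. PR (dec_on \<tau> (2 * h) (rand_xorsat_density k r n)) {(\<Phi>, \<sigma>, f). \<sigma> \<in> solutions \<Phi>} \<le> 6 * \<xi>"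
proof -
  define \<kappa> where "\<kappa> = real k * r"
  \<comment> \<open>Half of the gap between \<delta> and q is kept as d; eps is so small that the
    losses (\<delta> + 3) eps use up at most the other half.\<close>
  define d where "d = (\<delta> - q) / 2"
  define eps where "eps = min \<xi> ((\<delta> - q) / (2 * (\<delta> + 3)))"
  have \<kappa>0: "0 \<le> \<kappa>" using r by (simp add: \<kappa>_def)
  have d: "d > 0" using \<delta> by (simp add: d_def)
  have \<delta>0: "\<delta> \<ge> 0" using \<delta> q by simp
  have eps: "eps > 0" "eps \<le> \<xi>" using \<xi> \<delta> \<delta>0 by (auto simp: eps_def)
  have "eps \<le> (\<delta> - q) / (2 * (\<delta> + 3))" by (simp add: eps_def)
  then have "eps * (2 * (\<delta> + 3)) \<le> \<delta> - q" using \<delta>0 by (simp add: le_divide_eq)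
  then have gap: "d \<le> \<delta> * (1 - eps) - q - 3 * eps" by (simp add: d_def field_simps)
  note small = long_chain_small[where k = k and \<kappa> = \<kappa> and h = h]
  obtain l where l: "\<And>V m. finite V \<Longrightarrow> 1 \<le> k \<Longrightarrow> k \<le> card V \<Longrightarrow> 0 \<le> \<kappa> \<Longrightarrow> real (k * m) \<le> \<kappa> * rcard V \<Longrightarrow>
    mean_chains V k m h l \<le> (eps * \<xi>) * rcard V"
    using small[of "eps * \<xi>"] eps \<xi> by auto
  obtain K :: nat where K: "K \<ge> 1" "exp (- real K) * ball_mgf \<kappa> (exp 1) k (2 * (l * h)) \<le> eps * \<xi>"
    using exp_minus_nat_small[of "eps * \<xi>"] eps \<xi> by auto
  \<comment> \<open>Makes the first term of \<open>success_prob_le\<close> equal to \<xi>.\<close>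
  define eps' where "eps' = \<xi> * (d / (2 * real K))\<^sup>2"
  have eps': "eps' > 0" using \<xi> d K by (simp add: eps'_def)
  \<comment> \<open>The two summands with an eighth each are doubled later and make up one half; the
    other half is left for the term of order 1 / n.\<close>
  obtain D :: nat where D: "D \<ge> 1" "exp (- real D) * ball_mgf \<kappa> (exp 2) k 1 \<le> eps' * \<xi> / 8"
    using exp_minus_nat_small[of "eps' * \<xi> / 8"] eps' \<xi> by auto
  define t' where "t' = eps' * \<xi> / (8 * real D)"
  have "t' > 0" using eps' \<xi> D by (simp add: t'_def)
  obtain l' where l': "\<And>V m. finite V \<Longrightarrow> 1 \<le> k \<Longrightarrow> k \<le> card V \<Longrightarrow> 0 \<le> \<kappa> \<Longrightarrow> real (k * m) \<le> \<kappa> * rcard V \<Longrightarrow>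
    mean_chains V k m h l' \<le> t' * rcard V"
    using small[OF \<open>t' > 0\<close>] by auto
  let ?g = "ball_mgf \<kappa> (exp 1) k (2 * (l' * h + 1))"
  obtain \<eta> N1 where \<eta>: "\<eta> > 0" and N1: "\<And>V :: nat set. \<And>m. finite V \<Longrightarrow> N1 \<le> card V \<Longrightarrow>
      \<bar>real m - r * rcard V\<bar> \<le> \<eta> * rcard V \<Longrightarrow>
      many_wit V k m K (q + eps) \<le> eps"
    using wit_density[OF k r q eps(1), of K] by blast
  obtain N2 :: nat where N2: "1 / \<eta> \<le> real N2" using real_arch_simple by blast
  obtain N3 :: nat where N3: "?g * 2 / (eps' * \<xi>) \<le> real N3" using real_arch_simple by blast
  let ?Pn = "\<lambda>n. dec_on \<tau> (2 * h) (rand_xorsat_density k r n)"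
  have "(\<lambda>n. PR (?Pn n) {(\<Phi>, \<sigma>, f). real f \<ge> \<delta> * real n}) \<longlonglongrightarrow> 1"
    using free unfolding dec_free_def whp_def by (simp add: case_prod_unfold)
  then have "\<forall>\<^sub>F n in sequentially. 1 - eps * \<xi> < PR (?Pn n) {(\<Phi>, \<sigma>, f). real f \<ge> \<delta> * real n}"
    using eps \<xi> by (intro order_tendstoD(1)) auto
  then show ?thesis using eventually_ge_at_top[of "N1 + N2 + N3 + k"]
  proof eventually_elim
    case (elim n)
    define m where "m = nat \<lfloor>r * real n\<rfloor>"
    let ?V = "{1..n}"
    have n: "N1 \<le> n" "N2 \<le> n" "N3 \<le> n" "k \<le> n" "n > 0" using elim(2) k by auto
    have rn: "0 \<le> r * real n" using r by simp
    have m: "real m \<le> r * real n" "r * real n - 1 \<le> real m"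
      unfolding m_def using rn by (auto simp: of_nat_nat)
    have km: "real (k * m) \<le> \<kappa> * real n" using m(1) mult_left_mono[of "real m" "r * real n" "real k"] by (simp add: \<kappa>_def mult.assoc)
    have P: "?Pn n = dec_on \<tau> (2 * h) (rand_xorsat k n m)" by (simp add: rand_xorsat_density_def m_def)
    have "1 \<le> \<eta> * real n"
    proof -
      have "1 / \<eta> \<le> real n" using N2 n by linarith
      then show ?thesis using \<eta> by (simp add: divide_le_eq mult.commute)
    qed
    then have W: "PR (iid m (rand_edge ?V k)) {es. (q + eps) * real n \<le> real (card {x \<in> ?V. wit (set es) K x})} \<le> eps"
      using N1[of ?V m] n m by (simp add: abs_le_iff)
    have compl: "{(\<Phi>, \<sigma>, f). real f < \<delta> * real n} = UNIV - {(\<Phi>, \<sigma>, f). real f \<ge> \<delta> * real n}" by auto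
    have "PR (?Pn n) {(\<Phi>, \<sigma>, f). real f < \<delta> * real n} = 1 - PR (?Pn n) {(\<Phi>, \<sigma>, f). real f \<ge> \<delta> * real n}"
      unfolding compl using measure_pmf.prob_compl[of "{(\<Phi>, \<sigma>, f). real f \<ge> \<delta> * real n}" "?Pn n"] by simp
    then have Fr: "PR (?Pn n) {(\<Phi>, \<sigma>, f). real f < \<delta> * real n} \<le> eps * \<xi>" using elim(1) by linarith
    have "PR (?Pn n) {(\<Phi>, \<sigma>, f). \<sigma> \<in> solutions \<Phi>} \<le>
       eps' / (d / (2 * real K))\<^sup>2
       + PR (iid m (rand_edge ?V k)) {es. (q + eps) * real n \<le> real (card {x \<in> ?V. wit (set es) K x})}
       + eps * \<xi> / eps + exp (- real K) * ball_mgf \<kappa> (exp 1) k (2 * (l * h)) / eps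
       + (2 * (real D * t' + exp (- real D) * ball_mgf \<kappa> (exp 2) k 1) + ?g / real n) / eps'
       + PR (?Pn n) {(\<Phi>, \<sigma>, f). real f < \<delta> * real n} / eps"
      unfolding P
    proof (rule success_prob_le[OF k n(4) \<kappa>0 km K(1) eps(1) eps' d \<delta>0 gap])
      show "mean_chains ?V k m h l \<le> eps * \<xi> * real n"
        using l[of ?V m] k n km \<kappa>0 by simp
      show "mean_chains ?V k m h l' \<le> t' * real n"
        using l'[of ?V m] k n km \<kappa>0 by simp
    qed
    also have "eps' / (d / (2 * real K))\<^sup>2 = \<xi>" using d K by (simp add: eps'_def)
    also have "PR (iid m (rand_edge ?V k)) {es. (q + eps) * real n \<le> real (card {x \<in> ?V. wit (set es) K x})} \<le> \<xi>"
      using W eps(2) by linarith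
    also have "eps * \<xi> / eps = \<xi>" using eps by simp
    also have "exp (- real K) * ball_mgf \<kappa> (exp 1) k (2 * (l * h)) / eps \<le> \<xi>"
      using K(2) eps(1) by (simp add: divide_le_eq mult.commute)
    also have "(2 * (real D * t' + exp (- real D) * ball_mgf \<kappa> (exp 2) k 1) + ?g / real n) / eps' \<le> \<xi>"
    proof -
      have "real D * t' = eps' * \<xi> / 8" using D(1) by (simp add: t'_def)
      moreover have "?g / real n \<le> eps' * \<xi> / 2"
      proof -
        have "?g * 2 / (eps' * \<xi>) \<le> real n" using N3 n by linarith
        then have "?g * 2 \<le> real n * (eps' * \<xi>)" using eps' \<xi> by (simp add: divide_le_eq)
        then show ?thesis using n by (simp add: divide_le_eq mult.commute)
      qed
      ultimately have "2 * (real D * t' + exp (- real D) * ball_mgf \<kappa> (exp 2) k 1) + ?g / real n \<le> \<xi> * eps'"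
        using D(2) by (simp add: mult.commute)
      then show ?thesis using eps' by (simp only: divide_le_eq if_True)
    qed
    also have "PR (?Pn n) {(\<Phi>, \<sigma>, f). real f < \<delta> * real n} / eps \<le> \<xi>"
      using Fr eps(1) by (simp add: divide_le_eq mult.commute)
    finally show ?case by simp
  qed
qed

theorem theorem1:
  fixes k R :: nat and r r_sat :: real and \<tau> :: "rooted_xorsat \<Rightarrow> real"
  assumes "k \<ge> 3"
    and "is_sat_threshold k r_sat"
    and "r_core k < r" and "r < r_sat"
    and "even R" and "local_rule R \<tau>"
    and "dec_strictly_free \<tau> R (rand_xorsat_density k r) (2 * \<mu> k r)"
  shows "(\<lambda>n. measure_pmf.prob (dec_on \<tau> R (rand_xorsat_density k r n))
            {(\<Phi>, \<sigma>, f). \<sigma> \<in> solutions \<Phi>}) \<longlonglongrightarrow> 0"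
proof -
  define Q where "Q = Q_max k r"
  have k: "k \<ge> 2" "1 \<le> k" using assms(1) by auto
  have r: "0 \<le> r" using r_core_nonneg[of k] assms(3) by linarith
  note Q = Q_max_fixpoint[OF k(1) r, folded Q_def]
  \<comment> \<open>With q = 1 - Q the last condition is the fixed point equation of Q.\<close>
  have q: "0 \<le> 1 - Q" "1 - Q \<le> 1" "exp (- (real k * r * (1 - (1 - Q)) ^ (k - 1))) \<le> 1 - Q"
    using Q by auto
  obtain h where R: "R = 2 * h" using assms(5) by blast
  obtain \<delta> where \<delta>: "\<delta> > 2 * \<mu> k r" "dec_free \<tau> (2 * h) (rand_xorsat_density k r) \<delta>"
    using assms(7) unfolding dec_strictly_free_def R by blast
  have "1 - Q \<le> \<mu> k r" unfolding Q_def by (rule mu_ge[OF k(1) r])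
  then have q\<delta>: "1 - Q < \<delta>" using \<delta>(1) q(1) by linarith
  show ?thesis
  proof (rule order_tendstoI)
    fix a :: real assume "0 < a"
    \<comment> \<open>Seven instead of six makes the final inequality strict.\<close>
    then have "a / 7 > 0" by simp
    from success_prob_eventually_le[OF k(2) r q q\<delta> this \<delta>(2)]
    show "\<forall>\<^sub>F n in sequentially. measure_pmf.prob (dec_on \<tau> R (rand_xorsat_density k r n))
            {(\<Phi>, \<sigma>, f). \<sigma> \<in> solutions \<Phi>} < a"
      unfolding R by eventually_elim (use \<open>0 < a\<close> in linarith)
  qed (auto intro!: always_eventually less_le_trans[OF _ measure_nonneg])
qed

end
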